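(* Let $L_t:\mathbb{R}^d\times\mathbb{R}^d\to\mathbb{R}$ be a 1-periodic Tonelli Lagrangian on $\mathbb{R}^d$ whose Euler-Lagrange solutions are defined for all time, and let $A$ be its action functional on 1-periodic curves. The Morse index of $A$ at a critical point $\gamma$ coincides with the Maslov index of the associated symplectic path $\Gamma$, i.e. $\mathrm{ind}(\gamma)=\mathrm{mas}(\Gamma)$.
   Context: Lagrangian setting. A Tonelli Lagrangian on $\mathbb{R}^d$ is a smooth function $(t,q,v)\mapsto L_t(q,v)$ with $L_{t+1}=L_t$, with $\partial^2_{vv}L_t(q,v)$ positive definite for all $t,q,v$, and with superlinear growth $\lim_{|v|\to\infty}L_t(q,v)/|v|=\infty$ for all $t,q$. It is assumed that all solutions of the Euler-Lagrange equation $\frac{d}{dt}\partial_vL_t(\gamma,\dot\gamma)-\partial_qL_t(\gamma,\dot\gamma)=0$ are defined for all time. The action functional is $A:C^\infty(\mathbb{R}/\mathbb{Z};\mathbb{R}^d)\to\mathbb{R}$, $A(\gamma)=\int_0^1L_t(\gamma(t),\dot\gamma(t))\,dt$; its critical points are the 1-periodic solutions of the Euler-Lagrange equation. The Hessian of $A$ at a critical point $\gamma$ is the symmetric bilinear form on $C^\infty(\mathbb{R}/\mathbb{Z};\mathbb{R}^d)$ $$\mathrm{Hess}A(\gamma)[\xi,\eta]=\int_0^1\big(\langle\alpha\dot\xi,\dot\eta\rangle+\langle\beta\xi,\dot\eta\rangle+\langle\dot\xi,\beta\eta\rangle+\langle\delta\xi,\eta\rangle\big)dt,$$ where $\alpha_t=\partial_{vv}L_t$,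 $\beta_t=\partial_{qv}L_t$, $\delta_t=\partial_{qq}L_t$ evaluated at $(\gamma(t),\dot\gamma(t))$ (with $\langle\beta\xi,w\rangle$ the mixed derivative in the directions $\xi$ for $q$ and $w$ for $v$). The Morse index $\mathrm{ind}(\gamma)$ is the supremum of the dimensions of subspaces on which this form is negative definite. Hamiltonian setting. The dual Hamiltonian is $H_t(q,p)=\max_{v}\{\langle p,v\rangle-L_t(q,v)\}$ on $\mathbb{R}^{2d}$ with $\omega=dq\wedge dp$; $\phi_H^t$ is the flow (starting at time $0$, $\phi_H^0=\mathrm{id}$) of the vector field $X_{H_t}$ defined by $\omega(X_{H_t},\cdot)=dH_t$, i.e. $\dot q=\partial_pH_t$, $\dot p=-\partial_qH_t$. The symplectic path associated to $\gamma$ is $\Gamma:[0,1]\to\mathrm{Sp}(2d)$, $\Gamma(t)=d\phi_H^t\big(\gamma(0),\partial_vL_0(\gamma(0),\dot\gamma(0))\big)$. Maslov index. A matrix $P_j\in\mathrm{Sp}(2d)$ is described by the quadratic generating function $f_j(X,Y)=\tfrac12\langle A_jX,X\rangle+\langle B_jX,Y\rangle+\tfrac12\langle C_jY,Y\rangle$ ($A_j,C_j$ symmetric, $B_j$ arbitrary real $d\times d$ matrices) if $P_j(X_j,Y_j)=(X_{j+1},Y_{j+1})$ if and only if $X_{j+1}-X_j=-B_jX_{j+1}-C_jY_j$ and $Y_{j+1}-Y_j=A_jX_{j+1}+B_j^TY_j$; this holds for all symplectic matrices close enough to $I$. Given a continuous path $\Gamma:[0,1]\to\mathrm{Sp}(2d)$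 with $\Gamma(0)=I$, choose $k$ large enough that $\Gamma(t_2)\Gamma(t_1)^{-1}$ is described by a quadratic generating function whenever $t_1,t_2\in[0,1]$, $|t_1-t_2|\leq1/k$; let $f_j$ be the quadratic generating function of $P_j=\Gamma(\tfrac{j+1}k)\Gamma(\tfrac jk)^{-1}$, $j=0,\dots,k-1$, and let $h$ be the symmetric bilinear form on $\mathbb{R}^{2dk}$ with $$\tfrac12h(\boldsymbol Z,\boldsymbol Z)=\sum_{j\in\mathbb{Z}_k}\big(\langle Y_j,X_{j+1}-X_j\rangle+f_j(X_{j+1},Y_j)\big),\qquad\boldsymbol Z=(X_0,Y_0,\dots,X_{k-1},Y_{k-1}).$$ Then $\mathrm{mas}(\Gamma):=\mathrm{ind}(h)-dk$, where $\mathrm{ind}(h)$ is the maximal dimension of a subspace on which $h$ is negative definite; this integer does not depend on the choice of the sufficiently large $k$. *)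

theory Defs
  imports "HOL-Analysis.Analysis" "HOL-Library.Function_Algebras" "HOL-Library.Extended_Nat"
begin

section \<open>Linear algebra and calculus\<close>

text \<open>
  Pointwise scalar multiplication makes functions into a real vector space, so that
  \<open>subspace\<close>, \<open>span\<close> and \<open>dim\<close> apply to sets of loops and to sets of finite sequences.
\<close>

instantiation "fun" :: (type, real_vector) real_vector
begin

definition scaleR_fun :: "real \<Rightarrow> ('a \<Rightarrow> 'b) \<Rightarrow> 'a \<Rightarrow> 'b"
  where "scaleR_fun c f = (\<lambda>x. c *\<^sub>R f x)"

instance
  by standard
    (simp_all add: scaleR_fun_def plus_fun_def fun_eq_iff scaleR_add_right scaleR_add_left)

end

text \<open>The library's \<open>dim\<close> is \<open>0\<close> on infinite-dimensional subspaces; here these have dimension \<open>\<infinity>\<close>.\<close>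

definition edim :: "'a::real_vector set \<Rightarrow> enat"
  where "edim S = (if \<exists>B. finite B \<and> S \<subseteq> span B then enat (dim S) else \<infinity>)"

definition negative_definite_on :: "'a::real_vector set \<Rightarrow> ('a \<Rightarrow> 'a \<Rightarrow> real) \<Rightarrow> bool"
  where "negative_definite_on S b \<longleftrightarrow> (\<forall>x\<in>S. x \<noteq> 0 \<longrightarrow> b x x < 0)"

definition form_index :: "'a::real_vector set \<Rightarrow> ('a \<Rightarrow> 'a \<Rightarrow> real) \<Rightarrow> enat"
  where "form_index V b =
    (SUP S \<in> {S. subspace S \<and> S \<subseteq> V \<and> negative_definite_on S b}. edim S)"

text \<open>
  \<open>C\<^sup>k\<close> maps on a whole space. In finite dimension, continuity of all iterated directional
  derivatives is the same as continuity of the iterated Frechet derivatives.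
\<close>

primrec Ck :: "nat \<Rightarrow> ('a::real_normed_vector \<Rightarrow> 'b::real_normed_vector) \<Rightarrow> bool" where
  "Ck 0 f \<longleftrightarrow> continuous_on UNIV f"
| "Ck (Suc k) f \<longleftrightarrow>
     (\<forall>x. f differentiable (at x)) \<and> (\<forall>u. Ck k (\<lambda>x. frechet_derivative f (at x) u))"

definition smooth :: "('a::real_normed_vector \<Rightarrow> 'b::real_normed_vector) \<Rightarrow> bool"
  where "smooth f \<longleftrightarrow> (\<forall>k. Ck k f)"

definition grad :: "(real^'d \<Rightarrow> real) \<Rightarrow> real^'d \<Rightarrow> real^'d"
  where "grad f x = (\<chi> i. frechet_derivative f (at x) (axis i 1))"

abbreviation velocity :: "(real \<Rightarrow> 'a::real_normed_vector) \<Rightarrow> real \<Rightarrow> 'a"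
  where "velocity \<gamma> t \<equiv> vector_derivative \<gamma> (at t)"


section \<open>Tonelli Lagrangians and the action functional\<close>

type_synonym 'd lagrangian = "real \<Rightarrow> real^'d \<Rightarrow> real^'d \<Rightarrow> real"

definition dq :: "'d::finite lagrangian \<Rightarrow> real \<Rightarrow> real^'d \<Rightarrow> real^'d \<Rightarrow> real^'d"
  where "dq L t q v = grad (\<lambda>q'. L t q' v) q"

definition dv :: "'d::finite lagrangian \<Rightarrow> real \<Rightarrow> real^'d \<Rightarrow> real^'d \<Rightarrow> real^'d"
  where "dv L t q v = grad (\<lambda>v'. L t q v') v"

text \<open>The second derivatives are linear endomorphisms of \<open>\<real>\<^sup>d\<close>, applied to the last argument.\<close>

definition dvv :: "'d::finite lagrangian \<Rightarrow> real \<Rightarrow> real^'d \<Rightarrow> real^'d \<Rightarrow> real^'d \<Rightarrow> real^'d"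
  where "dvv L t q v = frechet_derivative (\<lambda>v'. dv L t q v') (at v)"

text \<open>\<open>dqv L t q v \<xi> \<bullet> w\<close> is the mixed derivative in the directions \<open>\<xi>\<close> for \<open>q\<close> and \<open>w\<close> for \<open>v\<close>.\<close>

definition dqv :: "'d::finite lagrangian \<Rightarrow> real \<Rightarrow> real^'d \<Rightarrow> real^'d \<Rightarrow> real^'d \<Rightarrow> real^'d"
  where "dqv L t q v = frechet_derivative (\<lambda>q'. dv L t q' v) (at q)"

definition dqq :: "'d::finite lagrangian \<Rightarrow> real \<Rightarrow> real^'d \<Rightarrow> real^'d \<Rightarrow> real^'d \<Rightarrow> real^'d"
  where "dqq L t q v = frechet_derivative (\<lambda>q'. dq L t q' v) (at q)"

definition tonelli :: "'d::finite lagrangian \<Rightarrow> bool"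
  where "tonelli L \<longleftrightarrow>
    smooth (\<lambda>(t, q, v). L t q v) \<and>
    (\<forall>t q v. L (t + 1) q v = L t q v) \<and>
    (\<forall>t q v w. w \<noteq> 0 \<longrightarrow> 0 < dvv L t q v w \<bullet> w) \<and>
    (\<forall>t q. filterlim (\<lambda>v. L t q v / norm v) at_top at_infinity)"

text \<open>
  To be used for open \<open>I\<close>. If \<open>L\<close> is Tonelli, then \<open>dv L t q\<close> is injective with smooth local
  inverses, so solutions in this sense are automatically smooth.
\<close>

definition EL_solution_on :: "'d::finite lagrangian \<Rightarrow> real set \<Rightarrow> (real \<Rightarrow> real^'d) \<Rightarrow> bool"
  where "EL_solution_on L I \<gamma> \<longleftrightarrow>
    (\<forall>t\<in>I. \<gamma> differentiable (at t) \<and>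
      ((\<lambda>s. dv L s (\<gamma> s) (velocity \<gamma> s)) has_vector_derivative
         dq L t (\<gamma> t) (velocity \<gamma> t)) (at t))"

definition EL_complete :: "'d::finite lagrangian \<Rightarrow> bool"
  where "EL_complete L \<longleftrightarrow>
    (\<forall>I \<gamma>. open I \<and> is_interval I \<and> I \<noteq> {} \<and> EL_solution_on L I \<gamma> \<longrightarrow>
      (\<exists>\<gamma>'. EL_solution_on L UNIV \<gamma>' \<and> (\<forall>t\<in>I. \<gamma>' t = \<gamma> t)))"

text \<open>\<open>C\<^sup>\<infinity>(\<real>/\<int>; \<real>\<^sup>d)\<close>, as 1-periodic functions on \<open>\<real>\<close>\<close>

definition loops :: "(real \<Rightarrow> real^'d) set"
  where "loops = {\<gamma>. smooth \<gamma> \<and> (\<forall>t. \<gamma> (t + 1) = \<gamma> t)}"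

definition action :: "'d::finite lagrangian \<Rightarrow> (real \<Rightarrow> real^'d) \<Rightarrow> real"
  where "action L \<gamma> = integral {0..1} (\<lambda>t. L t (\<gamma> t) (velocity \<gamma> t))"

definition critical_point :: "'d::finite lagrangian \<Rightarrow> (real \<Rightarrow> real^'d) \<Rightarrow> bool"
  where "critical_point L \<gamma> \<longleftrightarrow> \<gamma> \<in> loops \<and>
    (\<forall>\<xi>\<in>loops. ((\<lambda>s. action L (\<gamma> + s *\<^sub>R \<xi>)) has_real_derivative 0) (at 0))"

definition hess_action ::
  "'d::finite lagrangian \<Rightarrow> (real \<Rightarrow> real^'d) \<Rightarrow> (real \<Rightarrow> real^'d) \<Rightarrow> (real \<Rightarrow> real^'d) \<Rightarrow> real"
  where "hess_action L \<gamma> \<xi> \<eta> = integral {0..1} (\<lambda>t.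
    (let \<alpha> = dvv L t (\<gamma> t) (velocity \<gamma> t);
         \<beta> = dqv L t (\<gamma> t) (velocity \<gamma> t);
         \<delta> = dqq L t (\<gamma> t) (velocity \<gamma> t)
     in \<alpha> (velocity \<xi> t) \<bullet> velocity \<eta> t + \<beta> (\<xi> t) \<bullet> velocity \<eta> t
        + velocity \<xi> t \<bullet> \<beta> (\<eta> t) + \<delta> (\<xi> t) \<bullet> \<eta> t))"

definition morse_index :: "'d::finite lagrangian \<Rightarrow> (real \<Rightarrow> real^'d) \<Rightarrow> enat"
  where "morse_index L \<gamma> = form_index loops (hess_action L \<gamma>)"


section \<open>The dual Hamiltonian and the associated symplectic path\<close>

type_synonym 'd phase = "(real^'d) \<times> (real^'d)"

text \<open>For Tonelli \<open>L\<close> the supremum is a maximum.\<close>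

definition dual_hamiltonian :: "'d::finite lagrangian \<Rightarrow> real \<Rightarrow> real^'d \<Rightarrow> real^'d \<Rightarrow> real"
  where "dual_hamiltonian L t q p = (SUP v. p \<bullet> v - L t q v)"

text \<open>The vector field with \<open>\<omega>(X, \<sqdot>) = dH\<close> for \<open>\<omega> = dq \<and> dp\<close>\<close>

definition ham_field ::
  "(real \<Rightarrow> real^'d \<Rightarrow> real^'d \<Rightarrow> real) \<Rightarrow> real \<Rightarrow> 'd::finite phase \<Rightarrow> 'd phase"
  where "ham_field H t = (\<lambda>(q, p). (grad (\<lambda>p'. H t q p') p, - grad (\<lambda>q'. H t q' p) q))"

text \<open>
  The description is unique when \<open>H\<close> is the dual Hamiltonian of a Tonelli Lagrangian, and the
  solution exists when in addition the Euler-Lagrange solutions are defined for all time.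
\<close>

definition ham_flow ::
  "(real \<Rightarrow> real^'d \<Rightarrow> real^'d \<Rightarrow> real) \<Rightarrow> real \<Rightarrow> 'd::finite phase \<Rightarrow> 'd phase"
  where "ham_flow H t z =
    (THE x. x 0 = z \<and> (\<forall>s. (x has_vector_derivative ham_field H s (x s)) (at s))) t"

text \<open>Linear endomorphisms of phase space stand for \<open>2d \<times> 2d\<close> matrices.\<close>

definition symplectic_path ::
  "'d::finite lagrangian \<Rightarrow> (real \<Rightarrow> real^'d) \<Rightarrow> real \<Rightarrow> 'd phase \<Rightarrow> 'd phase"
  where "symplectic_path L \<gamma> t =
    frechet_derivative (ham_flow (dual_hamiltonian L) t)
      (at (\<gamma> 0, dv L 0 (\<gamma> 0) (velocity \<gamma> 0)))"


section \<open>The Maslov index\<close>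

text \<open>The triple \<open>(A, B, C)\<close> encodes the quadratic form \<open>quad_form (A, B, C)\<close> below.\<close>

type_synonym 'd quad_data = "(real^'d^'d) \<times> (real^'d^'d) \<times> (real^'d^'d)"

definition quad_form :: "'d::finite quad_data \<Rightarrow> real^'d \<Rightarrow> real^'d \<Rightarrow> real"
  where "quad_form = (\<lambda>(A, B, C) X Y.
    1/2 * ((A *v X) \<bullet> X) + (B *v X) \<bullet> Y + 1/2 * ((C *v Y) \<bullet> Y))"

definition described_by :: "('d::finite phase \<Rightarrow> 'd phase) \<Rightarrow> 'd quad_data \<Rightarrow> bool"
  where "described_by P = (\<lambda>(A, B, C).
    transpose A = A \<and> transpose C = C \<and>
    (\<forall>X Y X' Y'. P (X, Y) = (X', Y') \<longleftrightarrow>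
       X' - X = - (B *v X') - C *v Y \<and> Y' - Y = A *v X' + transpose B *v Y))"

lemma described_by_unique:
  assumes "described_by P D" "described_by P D'"
  shows "D = D'"
proof -
  obtain A B C where D: "D = (A, B, C)" by (cases D)
  obtain A' B' C' where D': "D' = (A', B', C')" by (cases D')
  have *: "B *v x + C *v y = B' *v x + C' *v y
      \<and> A *v x + transpose B *v y = A' *v x + transpose B' *v y" for x y
  proof -
    define X where "X = x + B *v x + C *v y"
    define Y' where "Y' = y + A *v x + transpose B *v y"
    have "P (X, y) = (x, Y')"
      using assms(1) unfolding D described_by_def X_def Y'_def by (simp add: algebra_simps)
    then have "x - X = - (B' *v x) - C' *v y \<and> Y' - y = A' *v x + transpose B' *v y"
      using assms(2) unfolding D' described_by_def by blast
    then show ?thesis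
      unfolding X_def Y'_def by (simp add: algebra_simps)
  qed
  from *[of _ 0] *[of 0 _] show ?thesis
    unfolding D D' by (simp add: matrix_eq)
qed

definition generating_data :: "('d::finite phase \<Rightarrow> 'd phase) \<Rightarrow> 'd quad_data"
  where "generating_data P = (THE D. described_by P D)"

definition fine_enough :: "(real \<Rightarrow> 'd::finite phase \<Rightarrow> 'd phase) \<Rightarrow> nat \<Rightarrow> bool"
  where "fine_enough \<Gamma> k \<longleftrightarrow> 0 < k \<and>
    (\<forall>t1\<in>{0..1}. \<forall>t2\<in>{0..1}. \<bar>t1 - t2\<bar> \<le> 1 / real k \<longrightarrow>
       (\<exists>D. described_by (\<Gamma> t2 \<circ> inv (\<Gamma> t1)) D))"

definition step_data :: "(real \<Rightarrow> 'd::finite phase \<Rightarrow> 'd phase) \<Rightarrow> nat \<Rightarrow> nat \<Rightarrow> 'd quad_data"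
  where "step_data \<Gamma> k j =
    generating_data (\<Gamma> (real (j + 1) / real k) \<circ> inv (\<Gamma> (real j / real k)))"

text \<open>\<open>\<real>\<^bsup>2dk\<^esup>\<close>, as sequences \<open>Z j = (X\<^sub>j, Y\<^sub>j)\<close> vanishing from \<open>k\<close> on\<close>

definition chains :: "nat \<Rightarrow> (nat \<Rightarrow> 'd::finite phase) set"
  where "chains k = {Z. \<forall>j\<ge>k. Z j = 0}"

definition discrete_action ::
  "(real \<Rightarrow> 'd::finite phase \<Rightarrow> 'd phase) \<Rightarrow> nat \<Rightarrow> (nat \<Rightarrow> 'd phase) \<Rightarrow> real"
  where "discrete_action \<Gamma> k Z =
    (\<Sum>j<k. let X = fst (Z j); Y = snd (Z j); X' = fst (Z ((j + 1) mod k))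
            in Y \<bullet> (X' - X) + quad_form (step_data \<Gamma> k j) X' Y)"

text \<open>The symmetric bilinear form \<open>h\<close> with \<open>1/2 h(Z, Z) = discrete_action \<Gamma> k Z\<close>, by polarization\<close>

definition discrete_form ::
  "(real \<Rightarrow> 'd::finite phase \<Rightarrow> 'd phase) \<Rightarrow> nat \<Rightarrow> (nat \<Rightarrow> 'd phase) \<Rightarrow> (nat \<Rightarrow> 'd phase) \<Rightarrow> real"
  where "discrete_form \<Gamma> k Z W =
    discrete_action \<Gamma> k (Z + W) - discrete_action \<Gamma> k Z - discrete_action \<Gamma> k W"

text \<open>
  For continuous paths of symplectic matrices starting at the identity, a fine enough \<open>k\<close> exists
  and the value does not depend on its choice. The index of \<open>h\<close> is at most \<open>2dk\<close>, hence finite.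
\<close>

definition maslov_index :: "(real \<Rightarrow> 'd::finite phase \<Rightarrow> 'd phase) \<Rightarrow> int"
  where "maslov_index \<Gamma> =
    (let k = (SOME k. fine_enough \<Gamma> k)
     in int (the_enat (form_index (chains k) (discrete_form \<Gamma> k))) - int (CARD('d) * k))"

end

theory Submission
  imports Defs
begin

text \<open>
  Along \<open>\<gamma>\<close> the path \<open>\<Gamma>\<close> is the fundamental solution of the linear Hamiltonian system dual to the
  quadratic Lagrangian with coefficients \<open>\<alpha>\<close>, \<open>\<beta>\<close>, \<open>\<delta>\<close>. If a step is described by a generating
  function, Jacobi's argument shows that the second variation on it is nonnegative on curves that are
  free at the left end and vanish at the right end. Hence every block \<open>C\<^sub>j\<close> is negative definite, and the
  \<open>dk\<close> variables \<open>Y\<^sub>j\<close> contribute exactly \<open>dk\<close> to the index of \<open>h\<close>. Eliminating them turns \<open>h\<close> into the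
  second variation evaluated on broken extremals with prescribed values at the nodes. These minimize
  the second variation among curves with the same values at the nodes, so sampling a negative space of
  loops gives a negative space of chains; conversely broken extremals are approximated by smooth loops
  so that the Gram matrices converge.
\<close>

section \<open>Index of a form and negative families\<close>

text \<open>Both indices are compared through finite families with a negativity condition on
  coefficients. Such families can be lifted, enlarged, cut down by linear equations and perturbed
  without any dimension count in the infinite-dimensional space of loops. Finiteness of the Morse
  index falls out: a negative family of n loops yields one of n + dk chains, and chains have 2dk
  coordinates. The frame \<open>p = 0\<close> at the left end of a step, in place of the classical
  \<open>q = 0\<close>, is dictated by the generating function: with Y = 0 its first equation says
  that X' = 0 forces X = 0, so exactly this frame projects invertibly to positions as long as the
  step is described. The resulting nonnegativity covers curves with free left end, and this larger
  class is what makes \<open>C j\<close> negative definite, since the test curves there start away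
  from 0. The k in \<open>maslov_index\<close> is an arbitrary fine one. Every fine k is compared
  directly with the Morse index, which does not mention k.\<close>

text \<open>If \<open>b 0 0 = 0\<close> such a family is automatically linearly independent.\<close>

definition negative_family ::
  "'a::real_vector set \<Rightarrow> ('a \<Rightarrow> 'a \<Rightarrow> real) \<Rightarrow> 'i set \<Rightarrow> ('i \<Rightarrow> 'a) \<Rightarrow> bool"
  where "negative_family V b I e \<longleftrightarrow> finite I \<and>
    (\<forall>a. (\<Sum>i\<in>I. a i *\<^sub>R e i) \<in> V \<and>
      ((\<exists>i\<in>I. a i \<noteq> 0) \<longrightarrow> b (\<Sum>i\<in>I. a i *\<^sub>R e i) (\<Sum>i\<in>I. a i *\<^sub>R e i) < 0))"

lemma negative_family_le_form_index:
  assumes neg: "negative_family V b I e" and b0: "b 0 0 = 0"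
  shows "enat (card I) \<le> form_index V b"
proof -
  have fin: "finite I"
    and inV: "(\<Sum>i\<in>I. a i *\<^sub>R e i) \<in> V"
    and lt: "\<exists>i\<in>I. a i \<noteq> 0 \<Longrightarrow> b (\<Sum>i\<in>I. a i *\<^sub>R e i) (\<Sum>i\<in>I. a i *\<^sub>R e i) < 0" for a
    using neg by (auto simp: negative_family_def)
  have zero: "\<forall>i\<in>I. a i = 0" if "(\<Sum>i\<in>I. a i *\<^sub>R e i) = 0" for a
    using lt[of a] that b0 by fastforce
  have inj: "inj_on e I"
  proof (rule inj_onI, rule ccontr)
    fix i j assume ij: "i \<in> I" "j \<in> I" "e i = e j" "i \<noteq> j"
    \<comment> \<open>The coefficients 1 at i and -1 at j give \<open>e i - e j\<close>, which
      vanishes by assumption although the coefficients do not.\<close>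
    have "(\<Sum>l\<in>I. ((if l = i then 1 else 0) - (if l = j then 1 else 0)) *\<^sub>R e l)
        = (\<Sum>l\<in>I. (if l = i then e l else 0)) - (\<Sum>l\<in>I. (if l = j then e l else 0))"
      by (subst sum_subtractf[symmetric]) (intro sum.cong, auto simp: scaleR_diff_left)
    also have "\<dots> = 0" using ij fin by simp
    finally show False using zero[of "\<lambda>l. (if l = i then 1 else 0) - (if l = j then 1 else 0)"] ij
      by auto
  qed
  have ind: "independent (e ` I)"
  proof (rule independent_if_scalars_zero)
    show "finite (e ` I)" using fin by simp
    fix f x assume s: "(\<Sum>x\<in>e ` I. f x *\<^sub>R x) = 0" and x: "x \<in> e ` I"
    have "(\<Sum>i\<in>I. f (e i) *\<^sub>R e i) = 0"
      using s by (simp add: sum.reindex[OF inj] o_def)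
    then show "f x = 0" using zero[of "f \<circ> e"] x by (auto simp: o_def)
  qed
  have comb: "\<exists>a. x = (\<Sum>i\<in>I. a i *\<^sub>R e i)" if x: "x \<in> span (e ` I)" for x
  proof -
    obtain u where "x = (\<Sum>v\<in>e ` I. u v *\<^sub>R v)"
      using x unfolding span_finite[OF finite_imageI[OF fin]] by blast
    then have "x = (\<Sum>i\<in>I. u (e i) *\<^sub>R e i)" by (simp add: sum.reindex[OF inj] o_def)
    then show ?thesis by (intro exI[of _ "u \<circ> e"]) simp
  qed
  have "span (e ` I) \<subseteq> V" using comb inV by blast
  moreover have "negative_definite_on (span (e ` I)) b"
    unfolding negative_definite_on_def
  proof (intro ballI impI)
    fix x assume "x \<in> span (e ` I)" "x \<noteq> 0"
    with comb obtain a where "x = (\<Sum>i\<in>I. a i *\<^sub>R e i)" by blast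
    with \<open>x \<noteq> 0\<close> show "b x x < 0" using lt[of a] by (metis (mono_tags, lifting) scaleR_zero_left sum.neutral)
  qed
  moreover have "edim (span (e ` I)) = enat (card I)"
    using fin ind by (auto simp: edim_def card_image[OF inj] dim_span dim_eq_card_independent)
  ultimately show ?thesis
    unfolding form_index_def by (metis (mono_tags, lifting) SUP_upper mem_Collect_eq subspace_span)
qed

text \<open>Any n vectors of a basis of S serve. An infinite basis, the case
  \<open>edim S = \<infinity>\<close>, contains n of them for every n.\<close>

lemma le_edim_imp_negative_family:
  assumes S: "subspace S" "S \<subseteq> V" "negative_definite_on S b" and n: "enat n \<le> edim S"
  shows "\<exists>B. negative_family V b B id \<and> card B = n"
proof -
  obtain B where B: "B \<subseteq> S" "independent B" "S \<subseteq> span B" "card B = dim S"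
    using basis_exists by blast
  have "\<exists>B'\<subseteq>B. finite B' \<and> card B' = n"
  proof (cases "finite B")
    case True
    then have "n \<le> card B" using n B by (auto simp: edim_def split: if_splits)
    then show ?thesis by (metis obtain_subset_with_card_n)
  next
    case False then show ?thesis by (metis infinite_arbitrarily_large)
  qed
  then obtain B' where B': "B' \<subseteq> B" "finite B'" "card B' = n" by blast
  have ind: "independent B'" using B B' independent_mono by blast
  have "negative_family V b B' id"
    unfolding negative_family_def
  proof (intro conjI allI impI)
    fix a :: "'a \<Rightarrow> real"
    have inS: "(\<Sum>i\<in>B'. a i *\<^sub>R id i) \<in> S"
      using S(1) B B' by (intro subspace_sum subspace_scale) auto
    show "(\<Sum>i\<in>B'. a i *\<^sub>R id i) \<in> V" using inS S by blast
    assume "\<exists>i\<in>B'. a i \<noteq> 0"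
    then have "(\<Sum>i\<in>B'. a i *\<^sub>R id i) \<noteq> 0"
      using ind B' independent_explicit_finite_subsets by (fastforce simp: dependent_finite)
    then show "b (\<Sum>i\<in>B'. a i *\<^sub>R id i) (\<Sum>i\<in>B'. a i *\<^sub>R id i) < 0"
      using S(3) inS unfolding negative_definite_on_def by blast
  qed (use B' in auto)
  then show ?thesis using B' by blast
qed

text \<open>The upper bound is asked only of families indexed by themselves, since a hypothesis
  cannot range over all index types.\<close>

lemma form_index_eqI:
  assumes "negative_family V b I e" "card I = N" "b 0 0 = 0"
    and ub: "\<And>B. negative_family V b B id \<Longrightarrow> card B \<le> N"
  shows "form_index V b = enat N"
proof (rule antisym)
  show "enat N \<le> form_index V b"
    using negative_family_le_form_index[of V b I e] assms by simp
  show "form_index V b \<le> enat N"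
    unfolding form_index_def
  proof (rule SUP_least, clarify)
    fix S assume S: "subspace S" "S \<subseteq> V" "negative_definite_on S b"
    show "edim S \<le> enat N"
    proof (rule ccontr)
      assume "\<not> edim S \<le> enat N"
      then have "enat (Suc N) \<le> edim S" by (simp add: Suc_ile_eq)
      then obtain B where "negative_family V b B id" "card B = Suc N"
        using le_edim_imp_negative_family[OF S] by blast
      with ub show False by fastforce
    qed
  qed
qed

lemma negative_family_eq_form_index:
  assumes "negative_family V b I e" "form_index V b = enat N" "b 0 0 = 0"
  shows "card I \<le> N"
  using negative_family_le_form_index[OF assms(1,3)] assms(2) by simp

text \<open>Gaussian elimination on families, one functional at a time: a member on which the
  functional does not vanish becomes the pivot and is dropped, so at most \<open>card J\<close>
  members are lost. The last conjunct says that nontrivial combinations of the new family are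
  nontrivial combinations of the old one; this is how negativity is inherited.\<close>

lemma eliminate_functionals:
  fixes e :: "'i \<Rightarrow> 'a::real_vector" and \<phi> :: "'j \<Rightarrow> 'a \<Rightarrow> real"
  assumes "finite J" "finite I" and lin: "\<And>j. j \<in> J \<Longrightarrow> linear (\<phi> j)"
  shows "\<exists>(I' :: 'i set) (e' :: 'i \<Rightarrow> 'a). finite I' \<and> card I \<le> card I' + card J \<and>
    (\<forall>j\<in>J. \<forall>i\<in>I'. \<phi> j (e' i) = 0) \<and>
    (\<forall>a. (\<exists>i\<in>I'. a i \<noteq> 0) \<longrightarrow>
      (\<exists>a'. (\<exists>i\<in>I. a' i \<noteq> 0) \<and> (\<Sum>i\<in>I'. a i *\<^sub>R e' i) = (\<Sum>i\<in>I. a' i *\<^sub>R e i)))"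
  using assms
proof (induction J rule: finite_induct)
  case empty
  show ?case by (rule exI[of _ I], rule exI[of _ e]) (use empty in auto)
next
  case (insert j J)
  then obtain I' :: "'i set" and e' :: "'i \<Rightarrow> 'a" where I': "finite I'" "card I \<le> card I' + card J"
    and k: "\<forall>j\<in>J. \<forall>i\<in>I'. \<phi> j (e' i) = 0"
    and c: "\<And>a. \<exists>i\<in>I'. a i \<noteq> 0 \<Longrightarrow>
      \<exists>a'. (\<exists>i\<in>I. a' i \<noteq> 0) \<and> (\<Sum>i\<in>I'. a i *\<^sub>R e' i) = (\<Sum>i\<in>I. a' i *\<^sub>R e i)"
    by auto
  show ?case
  proof (cases "\<exists>i0\<in>I'. \<phi> j (e' i0) \<noteq> 0")
    case False
    then show ?thesis using I' k c insert.hyps by (intro exI[of _ I'] exI[of _ e']) auto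
  next
    case True
    then obtain i0 where i0: "i0 \<in> I'" "\<phi> j (e' i0) \<noteq> 0" by blast
    define r where "r i = \<phi> j (e' i) / \<phi> j (e' i0)" for i
    define e'' where "e'' i = e' i - r i *\<^sub>R e' i0" for i
    define I'' where "I'' = I' - {i0}"
    have cI: "card I' = Suc (card I'')" unfolding I''_def
      using i0 I' by (metis card_Suc_Diff1)
    have lin': "linear (\<phi> j')" if "j' \<in> insert j J" for j' using insert.prems that by blast
    have k'': "\<phi> j' (e'' i) = 0" if "j' \<in> insert j J" "i \<in> I''" for j' i
    proof -
      have "\<phi> j' (e'' i) = \<phi> j' (e' i) - r i * \<phi> j' (e' i0)"
        unfolding e''_def using lin'[OF that(1)] by (simp add: linear_diff linear_cmul)
      then show ?thesis using that k i0 by (auto simp: r_def I''_def)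
    qed
    have c'': "\<exists>a'. (\<exists>i\<in>I. a' i \<noteq> 0) \<and> (\<Sum>i\<in>I''. a i *\<^sub>R e'' i) = (\<Sum>i\<in>I. a' i *\<^sub>R e i)"
      if a: "\<exists>i\<in>I''. a i \<noteq> 0" for a
    proof -
      \<comment> \<open>The coefficient at the pivot collects the multiples of \<open>e' i0\<close>
        that are subtracted in the members \<open>e'' l\<close>.\<close>
      define b where "b i = (if i = i0 then - (\<Sum>l\<in>I''. a l * r l) else a i)" for i
      have "(\<Sum>i\<in>I'. b i *\<^sub>R e' i) = b i0 *\<^sub>R e' i0 + (\<Sum>i\<in>I''. b i *\<^sub>R e' i)"
        unfolding I''_def using i0 I' by (simp add: sum.remove)
      also have "(\<Sum>i\<in>I''. b i *\<^sub>R e' i) = (\<Sum>i\<in>I''. a i *\<^sub>R e' i)"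
        by (rule sum.cong) (auto simp: b_def I''_def)
      finally have "(\<Sum>i\<in>I'. b i *\<^sub>R e' i) = (\<Sum>i\<in>I''. a i *\<^sub>R e'' i)"
        by (simp add: e''_def b_def scaleR_diff_right sum_subtractf scaleR_sum_left)
      moreover have "\<exists>i\<in>I'. b i \<noteq> 0" using a by (auto simp: b_def I''_def)
      ultimately show ?thesis using c[of b] by auto
    qed
    show ?thesis
      using I' cI k'' c'' insert.hyps by (intro exI[of _ I''] exI[of _ e'']) (auto simp: I''_def)
  qed
qed

text \<open>A negative definite quadratic form has a negative maximum -m on the unit sphere of
  coefficients. A matrix whose entries differ from \<open>G\<close> by less than m in total is still
  negative there, and by homogeneity everywhere.\<close>

lemma gram_negative_open:
  fixes G :: "'i \<Rightarrow> 'i \<Rightarrow> real" and Gn :: "nat \<Rightarrow> 'i \<Rightarrow> 'i \<Rightarrow> real"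
  assumes fin: "finite I"
    and neg: "\<And>a. \<exists>i\<in>I. a i \<noteq> 0 \<Longrightarrow> (\<Sum>i\<in>I. \<Sum>l\<in>I. a i * a l * G i l) < 0"
    and lim: "\<And>i l. i \<in> I \<Longrightarrow> l \<in> I \<Longrightarrow> (\<lambda>n. Gn n i l) \<longlonglongrightarrow> G i l"
  shows "\<exists>n. \<forall>a. (\<exists>i\<in>I. a i \<noteq> 0) \<longrightarrow> (\<Sum>i\<in>I. \<Sum>l\<in>I. a i * a l * Gn n i l) < 0"
proof (cases "I = {}")
  case True then show ?thesis by auto
next
  case False
  \<comment> \<open>The unit sphere of coefficients inside the product space of all functions on the
    index type. Coordinates outside I are frozen at 0, so Tychonoff's theorem gives
    compactness.\<close>
  define K where "K = (PiE UNIV (\<lambda>i. if i \<in> I then {-1..1::real} else {0})) \<inter>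
     {a. (\<Sum>i\<in>I. (a i)\<^sup>2) = 1}"
  have cc: "continuous_on UNIV (\<lambda>a::'i \<Rightarrow> real. a i)" for i
    by (rule continuous_on_product_coordinates)
  have "compact (PiE UNIV (\<lambda>i. if i \<in> I then {-1..1::real} else {0}))"
    unfolding compactin_euclidean_iff[symmetric] euclidean_product_topology[symmetric]
    by (subst compactin_PiE) auto
  moreover have "closed {a::'i\<Rightarrow>real. (\<Sum>i\<in>I. (a i)\<^sup>2) = 1}"
    by (intro closed_Collect_eq continuous_intros cc)
  ultimately have compK: "compact K" unfolding K_def by (rule compact_Int_closed)
  obtain i1 where i1: "i1 \<in> I" using False by blast
  have "(\<lambda>i. if i = i1 then 1 else 0) \<in> K"
    using i1 fin unfolding K_def by (auto simp: if_distrib[of "\<lambda>x. x\<^sup>2"] cong: if_cong)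
  then have neK: "K \<noteq> {}" by blast
  have contG: "continuous_on K (\<lambda>a. \<Sum>i\<in>I. \<Sum>l\<in>I. a i * a l * G i l)"
    by (intro continuous_intros continuous_on_subset[OF cc subset_UNIV])
  obtain a0 where a0: "a0 \<in> K" and
    max: "\<And>a. a \<in> K \<Longrightarrow> (\<Sum>i\<in>I. \<Sum>l\<in>I. a i * a l * G i l) \<le> (\<Sum>i\<in>I. \<Sum>l\<in>I. a0 i * a0 l * G i l)"
    using continuous_attains_sup[OF compK neK contG] by blast
  define m where "m = - (\<Sum>i\<in>I. \<Sum>l\<in>I. a0 i * a0 l * G i l)"
  have "\<exists>i\<in>I. a0 i \<noteq> 0" using a0 unfolding K_def by (force intro: ccontr)
  then have "m > 0" unfolding m_def using neg[of a0] by simp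
  have "(\<lambda>n. \<Sum>i\<in>I. \<Sum>l\<in>I. \<bar>Gn n i l - G i l\<bar>) \<longlonglongrightarrow> (\<Sum>i\<in>I. \<Sum>l\<in>I. \<bar>G i l - G i l\<bar>)"
    by (intro tendsto_intros lim)
  then have "eventually (\<lambda>n. (\<Sum>i\<in>I. \<Sum>l\<in>I. \<bar>Gn n i l - G i l\<bar>) < m) sequentially"
    using \<open>m > 0\<close> by (intro order_tendstoD(2)) auto
  then obtain n where n: "(\<Sum>i\<in>I. \<Sum>l\<in>I. \<bar>Gn n i l - G i l\<bar>) < m"
    using eventually_happens by force
  have "(\<Sum>i\<in>I. \<Sum>l\<in>I. a i * a l * Gn n i l) < 0" if ex: "\<exists>i\<in>I. a i \<noteq> 0" for a
  proof -
    define s where "s = (\<Sum>i\<in>I. (a i)\<^sup>2)"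
    have s: "s > 0" unfolding s_def using ex fin
      by (metis (mono_tags, lifting) sum_pos2 zero_le_power2 zero_less_power2)
    define c where "c i = (if i \<in> I then a i / sqrt s else 0)" for i
    have c1: "(\<Sum>i\<in>I. (c i)\<^sup>2) = 1"
      using s by (simp add: c_def power_divide sum_divide_distrib[symmetric] s_def[symmetric])
    have cb: "\<bar>c i\<bar> \<le> 1" if "i \<in> I" for i
    proof -
      have "(c i)\<^sup>2 \<le> (\<Sum>i\<in>I. (c i)\<^sup>2)" using that fin by (intro member_le_sum) auto
      then show ?thesis using c1 by (simp add: abs_square_le_1)
    qed
    have "c i \<in> (if i \<in> I then {-1..1} else {0})" for i
      using cb[of i] by (cases "i \<in> I") (simp_all add: abs_le_iff, simp add: c_def)
    then have cK: "c \<in> K" unfolding K_def using c1 by (simp add: PiE_iff)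
    have "(\<Sum>i\<in>I. \<Sum>l\<in>I. c i * c l * Gn n i l) - (\<Sum>i\<in>I. \<Sum>l\<in>I. c i * c l * G i l)
       = (\<Sum>i\<in>I. \<Sum>l\<in>I. c i * c l * (Gn n i l - G i l))"
      by (simp add: sum_subtractf right_diff_distrib)
    also have "\<dots> \<le> (\<Sum>i\<in>I. \<Sum>l\<in>I. \<bar>Gn n i l - G i l\<bar>)"
    proof (intro sum_mono)
      fix i l assume "i \<in> I" "l \<in> I"
      then have "\<bar>c i\<bar> * \<bar>c l\<bar> \<le> 1" using cb by (simp add: mult_le_one)
      then have "\<bar>c i * c l * (Gn n i l - G i l)\<bar> \<le> 1 * \<bar>Gn n i l - G i l\<bar>"
        unfolding abs_mult by (intro mult_right_mono) auto
      from order_trans[OF abs_ge_self this]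
      show "c i * c l * (Gn n i l - G i l) \<le> \<bar>Gn n i l - G i l\<bar>" by (simp only: mult_1_left)
    qed
    finally have neg': "(\<Sum>i\<in>I. \<Sum>l\<in>I. c i * c l * Gn n i l) < 0"
      using n max[OF cK] unfolding m_def by linarith
    have "(\<Sum>i\<in>I. \<Sum>l\<in>I. a i * a l * Gn n i l) = s * (\<Sum>i\<in>I. \<Sum>l\<in>I. c i * c l * Gn n i l)"
      unfolding sum_distrib_left
    proof (intro sum.cong refl)
      fix i l assume "i \<in> I" "l \<in> I"
      then show "a i * a l * Gn n i l = s * (c i * c l * Gn n i l)"
        using s by (simp add: c_def field_simps)
    qed
    then show ?thesis using neg' s by (simp add: mult_pos_neg)
  qed
  then show ?thesis by blast
qed

section \<open>Smooth loops and trigonometric approximation\<close>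

lemma Ck_SucI:
  assumes "\<And>x. (f has_derivative f' x) (at x)" and "\<And>u. Ck k (\<lambda>x. f' x u)"
  shows "Ck (Suc k) f"
proof -
  have "frechet_derivative f (at x) = f' x" for x
    using frechet_derivative_at[OF assms(1)] by simp
  then show ?thesis using assms by (auto simp: differentiable_def)
qed

lemma Ck_Suc_imp: "Ck (Suc k) f \<Longrightarrow> Ck k f"
proof (induction k arbitrary: f)
  case 0
  then show ?case
    by (auto simp: continuous_on_eq_continuous_at differentiable_imp_continuous_within)
next
  case (Suc k) then show ?case by (metis Ck.simps(2))
qed

lemma Ck_const: "Ck k (\<lambda>x. c)"
proof (induction k arbitrary: c)
  case (Suc k) then show ?case by (intro Ck_SucI[where f' = "\<lambda>x u. 0"]) auto
qed auto

lemma Ck_linear_comp: "bounded_linear h \<Longrightarrow> Ck k f \<Longrightarrow> Ck k (\<lambda>x. h (f x))"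
proof (induction k arbitrary: f)
  case 0 then show ?case
    by (auto intro: continuous_on_compose2[OF linear_continuous_on[OF 0(1)]])
next
  case (Suc k)
  show ?case
  proof (rule Ck_SucI)
    show "((\<lambda>x. h (f x)) has_derivative (\<lambda>u. h (frechet_derivative f (at x) u))) (at x)" for x
      using Suc.prems
      by (intro bounded_linear.has_derivative[OF Suc.prems(1)]) (simp add: frechet_derivative_works)
    show "Ck k (\<lambda>x. h (frechet_derivative f (at x) u))" for u using Suc by auto
  qed
qed

lemma Ck_add: "Ck k f \<Longrightarrow> Ck k g \<Longrightarrow> Ck k (\<lambda>x. f x + g x)"
proof (induction k arbitrary: f g)
  case 0 then show ?case by (simp add: continuous_on_add)
next
  case (Suc k)
  show ?case
  proof (rule Ck_SucI)
    show "((\<lambda>x. f x + g x) has_derivative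
        (\<lambda>u. frechet_derivative f (at x) u + frechet_derivative g (at x) u)) (at x)" for x
      using Suc.prems by (intro has_derivative_add) (simp_all add: frechet_derivative_works)
    show "Ck k (\<lambda>x. frechet_derivative f (at x) u + frechet_derivative g (at x) u)" for u
      using Suc by auto
  qed
qed

lemma Ck_sum: "(\<And>i. i \<in> I \<Longrightarrow> Ck k (f i)) \<Longrightarrow> Ck k (\<lambda>x. \<Sum>i\<in>I. f i x)"
proof (induction I rule: infinite_finite_induct)
  case (insert i I)
  then have "Ck k (\<lambda>x. f i x + (\<Sum>i\<in>I. f i x))" by (intro Ck_add) auto
  then show ?case using insert.hyps by simp
qed (simp_all add: Ck_const)

lemma Ck_mult:
  fixes f g :: "'a::real_normed_vector \<Rightarrow> real"
  shows "Ck k f \<Longrightarrow> Ck k g \<Longrightarrow> Ck k (\<lambda>x. f x * g x)"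
proof (induction k arbitrary: f g)
  case 0 then show ?case by (simp add: continuous_on_mult)
next
  case (Suc k)
  show ?case
  proof (rule Ck_SucI)
    show "((\<lambda>x. f x * g x) has_derivative
        (\<lambda>u. f x * frechet_derivative g (at x) u + frechet_derivative f (at x) u * g x)) (at x)" for x
      using Suc.prems by (intro has_derivative_mult) (simp_all add: frechet_derivative_works)
    show "Ck k (\<lambda>x. f x * frechet_derivative g (at x) u + frechet_derivative f (at x) u * g x)" for u
      using Suc.IH Suc.prems Ck_Suc_imp[OF Suc.prems(1)] Ck_Suc_imp[OF Suc.prems(2)]
      by (intro Ck_add) (auto simp del: Ck.simps(1))
  qed
qed

lemma axis_expansion: "(\<Sum>i\<in>UNIV. (v $ i) *\<^sub>R axis i 1) = (v :: real^'n)"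
  by (simp add: vec_eq_iff axis_def if_distrib cong: if_cong)

lemma Ck_vec:
  fixes f :: "'a::real_normed_vector \<Rightarrow> real^'n"
  assumes "\<And>i. Ck k (\<lambda>x. f x $ i)"
  shows "Ck k f"
proof -
  have "Ck k (\<lambda>x. \<Sum>i\<in>UNIV. (f x $ i) *\<^sub>R (axis i 1 :: real^'n))"
    by (rule Ck_sum, rule Ck_linear_comp[OF bounded_linear_scaleR_left assms])
  then show ?thesis by (simp add: axis_expansion)
qed

text \<open>The two claims go through the induction together because each derivative is a multiple
  of the other function.\<close>

lemma Ck_sin_cos: "Ck k (\<lambda>t. sin (c * t)) \<and> Ck k (\<lambda>t::real. cos (c * t))"
proof (induction k)
  case 0 then show ?case by (auto intro!: continuous_intros)
next
  case (Suc k)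
  have 1: "Ck k (\<lambda>t. (u * c) * cos (c * t))" "Ck k (\<lambda>t. (- u * c) * sin (c * t))" for u
    by (intro Ck_mult Ck_const conjunct1[OF Suc] conjunct2[OF Suc])+
  have "((\<lambda>t. sin (c * t)) has_real_derivative cos (c * t) * c) (at t)"
    "((\<lambda>t. cos (c * t)) has_real_derivative - sin (c * t) * c) (at t)" for t
    by (auto intro!: derivative_eq_intros)
  note d = this[unfolded has_field_derivative_def]
  have 2: "((\<lambda>t. sin (c * t)) has_derivative (\<lambda>u. (u * c) * cos (c * t))) (at t)"
    "((\<lambda>t. cos (c * t)) has_derivative (\<lambda>u. (- u * c) * sin (c * t))) (at t)" for t
    by (rule has_derivative_eq_rhs[OF d(1)], simp add: fun_eq_iff)
       (rule has_derivative_eq_rhs[OF d(2)], simp add: fun_eq_iff)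
  from Ck_SucI[OF 2(1) 1(1)] Ck_SucI[OF 2(2) 1(2)] show ?case by blast
qed

lemma smooth_add: "smooth f \<Longrightarrow> smooth g \<Longrightarrow> smooth (\<lambda>x. f x + g x)"
  unfolding smooth_def by (blast intro: Ck_add)

lemma smooth_antiderivative:
  fixes f :: "real \<Rightarrow> 'a::real_normed_vector"
  assumes "\<And>t. (f has_vector_derivative f' t) (at t)" and "smooth f'"
  shows "smooth f"
  unfolding smooth_def
proof
  fix k
  have "Ck k (\<lambda>t. u *\<^sub>R f' t)" for u
    using assms(2) unfolding smooth_def by (blast intro: Ck_linear_comp bounded_linear_scaleR_right)
  from Ck_SucI[OF assms(1)[unfolded has_vector_derivative_def] this]
  show "Ck k f" by (rule Ck_Suc_imp)
qed

lemma smooth_velocity: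
  fixes f :: "real \<Rightarrow> 'a::real_normed_vector"
  assumes "smooth f"
  shows "(f has_vector_derivative velocity f t) (at t)" "smooth (velocity f)"
    "continuous_on A f" "continuous_on A (velocity f)"
proof -
  have C: "Ck k f" "Ck (Suc k) f" for k using assms unfolding smooth_def by blast+
  have d: "f differentiable at t" for t using C(2)[of 0] by simp
  then show "(f has_vector_derivative velocity f t) (at t)" for t by (simp add: vector_derivative_works)
  then have "frechet_derivative f (at t) = (\<lambda>u. u *\<^sub>R velocity f t)" for t
    unfolding has_vector_derivative_def using frechet_derivative_at by metis
  moreover have "Ck k (\<lambda>x. frechet_derivative f (at x) 1)" for k
    using C(2)[of k] by (simp only: Ck.simps)
  ultimately have "Ck k (\<lambda>t. velocity f t)" for k by simp
  then show "smooth (velocity f)" unfolding smooth_def by simp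
  then have "Ck 0 (velocity f)" unfolding smooth_def by blast
  then show "continuous_on A (velocity f)" by (auto intro: continuous_on_subset)
  show "continuous_on A f" using C(1)[of 0] by (auto intro: continuous_on_subset)
qed

lemma antiderivative_real:
  fixes g :: "real \<Rightarrow> 'a::euclidean_space"
  assumes "continuous_on UNIV g"
  obtains J where "J 0 = 0" "\<And>t. (J has_vector_derivative g t) (at t)"
proof -
  \<comment> \<open>The signed integral from 0 to t: the integral over the interval with reversed
    ends is 0.\<close>
  define J where "J t = integral {0..t} g - integral {t..0} g" for t
  have int: "g integrable_on {a..b}" for a b
    by (intro integrable_continuous_real continuous_on_subset[OF assms]) auto
  have J0: "J 0 = 0" by (simp add: J_def)
  have "(J has_vector_derivative g t) (at t)" for t
  proof -
  define T :: real where "T = \<bar>t\<bar> + 1"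
  \<comment> \<open>With a fixed left end -T beyond t, J is an ordinary indefinite integral up to a
    constant, also around 0, where its definition changes form.\<close>
  have J: "J s = integral {-T..s} g - integral {-T..0} g" if "s \<in> {-T..T}" for s
    using that Henstock_Kurzweil_Integration.integral_combine[OF _ _ int[of "-T" 0], of s]
      Henstock_Kurzweil_Integration.integral_combine[OF _ _ int[of "-T" s], of 0]
    by (cases s "0::real" rule: linorder_cases) (auto simp: J_def algebra_simps)
  have "((\<lambda>s. integral {-T..s} g) has_vector_derivative g t) (at t within {-T..T})"
    by (intro integral_has_vector_derivative continuous_on_subset[OF assms]) (auto simp: T_def)
  then have "((\<lambda>s. integral {-T..s} g - integral {-T..0} g) has_vector_derivative g t - 0)
      (at t within {-T..T})"
    by (intro has_vector_derivative_diff) auto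
  moreover have "t \<in> interior {-T..T}" unfolding interior_atLeastAtMost_real by (auto simp: T_def)
  ultimately have "((\<lambda>s. integral {-T..s} g - integral {-T..0} g) has_vector_derivative g t) (at t)"
    by (simp only: at_within_interior diff_zero)
  then show "(J has_vector_derivative g t) (at t)"
  proof (rule has_vector_derivative_transform_within_open[where S = "{-T<..<T}"])
    show "t \<in> {-T<..<T}" by (auto simp: T_def)
    show "integral {-T..s} g - integral {-T..0} g = J s" if "s \<in> {-T<..<T}" for s
      using J[of s] that by simp
  qed simp
  qed
  then show thesis using that J0 by blast
qed

text \<open>Restricted to the unit circle, polynomials of the plane become trigonometric
  polynomials. They are the smooth periodic functions that Stone-Weierstrass will supply.\<close>

lemma smooth_real_polynomial_circle:
  "real_polynomial_function p \<Longrightarrow> Ck k (\<lambda>t. p (cis (2 * pi * t)))"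
proof (induction rule: real_polynomial_function.induct)
  case (linear f)
  then interpret bounded_linear f .
  have "f (cis (2 * pi * t)) = cos (2 * pi * t) * f 1 + sin (2 * pi * t) * f \<i>" for t
  proof -
    have "cis (2 * pi * t) = cos (2 * pi * t) *\<^sub>R 1 + sin (2 * pi * t) *\<^sub>R \<i>"
      by (simp add: complex_eq_iff)
    then show ?thesis by (simp add: add scaleR)
  qed
  then have eq: "(\<lambda>t. f (cis (2 * pi * t))) =
      (\<lambda>t. cos (2 * pi * t) * f 1 + sin (2 * pi * t) * f \<i>)" by blast
  show ?case unfolding eq
    by (intro Ck_add Ck_mult Ck_const conjunct1[OF Ck_sin_cos] conjunct2[OF Ck_sin_cos])
next
  case (const c) show ?case by (rule Ck_const)
next
  case (add f g) then show ?case by (intro Ck_add)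
next
  case (mult f g) then show ?case by (intro Ck_mult)
qed

lemma trigonometric_approximation:
  fixes u :: "real \<Rightarrow> real^'d"
  assumes u: "continuous_on {0..1} u" "u 0 = u 1" and e: "0 < e"
  shows "\<exists>w\<in>loops. \<forall>t\<in>{0..1}. norm (w t - u t) < e"
proof -
  have "path u" "pathfinish u = pathstart u" using u by (auto simp: path_def pathfinish_def pathstart_def)
  \<comment> \<open>The homotopy of u with itself serves only for its consequence that u,
    transported to the circle by the argument, is continuous there, including at the point
    1.\<close>
  then have "homotopic_loops UNIV u u"
    unfolding homotopic_loops_refl by simp
  from homotopic_with_imp_continuous[OF homotopic_loops_imp_homotopic_circlemaps[OF this]]
  have cont: "continuous_on (sphere 0 1) (u \<circ> (\<lambda>z. Arg2pi z / (2 * pi)))" by simp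
  obtain g where g: "polynomial_function g"
    "\<And>z. z \<in> sphere 0 1 \<Longrightarrow> norm ((u \<circ> (\<lambda>z. Arg2pi z / (2 * pi))) z - g z) < e"
    using Stone_Weierstrass_polynomial_function[OF _ cont e] by auto
  define w where "w t = g (cis (2 * pi * t))" for t
  have "Ck k (\<lambda>t. w t $ i)" for k i
  proof -
    have "real_polynomial_function ((\<lambda>x. x $ i) \<circ> g)"
      using g(1) unfolding polynomial_function_def by (simp add: bounded_linear_vec_nth)
    from smooth_real_polynomial_circle[OF this] show ?thesis by (simp add: w_def)
  qed
  then have "smooth w" unfolding smooth_def by (blast intro: Ck_vec)
  moreover have "w (t + 1) = w t" for t
    unfolding w_def by (simp add: distrib_left cis_mult[symmetric])
  ultimately have "w \<in> loops" by (simp add: loops_def)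
  moreover have "norm (w t - u t) < e" if t: "t \<in> {0..1}" for t
  proof -
    have "u (Arg2pi (cis (2 * pi * t)) / (2 * pi)) = u t"
    proof (cases "t = 1")
      case True
    moreover have "Arg2pi 1 = 0" by (rule Arg2pi_unique[of 1]) auto
    ultimately show ?thesis using u by simp
    next
      case False
      then have "Arg2pi (cis (2 * pi * t)) = 2 * pi * t"
        using t by (intro Arg2pi_unique[of 1]) (auto simp: cis_conv_exp mult.commute)
      then show ?thesis by simp
    qed
    then show ?thesis using g(2)[of "cis (2 * pi * t)"]
      by (simp add: w_def norm_minus_commute)
  qed
  ultimately show ?thesis by blast
qed

section \<open>Ordinary differential equations\<close>

text \<open>The squared norm is differentiable also where u vanishes. From 2|u|e \<le> |u|^2 + e^2
  the derivative of |u|^2 + e^2 is at most c (|u|^2 + e^2) in absolute value with c = 2K + 1, so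
  multiplying by exp(-ct) or exp(ct) gives a monotone function. The second estimate runs backwards
  in time.\<close>

lemma gronwall_square:
  fixes u :: "real \<Rightarrow> 'a::real_inner"
  assumes ab: "a \<le> b" and cont: "continuous_on {a..b} u"
    and der: "\<And>r. a < r \<Longrightarrow> r < b \<Longrightarrow> (u has_vector_derivative u' r) (at r)"
    and bd: "\<And>r. a < r \<Longrightarrow> r < b \<Longrightarrow> norm (u' r) \<le> K * norm (u r) + e"
    and K: "0 \<le> K" "0 \<le> e"
  shows "(norm (u b))\<^sup>2 + e\<^sup>2 \<le> ((norm (u a))\<^sup>2 + e\<^sup>2) * exp ((2 * K + 1) * (b - a))"
    and "(norm (u a))\<^sup>2 + e\<^sup>2 \<le> ((norm (u b))\<^sup>2 + e\<^sup>2) * exp ((2 * K + 1) * (b - a))"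
proof -
  define c where "c = 2 * K + 1"
  have e1: "exp ((- c) * a) * exp (c * b) = exp ((2 * K + 1) * (b - a))"
    and e2: "exp (c * b) * exp ((- c) * a) = exp ((2 * K + 1) * (b - a))"
    by (simp_all add: exp_add[symmetric] c_def algebra_simps)
  have e3: "exp ((- c) * r) * exp (c * r) = 1" "exp (c * r) * exp ((- c) * r) = 1" for r
    by (simp_all add: exp_add[symmetric])
  have bound: "\<bar>2 * (u r \<bullet> u' r)\<bar> \<le> c * (u r \<bullet> u r + e\<^sup>2)" if "a < r" "r < b" for r
  proof -
    have "\<bar>u r \<bullet> u' r\<bar> \<le> norm (u r) * (K * norm (u r) + e)"
      by (rule order_trans[OF Cauchy_Schwarz_ineq2]) (intro mult_left_mono bd that norm_ge_zero)
    moreover have "2 * (norm (u r) * e) \<le> (norm (u r))\<^sup>2 + e\<^sup>2"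
      using zero_le_power2[of "norm (u r) - e"] by (simp add: power2_diff)
    moreover have "0 \<le> K * e\<^sup>2" using K by simp
    ultimately show ?thesis
      unfolding c_def by (simp add: power2_norm_eq_inner[symmetric] algebra_simps power2_eq_square)
  qed
  have der2: "((\<lambda>r. (u r \<bullet> u r + e\<^sup>2) * exp (k * r)) has_real_derivative
      (2 * (u r \<bullet> u' r) + k * (u r \<bullet> u r + e\<^sup>2)) * exp (k * r)) (at r)"
    if "a < r" "r < b" for r k
  proof -
    have "((\<lambda>r. u r \<bullet> u r) has_real_derivative 2 * (u r \<bullet> u' r)) (at r)"
      using bounded_bilinear.has_vector_derivative[OF bounded_bilinear_inner der[OF that] der[OF that]]
      by (simp add: has_real_derivative_iff_has_vector_derivative inner_commute)
    then show ?thesis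
      by (auto intro!: derivative_eq_intros simp: algebra_simps)
  qed
  have cont2: "continuous_on {a..b} (\<lambda>r. (u r \<bullet> u r + e\<^sup>2) * exp (k * r))" for k
    by (intro continuous_intros cont)
  have "(u b \<bullet> u b + e\<^sup>2) * exp ((- c) * b) \<le> (u a \<bullet> u a + e\<^sup>2) * exp ((- c) * a)"
  proof (rule DERIV_nonpos_imp_decreasing_open[OF ab _ cont2])
    fix r assume r: "a < r" "r < b"
    have "2 * (u r \<bullet> u' r) + (- c) * (u r \<bullet> u r + e\<^sup>2) \<le> 0" using bound[OF r] by simp
    then show "\<exists>y. ((\<lambda>r. (u r \<bullet> u r + e\<^sup>2) * exp ((- c) * r)) has_real_derivative y) (at r) \<and> y \<le> 0"
      using der2[OF r, of "- c"] mult_nonpos_nonneg[OF _ exp_ge_zero] by blast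
  qed
  then have "(u b \<bullet> u b + e\<^sup>2) * (exp ((- c) * b) * exp (c * b))
      \<le> (u a \<bullet> u a + e\<^sup>2) * (exp ((- c) * a) * exp (c * b))"
    unfolding mult.assoc[symmetric] by (rule mult_right_mono) simp
  then show "(norm (u b))\<^sup>2 + e\<^sup>2 \<le> ((norm (u a))\<^sup>2 + e\<^sup>2) * exp ((2 * K + 1) * (b - a))"
    unfolding e3 e1 power2_norm_eq_inner by simp
  have "(u a \<bullet> u a + e\<^sup>2) * exp (c * a) \<le> (u b \<bullet> u b + e\<^sup>2) * exp (c * b)"
  proof (rule DERIV_nonneg_imp_increasing_open[OF ab _ cont2])
    fix r assume r: "a < r" "r < b"
    have "0 \<le> 2 * (u r \<bullet> u' r) + c * (u r \<bullet> u r + e\<^sup>2)" using bound[OF r] by simp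
    then show "\<exists>y. ((\<lambda>r. (u r \<bullet> u r + e\<^sup>2) * exp (c * r)) has_real_derivative y) (at r) \<and> 0 \<le> y"
      using der2[OF r, of c] mult_nonneg_nonneg[OF _ exp_ge_zero] by blast
  qed
  then have "(u a \<bullet> u a + e\<^sup>2) * (exp (c * a) * exp ((- c) * a))
      \<le> (u b \<bullet> u b + e\<^sup>2) * (exp (c * b) * exp ((- c) * a))"
    unfolding mult.assoc[symmetric] by (rule mult_right_mono) simp
  then show "(norm (u a))\<^sup>2 + e\<^sup>2 \<le> ((norm (u b))\<^sup>2 + e\<^sup>2) * exp ((2 * K + 1) * (b - a))"
    unfolding e3 e2 power2_norm_eq_inner by simp
qed

text \<open>Comparison with the antiderivative of the bound on each side of 0. The exponential rate
  is kept and a factor 1/c is gained, which is the source of the contraction in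
  \<open>picard_global\<close>.\<close>

lemma antiderivative_exp_bound:
  fixes J :: "real \<Rightarrow> 'a::real_normed_vector"
  assumes J: "\<And>t. (J has_vector_derivative g t) (at t)" and J0: "J 0 = 0"
    and bd: "\<And>t. norm (g t) \<le> B * exp (c * \<bar>t\<bar>)" and c: "0 < c" "0 \<le> B"
  shows "norm (J t) \<le> B / c * exp (c * \<bar>t\<bar>)"
proof -
  have contJ: "continuous_on A J" for A
    using J by (meson continuous_at_imp_continuous_on has_vector_derivative_continuous)
  have ed: "((\<lambda>s. B / k * exp (k * s)) has_vector_derivative B * exp (k * s)) (at s)" if "k \<noteq> 0" for k s
    using that unfolding has_real_derivative_iff_has_vector_derivative[symmetric]
    by (auto intro!: derivative_eq_intros)
  have ec: "continuous_on A (\<lambda>s. B / k * exp (k * s))" for k and A :: "real set"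
    by (intro continuous_intros)
  consider "t = 0" | "0 < t" | "t < 0" by linarith
  then show ?thesis
  proof cases
    case 2
    have "norm (J t - J 0) \<le> B / c * exp (c * t) - B / c * exp (c * 0)"
    proof (rule differentiable_bound_general[OF 2 contJ ec J ed])
      show "norm (g s) \<le> B * exp (c * s)" if "0 < s" "s < t" for s
        using bd[of s] that by simp
    qed (use c in auto)
    moreover have "0 \<le> B / c" using c by simp
    ultimately show ?thesis using 2 J0 by simp
  next
    case 3
    have "norm (J 0 - J t) \<le> B / (- c) * exp ((- c) * 0) - B / (- c) * exp ((- c) * t)"
    proof (rule differentiable_bound_general[OF 3 contJ ec J ed])
      show "norm (g s) \<le> B * exp (- c * s)" if "t < s" "s < 0" for s
        using bd[of s] that by simp
    qed (use c in auto)
    moreover have "0 \<le> B / c" using c by simp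
    ultimately show ?thesis using 3 J0 by simp
  qed (use J0 c in auto)
qed

lemma picard_global:
  fixes F :: "real \<Rightarrow> 'a::euclidean_space \<Rightarrow> 'a"
  assumes cont: "continuous_on UNIV (\<lambda>(t, z). F t z)"
    and lip: "\<And>t y z. norm (F t y - F t z) \<le> K * norm (y - z)"
    and bd: "\<And>t. norm (F t 0) \<le> M" and K: "0 \<le> K"
  shows "\<exists>x. x 0 = z0 \<and> (\<forall>t. (x has_vector_derivative F t (x t)) (at t))"
proof -
  \<comment> \<open>The contraction constant will be K/c, and this choice makes it at most
    1/2.\<close>
  define c where "c = 2 * K + 1"
  have c: "0 < c" using K by (simp add: c_def)
  have M: "0 \<le> M" using bd[of 0] norm_ge_zero order_trans by blast
  define g where "g y t = F t (exp (c * \<bar>t\<bar>) *\<^sub>R apply_bcontfun y t)" for y t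
  have contg: "continuous_on UNIV (g y)" for y
  proof -
    have "continuous_on UNIV (\<lambda>t. (t, exp (c * \<bar>t\<bar>) *\<^sub>R apply_bcontfun y t))"
      by (intro continuous_intros continuous_on_apply_bcontfun)
    from continuous_on_compose2[OF cont this] show ?thesis by (simp add: g_def[abs_def])
  qed
  have "\<exists>J. J 0 = 0 \<and> (\<forall>t. (J has_vector_derivative g y t) (at t))" for y
    using antiderivative_real[OF contg] by metis
  then obtain J where J0: "J y 0 = 0" and J: "(J y has_vector_derivative g y t) (at t)" for y t
    by metis
  define T where "T y t = exp (- c * \<bar>t\<bar>) *\<^sub>R (z0 + J y t)" for y t
  have e1: "1 \<le> exp (c * \<bar>t\<bar>)" for t using c by simp
  have gb: "norm (g y t) \<le> (M + K * norm y) * exp (c * \<bar>t\<bar>)" for y t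
  proof -
    have "norm (g y t) \<le> norm (F t 0) + norm (g y t - F t 0)" by norm
    also have "\<dots> \<le> M + K * norm (exp (c * \<bar>t\<bar>) *\<^sub>R apply_bcontfun y t - 0)"
      unfolding g_def by (intro add_mono bd lip)
    also have "\<dots> \<le> M * exp (c * \<bar>t\<bar>) + K * (exp (c * \<bar>t\<bar>) * norm y)"
      using mult_left_mono[OF e1[of t] M] K by (auto intro!: add_mono mult_left_mono norm_bounded)
    finally show ?thesis by (simp add: algebra_simps)
  qed
  have Tb: "T y \<in> bcontfun" for y
  proof (rule bcontfun_normI)
    have "continuous_on UNIV (J y)"
      using J by (meson continuous_at_imp_continuous_on has_vector_derivative_continuous)
    then show "continuous_on UNIV (T y)" unfolding T_def by (intro continuous_intros)
    show "norm (T y t) \<le> norm z0 + (M + K * norm y) / c" for t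
    proof -
      have "norm (z0 + J y t) \<le> norm z0 * exp (c * \<bar>t\<bar>) + (M + K * norm y) / c * exp (c * \<bar>t\<bar>)"
        using antiderivative_exp_bound[OF J J0 gb c, of y t] M K
          mult_left_mono[OF e1[of t] norm_ge_zero[of z0]]
        by (intro norm_triangle_le) auto
      then have "exp (- c * \<bar>t\<bar>) * norm (z0 + J y t)
          \<le> exp (- c * \<bar>t\<bar>) * ((norm z0 + (M + K * norm y) / c) * exp (c * \<bar>t\<bar>))"
        by (intro mult_left_mono) (auto simp: algebra_simps)
      also have "\<dots> = (norm z0 + (M + K * norm y) / c) * (exp (- c * \<bar>t\<bar>) * exp (c * \<bar>t\<bar>))"
        by (simp only: ac_simps)
      also have "\<dots> = norm z0 + (M + K * norm y) / c" by (simp add: exp_minus)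
      finally show ?thesis by (simp add: T_def)
    qed
  qed
  \<comment> \<open>\<open>T\<close> is the Picard operator in terms of \<open>y t = exp (- c \<bar>t\<bar>) x t\<close>; this weight makes it a contraction.\<close>
  have "\<exists>!y. Bcontfun (T y) = y"
  proof (rule banach_fix_type[of "1/2"])
    show "\<forall>y w. dist (Bcontfun (T y)) (Bcontfun (T w)) \<le> 1/2 * dist y w"
    proof (intro allI dist_bound)
      fix y w t
      have "((\<lambda>t. J y t - J w t) has_vector_derivative g y t - g w t) (at t)" for t
        by (intro has_vector_derivative_diff J)
      moreover have "norm (g y t - g w t) \<le> (K * dist y w) * exp (c * \<bar>t\<bar>)" for t
      proof -
        have "norm (g y t - g w t) \<le> K * (exp (c * \<bar>t\<bar>) * dist (apply_bcontfun y t) (apply_bcontfun w t))"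
          unfolding g_def by (rule order_trans[OF lip])
            (simp add: scaleR_diff_right[symmetric] dist_norm)
        also have "\<dots> \<le> K * (exp (c * \<bar>t\<bar>) * dist y w)"
          using K by (intro mult_left_mono dist_bounded) auto
        finally show ?thesis by (simp add: ac_simps)
      qed
      ultimately have "norm (J y t - J w t) \<le> (K * dist y w) / c * exp (c * \<bar>t\<bar>)"
        using K J0 c by (intro antiderivative_exp_bound[where g = "\<lambda>t. g y t - g w t"]) auto
      then have "exp (- c * \<bar>t\<bar>) * norm (J y t - J w t)
         \<le> exp (- c * \<bar>t\<bar>) * ((K * dist y w) / c * exp (c * \<bar>t\<bar>))"
        by (intro mult_left_mono) auto
      also have "\<dots> = (K * dist y w) / c" by (simp add: exp_minus)
      also have "\<dots> \<le> 1/2 * dist y w"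
      proof -
        have "2 * (K * dist y w) \<le> c * dist y w" unfolding c_def by (simp add: algebra_simps)
        then show ?thesis using c by (simp add: field_simps)
      qed
      finally show "dist (apply_bcontfun (Bcontfun (T y)) t) (apply_bcontfun (Bcontfun (T w)) t) \<le> 1/2 * dist y w"
        by (simp add: Bcontfun_inverse[OF Tb] T_def dist_norm scaleR_diff_right[symmetric])
    qed
  qed auto
  then obtain y where "Bcontfun (T y) = y" by blast
  then have y: "apply_bcontfun y t = T y t" for t using Bcontfun_inverse[OF Tb] by metis
  define x where "x t = z0 + J y t" for t
  have "exp (c * \<bar>t\<bar>) *\<^sub>R apply_bcontfun y t = x t" for t
    by (simp add: y T_def x_def exp_add[symmetric])
  then have "g y t = F t (x t)" for t by (simp add: g_def)
  then have "(x has_vector_derivative F t (x t)) (at t)" for t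
    using has_vector_derivative_add[OF has_vector_derivative_const[of z0] J[of y t]]
    by (simp add: x_def[abs_def])
  moreover have "x 0 = z0" by (simp add: x_def J0)
  ultimately show ?thesis by blast
qed

lemma continuous_on_compact_norm_bound:
  fixes f :: "'a::topological_space \<Rightarrow> 'b::real_normed_vector"
  assumes "continuous_on S f" "compact S"
  obtains B where "\<And>x. x \<in> S \<Longrightarrow> norm (f x) \<le> B"
  using compact_imp_bounded[OF compact_continuous_image[OF assms]] unfolding bounded_iff by blast

lemma linear_basis_expansion:
  fixes A :: "'a::euclidean_space \<Rightarrow> 'b::real_vector"
  assumes "linear A"
  shows "A u = (\<Sum>b\<in>Basis. (u \<bullet> b) *\<^sub>R A b)"
proof -
  have "A u = A (\<Sum>b\<in>Basis. (u \<bullet> b) *\<^sub>R b)" by (simp only: euclidean_representation)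
  also have "\<dots> = (\<Sum>b\<in>Basis. (u \<bullet> b) *\<^sub>R A b)"
    by (simp only: linear_sum[OF assms] linear_cmul[OF assms])
  finally show ?thesis .
qed

lemma linear_family_norm_le:
  fixes A :: "'a::euclidean_space \<Rightarrow> 'b::real_normed_vector"
  assumes "linear A"
  shows "norm (A u) \<le> (\<Sum>b\<in>Basis. norm (A b)) * norm u"
proof -
  have "norm (A u) = norm (\<Sum>b\<in>Basis. (u \<bullet> b) *\<^sub>R A b)"
    by (simp only: linear_basis_expansion[OF assms, symmetric])
  also have "\<dots> \<le> (\<Sum>b\<in>Basis. norm u * norm (A b))"
    by (intro sum_norm_le) (auto intro!: mult_right_mono Basis_le_norm)
  finally show ?thesis by (simp add: sum_distrib_left[symmetric] mult.commute)
qed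

text \<open>Passes to the limit in linear equations \<open>A x (y x) = r x\<close>. The limit
  \<open>A0\<close> is bounded below by some m > 0, so \<open>A x\<close> is bounded below by m/2 as
  soon as it is m/2-close to \<open>A0\<close> on the basis. This gives continuity of velocities and
  differentiability of frame coordinates.\<close>

lemma tendsto_linear_inverse:
  fixes A :: "'b \<Rightarrow> 'a::euclidean_space \<Rightarrow> 'c::euclidean_space"
  assumes A0: "linear A0" "inj A0" and A: "\<forall>\<^sub>F x in F. linear (A x)"
    and lim: "\<And>u. ((\<lambda>x. A x u) \<longlongrightarrow> A0 u) F"
    and y: "((\<lambda>x. A x (y x)) \<longlongrightarrow> A0 y0) F"
  shows "(y \<longlongrightarrow> y0) F"
proof -
  obtain m where m: "m > 0" "\<And>u. m * norm u \<le> norm (A0 u)"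
    using linear_inj_bounded_below_pos[OF A0] by blast
  have "((\<lambda>x. \<Sum>b\<in>Basis. norm (A x b - A0 b)) \<longlongrightarrow> (\<Sum>b\<in>Basis. norm (A0 b - A0 b))) F"
    by (intro tendsto_intros lim)
  then have ev: "\<forall>\<^sub>F x in F. (\<Sum>b\<in>Basis. norm (A x b - A0 b)) < m / 2"
    using m by (intro order_tendstoD(2)) auto
  have "\<forall>\<^sub>F x in F. norm (y x - y0) \<le> norm (A x (y x) - A x y0) * (2 / m)"
    using ev A
  proof eventually_elim
    case (elim x)
    then have s: "(\<Sum>b\<in>Basis. norm (A x b - A0 b)) < m / 2" and A: "linear (A x)" by auto
    let ?w = "y x - y0"
    have "linear (\<lambda>u. A x u - A0 u)" by (intro linear_compose_sub A A0(1))
    from linear_family_norm_le[OF this, of ?w]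
    have "norm (A x ?w - A0 ?w) \<le> m / 2 * norm ?w"
      by (rule order_trans) (intro mult_right_mono, use s in auto)
    moreover have "norm (A0 ?w) \<le> norm (A x ?w) + norm (A x ?w - A0 ?w)"
      by (metis norm_minus_commute norm_triangle_sub)
    ultimately have "m / 2 * norm ?w \<le> norm (A x ?w)" using m(2)[of ?w] by linarith
    then show "norm ?w \<le> norm (A x (y x) - A x y0) * (2 / m)"
      using m by (simp add: linear_diff[OF A] field_simps)
  qed
  moreover have "((\<lambda>x. norm (A x (y x) - A x y0) * (2 / m)) \<longlongrightarrow> norm (A0 y0 - A0 y0) * (2 / m)) F"
    by (intro tendsto_intros y lim)
  ultimately have "((\<lambda>x. y x - y0) \<longlongrightarrow> 0) F"
    using Lim_null_comparison by force
  then show ?thesis by (simp add: LIM_zero_iff)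
qed

section \<open>Symmetry of second derivatives\<close>

text \<open>Two applications of the mean value theorem: along u to the increment of \<open>f\<close>
  in the direction \<open>s *\<^sub>R v\<close>, then along v to \<open>f1\<close> in the direction
  u.\<close>

lemma second_difference_mvt:
  fixes f :: "'a::real_normed_vector \<Rightarrow> real"
  assumes f1: "\<And>x. (f has_derivative f1 x) (at x)"
    and f2: "\<And>x u. ((\<lambda>x. f1 x u) has_derivative f2 x u) (at x)"
    and s: "0 < s"
  shows "\<exists>a b. 0 < a \<and> a < s \<and> 0 < b \<and> b < s \<and>
    f (x + s *\<^sub>R u + s *\<^sub>R v) - f (x + s *\<^sub>R u) - f (x + s *\<^sub>R v) + f x =
      s\<^sup>2 * f2 (x + a *\<^sub>R u + b *\<^sub>R v) u v"
proof -
  have line: "((\<lambda>r. x + r *\<^sub>R w) has_derivative (\<lambda>h. h *\<^sub>R w)) (at r)" for x w :: 'a and r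
    by (auto intro!: derivative_eq_intros)
  have lin1: "linear (f1 x)" for x using f1 has_derivative_linear by blast
  have lin2: "linear (f2 x u)" for x u using f2 has_derivative_linear by blast
  have d1: "((\<lambda>r. f (x + r *\<^sub>R u)) has_real_derivative f1 (x + r *\<^sub>R u) u) (at r)" for x u r
    using has_derivative_compose[OF line f1[of "x + r *\<^sub>R u"]] 
    by (simp add: has_field_derivative_def linear_cmul[OF lin1] mult_commute_abs)
  have d2: "((\<lambda>r. f1 (x + r *\<^sub>R v) u) has_real_derivative f2 (x + r *\<^sub>R v) u v) (at r)" for x u r
    using has_derivative_compose[OF line f2[of u "x + r *\<^sub>R v"]]
    by (simp add: has_field_derivative_def linear_cmul[OF lin2] mult_commute_abs)
  have "\<exists>a. 0 < a \<and> a < s \<and>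
      (f ((x + s *\<^sub>R v) + s *\<^sub>R u) - f (x + s *\<^sub>R u)) - (f ((x + s *\<^sub>R v) + 0 *\<^sub>R u) - f (x + 0 *\<^sub>R u))
      = (s - 0) * (f1 ((x + s *\<^sub>R v) + a *\<^sub>R u) u - f1 (x + a *\<^sub>R u) u)"
    by (rule MVT2[OF s]) (auto intro!: DERIV_diff d1)
  then obtain a where a: "0 < a" "a < s"
    "f (x + s *\<^sub>R u + s *\<^sub>R v) - f (x + s *\<^sub>R u) - f (x + s *\<^sub>R v) + f x
      = s * (f1 (x + a *\<^sub>R u + s *\<^sub>R v) u - f1 (x + a *\<^sub>R u + 0 *\<^sub>R v) u)"
    by (auto simp: ac_simps)
  have "\<exists>b. 0 < b \<and> b < s \<and> f1 (x + a *\<^sub>R u + s *\<^sub>R v) u - f1 (x + a *\<^sub>R u + 0 *\<^sub>R v) u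
     = (s - 0) * f2 (x + a *\<^sub>R u + b *\<^sub>R v) u v"
    by (rule MVT2[OF s]) (rule d2)
  then show ?thesis using a by (auto simp: power2_eq_square)
qed

text \<open>The second difference of f is symmetric in u and v. Written by the mean value theorem in
  both orders and divided by the square of s = 1/(n+1), it converges to the two sides.\<close>

lemma second_derivative_symmetric:
  fixes f :: "'a::real_normed_vector \<Rightarrow> real"
  assumes f1: "\<And>x. (f has_derivative f1 x) (at x)"
    and f2: "\<And>x u. ((\<lambda>x. f1 x u) has_derivative f2 x u) (at x)"
    and cont: "\<And>u v. continuous_on UNIV (\<lambda>x. f2 x u v)"
  shows "f2 x u v = f2 x v u"
proof -
  define s where "s n = inverse (real (Suc n))" for n
  have s: "0 < s n" for n by (simp add: s_def)
  have s0: "s \<longlonglongrightarrow> 0" unfolding s_def by (rule LIMSEQ_inverse_real_of_nat)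
  have key: "\<exists>p. p \<longlonglongrightarrow> x \<and> (\<forall>n. f (x + s n *\<^sub>R u + s n *\<^sub>R v) - f (x + s n *\<^sub>R u) - f (x + s n *\<^sub>R v) + f x
     = (s n)\<^sup>2 * f2 (p n) u v)" for u v
  proof -
    have "\<forall>n. \<exists>a b. 0 < a \<and> a < s n \<and> 0 < b \<and> b < s n \<and>
      f (x + s n *\<^sub>R u + s n *\<^sub>R v) - f (x + s n *\<^sub>R u) - f (x + s n *\<^sub>R v) + f x =
      (s n)\<^sup>2 * f2 (x + a *\<^sub>R u + b *\<^sub>R v) u v"
      using second_difference_mvt[OF f1 f2 s] by blast
    then obtain a b where ab: "\<And>n. 0 < a n \<and> a n < s n \<and> 0 < b n \<and> b n < s n"
      and eq: "\<And>n. f (x + s n *\<^sub>R u + s n *\<^sub>R v) - f (x + s n *\<^sub>R u) - f (x + s n *\<^sub>R v) + f x =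
      (s n)\<^sup>2 * f2 (x + a n *\<^sub>R u + b n *\<^sub>R v) u v"
      by metis
    have "a \<longlonglongrightarrow> 0" "b \<longlonglongrightarrow> 0"
      using ab by (auto intro!: tendsto_sandwich[OF _ _ tendsto_const s0] always_eventually less_imp_le)
    then have "(\<lambda>n. x + a n *\<^sub>R u + b n *\<^sub>R v) \<longlonglongrightarrow> x + 0 *\<^sub>R u + 0 *\<^sub>R v"
      by (intro tendsto_intros)
    then show ?thesis using eq by (intro exI[of _ "\<lambda>n. x + a n *\<^sub>R u + b n *\<^sub>R v"]) auto
  qed
  obtain p where p: "p \<longlonglongrightarrow> x" "\<And>n. f (x + s n *\<^sub>R u + s n *\<^sub>R v) - f (x + s n *\<^sub>R u) - f (x + s n *\<^sub>R v) + f x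
     = (s n)\<^sup>2 * f2 (p n) u v" using key[of u v] by blast
  obtain q where q: "q \<longlonglongrightarrow> x" "\<And>n. f (x + s n *\<^sub>R v + s n *\<^sub>R u) - f (x + s n *\<^sub>R v) - f (x + s n *\<^sub>R u) + f x
     = (s n)\<^sup>2 * f2 (q n) v u" using key[of v u] by blast
  have eq: "(s n)\<^sup>2 * f2 (p n) u v = (s n)\<^sup>2 * f2 (q n) v u" for n
  proof -
    have "f (x + s n *\<^sub>R v + s n *\<^sub>R u) = f (x + s n *\<^sub>R u + s n *\<^sub>R v)" by (simp add: ac_simps)
    then show ?thesis using p(2)[of n] q(2)[of n] by linarith
  qed
  have "f2 (p n) u v = f2 (q n) v u" for n
    using eq[of n] s[of n] by simp
  moreover have "(\<lambda>n. f2 (p n) u v) \<longlonglongrightarrow> f2 x u v" "(\<lambda>n. f2 (q n) v u) \<longlonglongrightarrow> f2 x v u"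
    using continuous_on_tendsto_compose[OF cont p(1)] continuous_on_tendsto_compose[OF cont q(1)] by auto
  ultimately show ?thesis using LIMSEQ_unique by force
qed

section \<open>Flows of continuously differentiable time-dependent fields\<close>

text \<open>Global existence is not among the assumptions: for the Hamiltonian field it will come
  from the completeness of the Euler-Lagrange equation.\<close>

locale C1_field =
  fixes X :: "real \<Rightarrow> 'a::euclidean_space \<Rightarrow> 'a" and DX :: "real \<Rightarrow> 'a \<Rightarrow> 'a \<Rightarrow> 'a"
  assumes deriv: "(X t has_derivative DX t z) (at z)"
    and contX: "continuous_on UNIV (\<lambda>(t, z). X t z)"
    and contDX: "continuous_on UNIV (\<lambda>(t, z). DX t z u)"
begin

lemma linear_DX: "linear (DX t z)"
  using deriv has_derivative_linear by blast

lemma lipschitz_on_compact: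
  fixes a b R :: real
  shows "\<exists>K\<ge>0. \<forall>t\<in>{a..b}. \<forall>z\<in>cball 0 R. (\<forall>u. norm (DX t z u) \<le> K * norm u) \<and>
    (\<forall>y\<in>cball 0 R. norm (X t y - X t z) \<le> K * norm (y - z))"
proof -
  define S where "S = {a..b} \<times> cball (0::'a) R"
  have S: "compact S" unfolding S_def by (intro compact_Times compact_cball compact_Icc)
  have "\<exists>B. \<forall>t z. (t, z) \<in> S \<longrightarrow> norm (DX t z u) \<le> B" for u
  proof -
    obtain B where "\<And>x. x \<in> S \<Longrightarrow> norm (case x of (t, z) \<Rightarrow> DX t z u) \<le> B"
      using continuous_on_compact_norm_bound[OF continuous_on_subset[OF contDX[of u] subset_UNIV] S] by blast
    then show ?thesis by (intro exI[of _ B]) fastforce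
  qed
  then obtain B where B: "\<And>u t z. (t, z) \<in> S \<Longrightarrow> norm (DX t z u) \<le> B u" by metis
  define K where "K = (\<Sum>u\<in>Basis. max 0 (B u))"
  have K: "0 \<le> K" unfolding K_def by (intro sum_nonneg) auto
  have DK: "norm (DX t z u) \<le> K * norm u" if "t \<in> {a..b}" "z \<in> cball 0 R" for t z u
  proof -
    have "(\<Sum>b\<in>Basis. norm (DX t z b)) \<le> K"
      unfolding K_def using that B[of t z] by (intro sum_mono) (auto simp: S_def intro: le_max_iff_disj[THEN iffD2])
    then show ?thesis
      using linear_family_norm_le[OF linear_DX, of t z u] mult_right_mono[OF _ norm_ge_zero[of u]]
        order_trans by blast
  qed
  have "norm (X t y - X t z) \<le> K * norm (y - z)"
    if "t \<in> {a..b}" "z \<in> cball 0 R" "y \<in> cball 0 R" for t y z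
    by (rule differentiable_bound[OF convex_cball[of 0 R] has_derivative_at_withinI[OF deriv] onorm_le])
       (use that DK in auto)
  then show ?thesis using K DK by blast
qed

text \<open>Between 0 and t both curves stay in a common ball, where the field is Lipschitz.
  Gronwall with e = 0 applies forwards or backwards according to the sign of t.\<close>

lemma unique_solution:
  assumes x: "\<And>t. (x has_vector_derivative X t (x t)) (at t)"
    and y: "\<And>t. (y has_vector_derivative X t (y t)) (at t)" and "x 0 = y 0"
  shows "x = y"
proof
  fix t :: real
  define a where "a = min 0 t"
  define b where "b = max 0 t"
  have contx: "continuous_on A x" and conty: "continuous_on A y" for A
    using x y by (meson continuous_at_imp_continuous_on has_vector_derivative_continuous)+
  obtain R1 R2 where "\<And>r. r \<in> {a..b} \<Longrightarrow> norm (x r) \<le> R1" "\<And>r. r \<in> {a..b} \<Longrightarrow> norm (y r) \<le> R2"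
    using continuous_on_compact_norm_bound[OF contx compact_Icc]
      continuous_on_compact_norm_bound[OF conty compact_Icc] by metis
  then obtain R where R: "\<And>r. r \<in> {a..b} \<Longrightarrow> x r \<in> cball 0 R \<and> y r \<in> cball 0 R"
    by (intro that[of "max R1 R2"]) (fastforce simp: le_max_iff_disj)
  obtain K where K: "0 \<le> K" "\<And>r z w. r \<in> {a..b} \<Longrightarrow> z \<in> cball 0 R \<Longrightarrow> w \<in> cball 0 R \<Longrightarrow>
      norm (X r w - X r z) \<le> K * norm (w - z)"
    using lipschitz_on_compact[of a b R] by blast
  have ab: "a \<le> b" by (simp add: a_def b_def)
  have der: "((\<lambda>r. x r - y r) has_vector_derivative X r (x r) - X r (y r)) (at r)" for r
    by (intro has_vector_derivative_diff x y)
  have bd: "norm (X r (x r) - X r (y r)) \<le> K * norm (x r - y r) + 0" if "a < r" "r < b" for r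
    using K(2)[of r "y r" "x r"] R[of r] that by simp
  have c: "continuous_on {a..b} (\<lambda>r. x r - y r)" by (intro continuous_on_diff contx conty)
  show "x t = y t"
  proof (cases "0 \<le> t")
    case True
    with gronwall_square(1)[OF ab c der bd K(1)] show ?thesis
      using assms(3) by (simp add: a_def b_def)
  next
    case False
    with gronwall_square(2)[OF ab c der bd K(1)] show ?thesis
      using assms(3) by (simp add: a_def b_def)
  qed
qed

text \<open>Clamping time to [-1, 1] and projecting the state to the unit ball around z0 makes the
  field bounded at 0 and globally Lipschitz. The global solution of the modified equation solves the
  original one as long as it stays in that ball.\<close>

lemma local_solution:
  "\<exists>e>0. \<exists>x. x 0 = z0 \<and> (\<forall>t\<in>{-e<..<e}. (x has_vector_derivative X t (x t)) (at t))"
proof -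
  define S where "S = cball z0 1"
  have S: "convex S" "closed S" "S \<noteq> {}" by (auto simp: S_def)
  define cl where "cl t = max (-1) (min 1 t)" for t :: real
  define F where "F t z = X (cl t) (closest_point S z)" for t z
  have contcl: "continuous_on A cl" for A unfolding cl_def by (intro continuous_intros)
  have contF: "continuous_on UNIV (\<lambda>(t, z). F t z)"
    unfolding F_def case_prod_beta
    by (rule continuous_on_compose2[OF contX, of _ "\<lambda>p. (cl (fst p), closest_point S (snd p))",
          simplified case_prod_beta fst_conv snd_conv])
       (auto intro!: continuous_intros continuous_on_compose2[OF contcl]
          continuous_on_compose2[OF continuous_on_closest_point[OF S]])
  define R where "R = norm z0 + 1"
  have SR: "z \<in> cball 0 R" if "z \<in> S" for z
    using that norm_triangle_sub[of z z0] by (auto simp: S_def R_def dist_norm norm_minus_commute)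
  obtain K where K: "0 \<le> K" "\<And>t z y. t \<in> {-1..1} \<Longrightarrow> z \<in> cball 0 R \<Longrightarrow> y \<in> cball 0 R \<Longrightarrow>
      norm (X t y - X t z) \<le> K * norm (y - z)"
    using lipschitz_on_compact[of "-1" 1 R] by blast
  have cl: "cl t \<in> {-1..1}" for t by (auto simp: cl_def)
  have lip: "norm (F t y - F t z) \<le> K * norm (y - z)" for t y z
  proof -
    have "norm (F t y - F t z) \<le> K * norm (closest_point S y - closest_point S z)"
      unfolding F_def by (intro K(2) cl SR closest_point_in_set S)
    also have "\<dots> \<le> K * norm (y - z)"
      using closest_point_lipschitz[OF S, of y z] K(1) by (intro mult_left_mono) (auto simp: dist_norm)
    finally show ?thesis .
  qed
  have "continuous_on {-1..1} (\<lambda>t. X t (closest_point S 0))"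
    by (rule continuous_on_compose2[OF contX, of _ "\<lambda>t. (t, closest_point S 0)", simplified])
       (auto intro!: continuous_intros)
  then obtain M where M: "\<And>t. t \<in> {-1..1} \<Longrightarrow> norm (X t (closest_point S 0)) \<le> M"
    using continuous_on_compact_norm_bound[OF _ compact_Icc] by blast
  obtain x where x: "x 0 = z0" "\<And>t. (x has_vector_derivative F t (x t)) (at t)"
    using picard_global[OF contF lip _ K(1), of M z0] M cl unfolding F_def by blast
  have "continuous (at 0) x" using has_vector_derivative_continuous[OF x(2)] .
  then obtain d where d: "d > 0" "\<And>t. \<bar>t\<bar> < d \<Longrightarrow> dist (x t) (x 0) < 1"
    unfolding continuous_at_eps_delta by (metis diff_zero dist_real_def zero_less_one)
  define e where "e = min d 1"
  have "(x has_vector_derivative X t (x t)) (at t)" if t: "t \<in> {-e<..<e}" for t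
  proof -
    have "\<bar>t\<bar> < d" using t by (auto simp: e_def)
    then have "x t \<in> S" using d(2)[of t] x(1) by (simp add: S_def dist_commute)
    moreover have "cl t = t" using t by (auto simp: cl_def e_def)
    ultimately have "F t (x t) = X t (x t)" by (simp add: F_def closest_point_self)
    then show ?thesis using x(2)[of t] by simp
  qed
  moreover have "e > 0" using d by (simp add: e_def)
  ultimately show ?thesis using x(1) by blast
qed

text \<open>The derivative W of the flow is the fundamental solution of the variational equation
  along the orbit of z0. The remainder of the first order expansion solves the same equation up to a
  defect of size o(|y - z0|), and Gronwall carries this bound to time t.\<close>

lemma flow_has_derivative:
  fixes \<phi> :: "'a \<Rightarrow> real \<Rightarrow> 'a"
  assumes \<phi>0: "\<And>z. \<phi> z 0 = z"
    and \<phi>: "\<And>z t. (\<phi> z has_vector_derivative X t (\<phi> z t)) (at t)"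
  shows "\<exists>W. (\<forall>w. W 0 w = w) \<and>
    (\<forall>w. \<forall>t\<in>{0..1}. ((\<lambda>t. W t w) has_vector_derivative DX t (\<phi> z0 t) (W t w)) (at t within {0..1})) \<and>
    (\<forall>t\<in>{0..1}. ((\<lambda>z. \<phi> z t) has_derivative W t) (at z0))"
proof -
  have cont\<phi>: "continuous_on A (\<phi> z)" for A z
    using \<phi> by (meson continuous_at_imp_continuous_on has_vector_derivative_continuous)
  obtain R0 where R0: "\<And>t. t \<in> {0..1} \<Longrightarrow> norm (\<phi> z0 t) \<le> R0"
    using continuous_on_compact_norm_bound[OF cont\<phi> compact_Icc] by blast
  define R where "R = R0 + 1"
  obtain K where K: "0 \<le> K"
    "\<And>t z u. t \<in> {0..1} \<Longrightarrow> z \<in> cball 0 R \<Longrightarrow> norm (DX t z u) \<le> K * norm u"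
    "\<And>t z y. t \<in> {0..1} \<Longrightarrow> z \<in> cball 0 R \<Longrightarrow> y \<in> cball 0 R \<Longrightarrow>
      norm (X t y - X t z) \<le> K * norm (y - z)"
    using lipschitz_on_compact[of 0 1 R] by blast
  have inR: "z \<in> cball 0 R" if "norm (z - \<phi> z0 t) \<le> 1" "t \<in> {0..1}" for z t
    using R0[OF that(2)] that(1) norm_triangle_sub[of z "\<phi> z0 t"] by (auto simp: R_def)
  have inR0: "\<phi> z0 t \<in> cball 0 R" if "t \<in> {0..1}" for t using inR[of "\<phi> z0 t" t] that by simp
  \<comment> \<open>Clamped time makes the variational equation globally Lipschitz on the whole line
    without changing it on [0, 1].\<close>
  define cl where "cl t = max 0 (min 1 t)" for t :: real
  have cl: "cl t \<in> {0..1}" for t by (auto simp: cl_def)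
  define F where "F t w = DX (cl t) (\<phi> z0 (cl t)) w" for t w
  have contcl: "continuous_on A cl" for A unfolding cl_def by (intro continuous_intros)
  have linF: "linear (F t)" for t unfolding F_def by (rule linear_DX)
  have FK: "norm (F t w) \<le> K * norm w" for t w unfolding F_def by (intro K(2) cl inR0)
  have contF1: "continuous_on UNIV (\<lambda>t. F t w)" for w
    unfolding F_def
    by (rule continuous_on_compose2[OF contDX, of _ "\<lambda>t. (cl t, \<phi> z0 (cl t))", simplified])
       (intro continuous_intros contcl continuous_on_compose2[OF cont\<phi> contcl subset_UNIV])
  have Fexp: "F t w = (\<Sum>b\<in>Basis. (w \<bullet> b) *\<^sub>R F t b)" for t w
    by (rule linear_basis_expansion[OF linF])
  have contF: "continuous_on UNIV (\<lambda>(t, w). F t w)"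
    unfolding case_prod_beta
    by (subst Fexp) (intro continuous_intros continuous_on_compose2[OF contF1 _ subset_UNIV])
  have "\<exists>x. x 0 = w \<and> (\<forall>t. (x has_vector_derivative F t (x t)) (at t))" for w
    by (rule picard_global[OF contF _ _ K(1), of 0])
       (auto simp: linear_diff[OF linF, symmetric] linear_0[OF linF] FK)
  then obtain V where V0: "\<And>w. V w 0 = w"
    and V: "\<And>w t. (V w has_vector_derivative F t (V w t)) (at t)" by metis
  have contV: "continuous_on A (V w)" for A w
    using V by (meson continuous_at_imp_continuous_on has_vector_derivative_continuous)
  have zero: "u t = 0" if u0: "u 0 = 0" and u: "\<And>t. (u has_vector_derivative F t (u t)) (at t)"
    and t: "t \<in> {0..1}" for u t
  proof -
    have "continuous_on {0..t} u"
      using u by (meson continuous_at_imp_continuous_on has_vector_derivative_continuous)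
    from gronwall_square(1)[OF _ this u, of K 0] t FK K(1) u0 show ?thesis by simp
  qed
  have linV: "linear (\<lambda>w. V w t)" if t: "t \<in> {0..1}" for t
  proof (rule linearI)
    fix w w' :: 'a and c :: real
    have "((\<lambda>t. V (w + w') t - V w t - V w' t) has_vector_derivative
        F r (V (w + w') r - V w r - V w' r)) (at r)" for r
      unfolding linear_diff[OF linF] by (intro has_vector_derivative_diff V)
    from zero[OF _ this t] show "V (w + w') t = V w t + V w' t" by (simp add: V0 algebra_simps)
    have "((\<lambda>t. V (c *\<^sub>R w) t - c *\<^sub>R V w t) has_vector_derivative
        F r (V (c *\<^sub>R w) r - c *\<^sub>R V w r)) (at r)" for r
      unfolding linear_diff[OF linF] linear_cmul[OF linF]
      by (intro has_vector_derivative_diff V bounded_linear.has_vector_derivative[OF bounded_linear_scaleR_right])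
    from zero[OF _ this t] show "V (c *\<^sub>R w) t = c *\<^sub>R V w t" by (simp add: V0)
  qed
  \<comment> \<open>Chosen so that \<open>C\<^sup>2\<close> is the Gronwall factor on the unit
    interval.\<close>
  define C where "C = exp (K + 1/2)"
  have C: "0 < C" "C\<^sup>2 = exp (2 * K + 1)" by (simp_all add: C_def power2_eq_square exp_add[symmetric])
  have expC: "exp ((2 * K + 1) * (t - 0)) \<le> C\<^sup>2" if "t \<in> {0..1}" for t
  proof -
    have "(2 * K + 1) * (t - 0) \<le> (2 * K + 1) * 1" using that K(1) by (intro mult_left_mono) auto
    then show ?thesis unfolding C(2) by simp
  qed
  have growth: "norm (\<phi> z t - \<phi> z0 t) \<le> C * norm (z - z0)"
    if t: "t \<in> {0..1}" and tube: "\<And>r. 0 < r \<Longrightarrow> r < t \<Longrightarrow> norm (\<phi> z r - \<phi> z0 r) \<le> 1" for z t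
  proof -
    have der: "((\<lambda>r. \<phi> z r - \<phi> z0 r) has_vector_derivative X r (\<phi> z r) - X r (\<phi> z0 r)) (at r)" for r
      by (intro has_vector_derivative_diff \<phi>)
    have bd: "norm (X r (\<phi> z r) - X r (\<phi> z0 r)) \<le> K * norm (\<phi> z r - \<phi> z0 r) + 0"
      if "0 < r" "r < t" for r
    proof -
      have r: "r \<in> {0..1}" using that t by auto
      show ?thesis using K(3)[OF r inR0[OF r] inR[OF tube[OF that] r]] by simp
    qed
    have "(norm (\<phi> z t - \<phi> z0 t))\<^sup>2 \<le> (norm (z - z0))\<^sup>2 * exp ((2 * K + 1) * (t - 0))"
      using gronwall_square(1)[of 0 t, OF _ continuous_on_diff[OF cont\<phi> cont\<phi>] der bd K(1)] t
      by (simp add: \<phi>0)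
    also have "\<dots> \<le> (norm (z - z0))\<^sup>2 * C\<^sup>2" by (intro mult_left_mono expC t) simp
    finally have "(norm (\<phi> z t - \<phi> z0 t))\<^sup>2 \<le> (C * norm (z - z0))\<^sup>2"
      by (simp add: power_mult_distrib mult.commute)
    then show ?thesis by (rule power2_le_imp_le) (use C in auto)
  qed
  have near: "norm (\<phi> z t - \<phi> z0 t) \<le> C * norm (z - z0) \<and> norm (\<phi> z t - \<phi> z0 t) < 1"
    if small: "C * norm (z - z0) < 1" and t: "t \<in> {0..1}" for z t
  proof -
    have lt: "norm (\<phi> z t - \<phi> z0 t) < 1" if t: "t \<in> {0..1}" for t
    proof (rule ccontr)
      assume "\<not> norm (\<phi> z t - \<phi> z0 t) < 1"
      \<comment> \<open>Continuation argument: at the first time s at which the distance reaches 1,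
        the tube hypothesis of \<open>growth\<close> holds before s, and its conclusion bounds the
        distance at s by a number below 1.\<close>
      define S where "S = {t \<in> {0..1}. 1 \<le> norm (\<phi> z t - \<phi> z0 t)}"
      have neS: "S \<noteq> {}" using \<open>\<not> norm (\<phi> z t - \<phi> z0 t) < 1\<close> t by (auto simp: S_def)
      have compS: "compact S"
      proof -
        have "S = {0..1} \<inter> {t. 1 \<le> norm (\<phi> z t - \<phi> z0 t)}" by (auto simp: S_def)
        moreover have "closed {t. 1 \<le> norm (\<phi> z t - \<phi> z0 t)}"
          by (intro closed_Collect_le continuous_intros cont\<phi>)
        ultimately show ?thesis by (simp add: compact_Int_closed)
      qed
      obtain s where s: "s \<in> S" "\<And>r. r \<in> S \<Longrightarrow> s \<le> r"
        using compact_attains_inf[OF compS neS] by blast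
      have s01: "s \<in> {0..1}" using s(1) by (simp add: S_def)
      have "norm (\<phi> z s - \<phi> z0 s) \<le> C * norm (z - z0)"
      proof (rule growth[OF s01])
        fix r assume "0 < r" "r < s"
        then show "norm (\<phi> z r - \<phi> z0 r) \<le> 1" using s(2)[of r] s01 by (force simp: S_def)
      qed
      then show False using s(1) small by (simp add: S_def)
    qed
    have "norm (\<phi> z t - \<phi> z0 t) \<le> C * norm (z - z0)"
      by (rule growth[OF t]) (use lt t in \<open>simp add: less_imp_le\<close>)
    then show ?thesis using lt[OF t] by simp
  qed
  define T where "T = {0..1::real} \<times> cball (0::'a) R"
  have compT: "compact T" unfolding T_def by (intro compact_Times compact_cball compact_Icc)
  \<comment> \<open>Differentiability of the field uniformly along the orbit: \<open>DX\<close> is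
    uniformly continuous on the compact set T, one basis direction at a time.\<close>
  have unif: "\<exists>d>0. d \<le> 1 \<and> (\<forall>t\<in>{0..1}. \<forall>y. norm (y - \<phi> z0 t) \<le> d \<longrightarrow>
      norm (X t y - X t (\<phi> z0 t) - DX t (\<phi> z0 t) (y - \<phi> z0 t)) \<le> e * norm (y - \<phi> z0 t))"
    if e: "0 < e" for e
  proof -
    define e' where "e' = e / DIM('a)"
    have e': "0 < e'" using e by (simp add: e'_def)
    have "\<exists>d>0. \<forall>x\<in>T. \<forall>x'\<in>T. dist x' x < d \<longrightarrow>
       dist (case x' of (t, z) \<Rightarrow> DX t z b) (case x of (t, z) \<Rightarrow> DX t z b) < e'" for b
      using compact_uniformly_continuous[OF continuous_on_subset[OF contDX[of b] subset_UNIV] compT] e'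
      unfolding uniformly_continuous_on_def by blast
    then obtain d where d: "\<And>b. d b > 0" and du: "\<And>b x x'. x \<in> T \<Longrightarrow> x' \<in> T \<Longrightarrow> dist x' x < d b \<Longrightarrow>
       dist (case x' of (t, z) \<Rightarrow> DX t z b) (case x of (t, z) \<Rightarrow> DX t z b) < e'" by metis
    define m where "m = min 1 (Min (d ` Basis) / 2)"
    have "Min (d ` Basis) > 0" using d by simp
    then have m: "0 < m" "m \<le> 1" and md: "\<And>b. b \<in> Basis \<Longrightarrow> m < d b"
      unfolding m_def using Min_le[of "d ` Basis"] by (auto, smt (verit) finite_Basis finite_imageI imageI field_sum_of_halves)
    have "norm (X t y - X t (\<phi> z0 t) - DX t (\<phi> z0 t) (y - \<phi> z0 t)) \<le> norm (y - \<phi> z0 t) * e"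
      if t: "t \<in> {0..1}" and y: "norm (y - \<phi> z0 t) \<le> m" for t y
    proof (rule differentiable_bound_linearization[where S = "cball (\<phi> z0 t) m"
            and f' = "DX t" and ?x0.0 = "\<phi> z0 t"])
      show "\<phi> z0 t + s *\<^sub>R (y - \<phi> z0 t) \<in> cball (\<phi> z0 t) m" if "s \<in> {0..1}" for s
        using that y mult_left_le_one_le[of "norm (y - \<phi> z0 t)" s] by (auto simp: dist_norm)
      show "\<phi> z0 t \<in> cball (\<phi> z0 t) m" using m by simp
      show "(X t has_derivative DX t z) (at z within cball (\<phi> z0 t) m)" for z
        by (rule has_derivative_at_withinI[OF deriv])
      show "onorm (DX t z - DX t (\<phi> z0 t)) \<le> e" if z: "z \<in> cball (\<phi> z0 t) m" for z
      proof (rule onorm_le)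
        fix u
        have "linear (\<lambda>u. DX t z u - DX t (\<phi> z0 t) u)" by (intro linear_compose_sub linear_DX)
        from linear_family_norm_le[OF this, of u]
        have "norm (DX t z u - DX t (\<phi> z0 t) u) \<le>
          (\<Sum>b\<in>Basis. norm (DX t z b - DX t (\<phi> z0 t) b)) * norm u" .
        also have "\<dots> \<le> (\<Sum>b\<in>(Basis::'a set). e') * norm u"
        proof (intro mult_right_mono sum_mono norm_ge_zero)
          fix b :: 'a assume b: "b \<in> Basis"
          have "(t, z) \<in> T" "(t, \<phi> z0 t) \<in> T"
            using t z m inR[of z t] inR0[of t] by (auto simp: T_def dist_norm norm_minus_commute)
          moreover have "dist (t, z) (t, \<phi> z0 t) < d b"
            using z md[OF b] by (simp add: dist_Pair_Pair dist_commute)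
          ultimately show "norm (DX t z b - DX t (\<phi> z0 t) b) \<le> e'"
            using du[of "(t, \<phi> z0 t)" "(t, z)" b] by (simp add: dist_norm)
        qed
        also have "\<dots> = e * norm u" by (simp add: e'_def)
        finally show "norm ((DX t z - DX t (\<phi> z0 t)) u) \<le> e * norm u" by simp
      qed
    qed
    then show ?thesis using m by (intro exI[of _ m]) (simp add: mult.commute)
  qed
  have "((\<lambda>z. \<phi> z t) has_derivative (\<lambda>w. V w t)) (at z0)" if t: "t \<in> {0..1}" for t
    unfolding has_derivative_at_alt
  proof (intro conjI allI impI)
    show "bounded_linear (\<lambda>w. V w t)" using linV[OF t] by (simp add: linear_conv_bounded_linear)
    fix e :: real assume e: "0 < e"
    \<comment> \<open>One factor C bounds the distance of the two orbits, the other comes from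
      Gronwall applied to the remainder.\<close>
    define e1 where "e1 = e / (C * C)"
    have e1: "0 < e1" using e C by (simp add: e1_def)
    obtain d where d: "0 < d" "d \<le> 1" "\<And>t y. t \<in> {0..1} \<Longrightarrow> norm (y - \<phi> z0 t) \<le> d \<Longrightarrow>
      norm (X t y - X t (\<phi> z0 t) - DX t (\<phi> z0 t) (y - \<phi> z0 t)) \<le> e1 * norm (y - \<phi> z0 t)"
      using unif[OF e1] by blast
    show "\<exists>d>0. \<forall>y. norm (y - z0) < d \<longrightarrow>
        norm (\<phi> y t - \<phi> z0 t - V (y - z0) t) \<le> e * norm (y - z0)"
    proof (intro exI[of _ "d / C"] conjI allI impI)
      show "0 < d / C" using d C by simp
      fix y assume "norm (y - z0) < d / C"
      then have yd: "C * norm (y - z0) < d" using C by (simp add: field_simps)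
      then have y1: "C * norm (y - z0) < 1" using d by linarith
      define u where "u r = \<phi> y r - \<phi> z0 r - V (y - z0) r" for r
      define E where "E = e1 * (C * norm (y - z0))"
      have E: "0 \<le> E" using e1 C by (simp add: E_def)
      have contu: "continuous_on {0..t} u" unfolding u_def by (intro continuous_intros cont\<phi> contV)
      have der: "(u has_vector_derivative X r (\<phi> y r) - X r (\<phi> z0 r) - F r (V (y - z0) r)) (at r)" for r
        unfolding u_def by (intro has_vector_derivative_diff \<phi> V)
      have bd: "norm (X r (\<phi> y r) - X r (\<phi> z0 r) - F r (V (y - z0) r)) \<le> K * norm (u r) + E"
        if "0 < r" "r < t" for r
      proof -
        have r: "r \<in> {0..1}" using that t by auto
        have "cl r = r" using r by (simp add: cl_def)
        then have eq: "X r (\<phi> y r) - X r (\<phi> z0 r) - F r (V (y - z0) r)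
          = F r (u r) + (X r (\<phi> y r) - X r (\<phi> z0 r) - DX r (\<phi> z0 r) (\<phi> y r - \<phi> z0 r))"
          by (simp add: F_def u_def linear_diff[OF linear_DX])
        have "norm (X r (\<phi> y r) - X r (\<phi> z0 r) - DX r (\<phi> z0 r) (\<phi> y r - \<phi> z0 r))
            \<le> e1 * norm (\<phi> y r - \<phi> z0 r)"
          by (rule d(3)[OF r]) (use near[OF y1 r] yd in linarith)
        also have "\<dots> \<le> E" unfolding E_def using near[OF y1 r] e1 by (intro mult_left_mono) auto
        finally show ?thesis unfolding eq using FK[of r "u r"] by (intro norm_triangle_le) linarith
      qed
      have u0: "u 0 = 0" by (simp add: u_def \<phi>0 V0)
      have "(norm (u t))\<^sup>2 + E\<^sup>2 \<le> ((norm (u 0))\<^sup>2 + E\<^sup>2) * exp ((2 * K + 1) * (t - 0))"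
        by (rule gronwall_square(1)[OF _ contu der bd K(1) E]) (use t in auto)
      also have "\<dots> \<le> E\<^sup>2 * C\<^sup>2" unfolding u0 by (simp, intro mult_left_mono) (use expC[OF t] in auto)
      finally have "(norm (u t))\<^sup>2 \<le> (E * C)\<^sup>2" by (simp add: power_mult_distrib) (smt (verit) zero_le_power2)
      then have "norm (u t) \<le> E * C" by (rule power2_le_imp_le) (use C E in auto)
      also have "E * C = e * norm (y - z0)" using C by (simp add: E_def e1_def)
      finally show "norm (\<phi> y t - \<phi> z0 t - V (y - z0) t) \<le> e * norm (y - z0)" by (simp add: u_def)
    qed
  qed
  moreover have "((\<lambda>t. V w t) has_vector_derivative DX t (\<phi> z0 t) (V w t)) (at t within {0..1})"
    if "t \<in> {0..1}" for w t
    using has_vector_derivative_at_within[OF V, of w t "{0..1}"] that by (simp add: F_def cl_def)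
  ultimately show ?thesis using V0 by (intro exI[of _ "\<lambda>t w. V w t"]) auto
qed

end

section \<open>Linear Lagrangian systems\<close>

text \<open>Turns differentiability into a limit of quotients, the form in which
  \<open>tendsto_linear_inverse\<close> can produce derivatives.\<close>

lemma has_vector_derivative_iff_quotient:
  "(f has_vector_derivative f') (at x within S) \<longleftrightarrow>
    ((\<lambda>y. (f y - f x) /\<^sub>R (y - x)) \<longlongrightarrow> f') (at x within S)"
proof -
  have "norm ((f y - f x) - (y - x) *\<^sub>R f') / norm (y - x) = norm ((f y - f x) /\<^sub>R (y - x) - f')"
    if "y \<noteq> x" for y
  proof -
    have "(f y - f x) - (y - x) *\<^sub>R f' = (y - x) *\<^sub>R ((f y - f x) /\<^sub>R (y - x) - f')"
      using that by (simp add: scaleR_diff_right)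
    then show ?thesis using that by simp
  qed
  then have "((\<lambda>y. norm ((f y - f x) - (y - x) *\<^sub>R f') / norm (y - x)) \<longlongrightarrow> 0) (at x within S) \<longleftrightarrow>
    ((\<lambda>y. norm ((f y - f x) /\<^sub>R (y - x) - f')) \<longlongrightarrow> 0) (at x within S)"
    by (intro tendsto_cong) (auto simp: eventually_at_filter)
  then show ?thesis
    unfolding has_vector_derivative_def has_derivative_iff_norm tendsto_norm_zero_iff LIM_zero_iff
    by (simp add: bounded_linear_scaleR_left)
qed

lemma continuous_on_linear_family:
  fixes A :: "'t::topological_space \<Rightarrow> 'a::euclidean_space \<Rightarrow> 'b::real_normed_vector"
  assumes "\<And>t. t \<in> S \<Longrightarrow> linear (A t)" "\<And>u. continuous_on S (\<lambda>t. A t u)" "continuous_on S y"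
  shows "continuous_on S (\<lambda>t. A t (y t))"
proof -
  have "continuous_on S (\<lambda>t. \<Sum>b\<in>Basis. (y t \<bullet> b) *\<^sub>R A t b)"
    by (intro continuous_intros assms)
  then show ?thesis
    by (rule continuous_on_eq) (simp add: linear_basis_expansion[OF assms(1), symmetric])
qed

lemma has_vector_derivative_linear_family:
  fixes A :: "real \<Rightarrow> 'a::euclidean_space \<Rightarrow> 'b::real_normed_vector"
  assumes lin: "\<And>t. t \<in> S \<Longrightarrow> linear (A t)" and lin': "linear A'" and t: "t \<in> S"
    and A: "\<And>u. ((\<lambda>t. A t u) has_vector_derivative A' u) (at t within S)"
    and c: "(c has_vector_derivative c') (at t within S)"
  shows "((\<lambda>t. A t (c t)) has_vector_derivative A' (c t) + A t c') (at t within S)"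
proof -
  have "((\<lambda>t. c t \<bullet> b) has_real_derivative c' \<bullet> b) (at t within S)" for b
    using bounded_linear.has_vector_derivative[OF bounded_linear_inner_left c]
    by (simp add: has_real_derivative_iff_has_vector_derivative)
  then have "((\<lambda>t. \<Sum>b\<in>Basis. (c t \<bullet> b) *\<^sub>R A t b) has_vector_derivative
      (\<Sum>b\<in>Basis. (c t \<bullet> b) *\<^sub>R A' b + (c' \<bullet> b) *\<^sub>R A t b)) (at t within S)"
    by (intro has_vector_derivative_sum has_vector_derivative_scaleR A)
  moreover have "(\<Sum>b\<in>Basis. (c t \<bullet> b) *\<^sub>R A' b + (c' \<bullet> b) *\<^sub>R A t b) = A' (c t) + A t c'"
    unfolding sum.distrib
    using linear_basis_expansion[OF lin'] linear_basis_expansion[OF lin[OF t]] by metis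
  ultimately show ?thesis
    by (intro has_vector_derivative_transform[OF t linear_basis_expansion[OF lin]]) simp_all
qed

text \<open>\<open>\<Gamma>\<close> is the fundamental solution of the linear Hamiltonian system dual to the quadratic Lagrangian
  with coefficients \<open>\<alpha>\<close>, \<open>\<beta>\<close>, \<open>\<delta>\<close>; \<open>V\<close> is the velocity as a function of \<open>(q, p)\<close> and \<open>\<beta>t\<close> the adjoint of \<open>\<beta>\<close>.\<close>

locale linear_lagrangian =
  fixes \<alpha> \<beta> \<beta>t \<delta> :: "real \<Rightarrow> real^'d \<Rightarrow> real^'d"
    and V :: "real \<Rightarrow> 'd::finite phase \<Rightarrow> real^'d"
    and \<Gamma> :: "real \<Rightarrow> 'd phase \<Rightarrow> 'd phase"
  assumes lin: "linear (\<alpha> t)" "linear (\<beta> t)" "linear (\<delta> t)"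
    and cont: "continuous_on {0..1} (\<lambda>t. \<alpha> t u)" "continuous_on {0..1} (\<lambda>t. \<beta> t u)"
      "continuous_on {0..1} (\<lambda>t. \<delta> t u)"
    and selfadj: "\<alpha> t u \<bullet> w = \<alpha> t w \<bullet> u" "\<delta> t u \<bullet> w = \<delta> t w \<bullet> u"
    and adj: "\<beta>t t v \<bullet> u = v \<bullet> \<beta> t u"
    and pos: "w \<noteq> 0 \<Longrightarrow> 0 < \<alpha> t w \<bullet> w"
    and V: "\<alpha> t (V t z) + \<beta> t (fst z) = snd z"
    and \<Gamma>0: "\<Gamma> 0 z = z"
    and lin\<Gamma>: "t \<in> {0..1} \<Longrightarrow> linear (\<Gamma> t)"
    and \<Gamma>q: "t \<in> {0..1} \<Longrightarrow>
      ((\<lambda>t. fst (\<Gamma> t z)) has_vector_derivative V t (\<Gamma> t z)) (at t within {0..1})"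
    and \<Gamma>p: "t \<in> {0..1} \<Longrightarrow>
      ((\<lambda>t. snd (\<Gamma> t z)) has_vector_derivative \<beta>t t (V t (\<Gamma> t z)) + \<delta> t (fst (\<Gamma> t z)))
        (at t within {0..1})"
begin

text \<open>The integrand of the Hessian with positions x, y and velocities v, w as independent
  arguments. This also accommodates broken extremals, whose velocities are set by hand at the
  corners.\<close>

definition ell :: "real \<Rightarrow> real^'d \<Rightarrow> real^'d \<Rightarrow> real^'d \<Rightarrow> real^'d \<Rightarrow> real"
  where "ell t x v y w = \<alpha> t v \<bullet> w + \<beta> t x \<bullet> w + v \<bullet> \<beta> t y + \<delta> t x \<bullet> y"

lemma ell_sym: "ell t x v y w = ell t y w x v"
  using selfadj(1)[of t v w] selfadj(2)[of t x y] inner_commute[of w "\<beta> t x"] inner_commute[of v "\<beta> t y"]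
  unfolding ell_def by linarith

lemma ell_add_left: "ell t (x + x') (v + v') y w = ell t x v y w + ell t x' v' y w"
  by (simp add: ell_def linear_add[OF lin(1)] linear_add[OF lin(2)] linear_add[OF lin(3)] inner_add_left)

lemma ell_scale_left: "ell t (c *\<^sub>R x) (c *\<^sub>R v) y w = c * ell t x v y w"
  by (simp add: ell_def linear_cmul[OF lin(1)] linear_cmul[OF lin(2)] linear_cmul[OF lin(3)] algebra_simps)

lemma ell_add_right: "ell t x v (y + y') (w + w') = ell t x v y w + ell t x v y' w'"
  by (metis ell_sym ell_add_left)

lemma ell_scale_right: "ell t x v (c *\<^sub>R y) (c *\<^sub>R w) = c * ell t x v y w"
  by (metis ell_sym ell_scale_left)

lemma ell_sum_left: "ell t (\<Sum>i\<in>I. x i) (\<Sum>i\<in>I. v i) y w = (\<Sum>i\<in>I. ell t (x i) (v i) y w)"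
proof (induction I rule: infinite_finite_induct)
qed (simp_all add: ell_add_left ell_def[of t 0 0] linear_0[OF lin(1)] linear_0[OF lin(2)] linear_0[OF lin(3)])

lemma ell_sum_right: "ell t x v (\<Sum>i\<in>I. y i) (\<Sum>i\<in>I. w i) = (\<Sum>i\<in>I. ell t x v (y i) (w i))"
  unfolding ell_sym[of t x v] by (rule ell_sum_left)

lemma continuous_ell:
  assumes "S \<subseteq> {0..1}" "continuous_on S x" "continuous_on S v" "continuous_on S y" "continuous_on S w"
  shows "continuous_on S (\<lambda>t. ell t (x t) (v t) (y t) (w t))"
proof -
  have "continuous_on S (\<lambda>t. \<alpha> t (f t))" "continuous_on S (\<lambda>t. \<beta> t (f t))" "continuous_on S (\<lambda>t. \<delta> t (f t))"
    if "continuous_on S f" for f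
    using continuous_on_linear_family[OF lin(1) continuous_on_subset[OF cont(1) assms(1)] that]
      continuous_on_linear_family[OF lin(2) continuous_on_subset[OF cont(2) assms(1)] that]
      continuous_on_linear_family[OF lin(3) continuous_on_subset[OF cont(3) assms(1)] that] .
  then show ?thesis unfolding ell_def using assms(2-) by (intro continuous_intros) auto
qed

lemma inj_\<alpha>: "inj (\<alpha> t)"
proof (subst linear_injective_0[OF lin(1)], intro allI impI, rule ccontr)
  fix v assume "\<alpha> t v = 0" "v \<noteq> 0"
  then show False using pos[of v t] by simp
qed

lemma V_unique: "\<alpha> t v + \<beta> t (fst z) = snd z \<Longrightarrow> V t z = v"
  by (rule injD[OF inj_\<alpha>[of t]], rule add_right_imp_eq[of _ "\<beta> t (fst z)"]) (simp add: V)

lemma linear_V: "linear (V t)"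
proof (rule linearI)
  fix z z' :: "'d phase" and c :: real
  show "V t (z + z') = V t z + V t z'"
    using V[of t z, symmetric] V[of t z', symmetric]
    by (intro V_unique) (simp add: linear_add[OF lin(1)] linear_add[OF lin(2)])
  show "V t (c *\<^sub>R z) = c *\<^sub>R V t z"
    using V[of t z, symmetric]
    by (intro V_unique) (simp add: linear_cmul[OF lin(1)] linear_cmul[OF lin(2)] scaleR_add_right)
qed

text \<open>Position, velocity and momentum at time t of the extremal whose state at time 0 is
  z.\<close>

abbreviation "eq z t \<equiv> fst (\<Gamma> t z)"
abbreviation "ev z t \<equiv> V t (\<Gamma> t z)"
abbreviation "ep z t \<equiv> snd (\<Gamma> t z)"

lemma eq_deriv: "t \<in> {a..b} \<Longrightarrow> {a..b} \<subseteq> {0..1} \<Longrightarrow> (eq z has_vector_derivative ev z t) (at t within {a..b})"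
  using has_vector_derivative_within_subset[OF \<Gamma>q] by blast

lemma ep_deriv: "t \<in> {a..b} \<Longrightarrow> {a..b} \<subseteq> {0..1} \<Longrightarrow>
   (ep z has_vector_derivative \<beta>t t (ev z t) + \<delta> t (eq z t)) (at t within {a..b})"
  using has_vector_derivative_within_subset[OF \<Gamma>p] by blast

lemma continuous_eq_ep: "S \<subseteq> {0..1} \<Longrightarrow> continuous_on S (eq z)" "S \<subseteq> {0..1} \<Longrightarrow> continuous_on S (ep z)"
proof -
  have "continuous_on {0..1} (eq z)" "continuous_on {0..1} (ep z)"
    unfolding continuous_on_eq_continuous_within
    using has_vector_derivative_continuous[OF \<Gamma>q] has_vector_derivative_continuous[OF \<Gamma>p] by blast+
  then show "S \<subseteq> {0..1} \<Longrightarrow> continuous_on S (eq z)" "S \<subseteq> {0..1} \<Longrightarrow> continuous_on S (ep z)"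
    by (blast intro: continuous_on_subset)+
qed

lemma continuous_\<Gamma>: "S \<subseteq> {0..1} \<Longrightarrow> continuous_on S (\<lambda>t. \<Gamma> t z)"
  using continuous_on_Pair[OF continuous_eq_ep(1)[of S z] continuous_eq_ep(2)[of S z]] by simp

lemma continuous_ev: "S \<subseteq> {0..1} \<Longrightarrow> continuous_on S (ev z)"
proof -
  have "continuous_on {0..1} (ev z)"
    unfolding continuous_on_def
  proof
    fix t :: real assume t: "t \<in> {0..1}"
    have c: "continuous_on {0..1} (\<lambda>t. ep z t - \<beta> t (eq z t))"
      by (rule continuous_on_diff[OF continuous_eq_ep(2) continuous_on_linear_family[OF lin(2) cont(2) continuous_eq_ep(1)]]) auto
    have eq: "\<alpha> t (ev z t) = ep z t - \<beta> t (eq z t)" for t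
      using V[of t "\<Gamma> t z"] by (simp add: algebra_simps)
    show "(ev z \<longlongrightarrow> ev z t) (at t within {0..1})"
    proof (rule tendsto_linear_inverse[OF lin(1) inj_\<alpha>])
      show "((\<lambda>x. \<alpha> x u) \<longlongrightarrow> \<alpha> t u) (at t within {0..1})" for u
        using cont(1) t by (auto simp: continuous_on_def)
      show "((\<lambda>x. \<alpha> x (ev z x)) \<longlongrightarrow> \<alpha> t (ev z t)) (at t within {0..1})"
        unfolding eq using c t by (auto simp: continuous_on_def)
    qed (simp add: lin)
  qed
  then show "S \<subseteq> {0..1} \<Longrightarrow> continuous_on S (ev z)" by (rule continuous_on_subset)
qed

text \<open>By p = \<alpha> v + \<beta> q and the equation for p', the integrand pairing an extremal
  with any curve \<eta> is the derivative of \<open>ep z t \<bullet> \<eta> t\<close>. All boundary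
  terms below originate here.\<close>

lemma first_variation:
  assumes ab: "a \<le> b" "{a..b} \<subseteq> {0..1}"
    and \<eta>: "\<And>t. t \<in> {a..b} \<Longrightarrow> (\<eta> has_vector_derivative \<eta>' t) (at t within {a..b})"
  shows "((\<lambda>t. ell t (eq z t) (ev z t) (\<eta> t) (\<eta>' t)) has_integral ep z b \<bullet> \<eta> b - ep z a \<bullet> \<eta> a) {a..b}"
proof (rule fundamental_theorem_of_calculus[OF ab(1)])
  fix t assume t: "t \<in> {a..b}"
  have "((\<lambda>t. ep z t \<bullet> \<eta> t) has_vector_derivative
     ep z t \<bullet> \<eta>' t + (\<beta>t t (ev z t) + \<delta> t (eq z t)) \<bullet> \<eta> t) (at t within {a..b})"
    by (rule bounded_bilinear.has_vector_derivative[OF bounded_bilinear_inner ep_deriv[OF t ab(2)] \<eta>[OF t]])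
  moreover have "ep z t \<bullet> \<eta>' t + (\<beta>t t (ev z t) + \<delta> t (eq z t)) \<bullet> \<eta> t
     = ell t (eq z t) (ev z t) (\<eta> t) (\<eta>' t)"
    unfolding V[of t "\<Gamma> t z", symmetric] ell_def by (simp add: inner_add_left adj)
  ultimately show "((\<lambda>t. ep z t \<bullet> \<eta> t) has_vector_derivative ell t (eq z t) (ev z t) (\<eta> t) (\<eta>' t))
      (at t within {a..b})" by simp
qed

text \<open>Two extremals can be paired in either order in the first variation. The symmetry of
  \<open>ell\<close> equates the boundary terms, which says that the symplectic form is
  preserved.\<close>

lemma symplectic:
  assumes "t \<in> {0..1}"
  shows "ep z t \<bullet> eq z' t - ep z' t \<bullet> eq z t = snd z \<bullet> fst z' - snd z' \<bullet> fst z"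
proof -
  have s: "0 \<le> t" "{0..t} \<subseteq> {0..1}" using assms by auto
  have i1: "((\<lambda>r. ell r (eq z r) (ev z r) (eq z' r) (ev z' r)) has_integral ep z t \<bullet> eq z' t - ep z 0 \<bullet> eq z' 0) {0..t}"
    by (rule first_variation[OF s]) (rule eq_deriv[OF _ s(2)])
  have i2: "((\<lambda>r. ell r (eq z r) (ev z r) (eq z' r) (ev z' r)) has_integral ep z' t \<bullet> eq z t - ep z' 0 \<bullet> eq z 0) {0..t}"
    by (subst ell_sym, rule first_variation[OF s]) (rule eq_deriv[OF _ s(2)])
  show ?thesis using has_integral_unique[OF i1 i2] by (simp add: \<Gamma>0)
qed

lemma inj_\<Gamma>: "t \<in> {0..1} \<Longrightarrow> inj (\<Gamma> t)"
proof (subst linear_injective_0[OF lin\<Gamma>], assumption, intro allI impI)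
  fix z assume t: "t \<in> {0..1}" and z: "\<Gamma> t z = 0"
  have "snd z \<bullet> fst z' = snd z' \<bullet> fst z" for z'
    using symplectic[OF t, of z z'] z by simp
  \<comment> \<open>Pairing z with its rotation by the complex structure gives the squared norm of
    z.\<close>
  from this[of "(snd z, - fst z)"] have "snd z \<bullet> snd z + fst z \<bullet> fst z = 0" by simp
  then show "z = 0" by (simp add: prod_eq_iff add_nonneg_eq_0_iff)
qed

lemma bij_\<Gamma>: "t \<in> {0..1} \<Longrightarrow> bij (\<Gamma> t)"
  using inj_\<Gamma>[of t] linear_injective_imp_surjective[OF lin\<Gamma>[of t]] by (auto simp: bij_def)

lemma \<Gamma>_inv: "t \<in> {0..1} \<Longrightarrow> \<Gamma> t (inv (\<Gamma> t) z) = z"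
  using bij_\<Gamma> by (simp add: bij_is_surj surj_f_inv_f)

lemma linear_inv_\<Gamma>: "t \<in> {0..1} \<Longrightarrow> linear (inv (\<Gamma> t))"
proof (rule linearI)
  fix z z' :: "'d phase" and c :: real assume t: "t \<in> {0..1}"
  note i = inv_f_eq[OF inj_\<Gamma>[OF t]]
  show "inv (\<Gamma> t) (z + z') = inv (\<Gamma> t) z + inv (\<Gamma> t) z'"
    by (rule i) (simp only: linear_add[OF lin\<Gamma>[OF t]] \<Gamma>_inv[OF t])
  show "inv (\<Gamma> t) (c *\<^sub>R z) = c *\<^sub>R inv (\<Gamma> t) z"
    by (rule i) (simp only: linear_cmul[OF lin\<Gamma>[OF t]] \<Gamma>_inv[OF t])
qed

text \<open>Jacobi's argument: writing \<open>\<eta> = M c\<close> along the Lagrangian frame that starts at \<open>{p = 0}\<close>,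
  the quadratic integrand differs from \<open>\<langle>\<alpha> M c', M c'\<rangle>\<close> by an exact derivative.\<close>

lemma jacobi_nonneg:
  assumes ab: "a \<le> b" "{a..b} \<subseteq> {0..1}"
    and inj: "\<And>t X. t \<in> {a..b} \<Longrightarrow> fst (\<Gamma> t (inv (\<Gamma> a) (X, 0))) = 0 \<Longrightarrow> X = 0"
    and \<eta>: "\<And>t. t \<in> {a..b} \<Longrightarrow> (\<eta> has_vector_derivative \<eta>' t) (at t within {a..b})"
    and \<eta>b: "\<eta> b = 0"
    and int: "((\<lambda>t. ell t (\<eta> t) (\<eta>' t) (\<eta> t) (\<eta>' t)) has_integral I) {a..b}"
  shows "0 \<le> I"
proof -
  have a: "a \<in> {0..1}" and t01: "\<And>t. t \<in> {a..b} \<Longrightarrow> t \<in> {0..1}" using ab by auto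
  define U where "U X = inv (\<Gamma> a) (X, 0)" for X
  have linU: "linear U"
    unfolding U_def
    by (rule linear_compose[of "\<lambda>X. (X, 0)", unfolded o_def, OF _ linear_inv_\<Gamma>[OF a]])
       (auto intro!: linearI)
  define M where "M t X = eq (U X) t" for t X
  define M' where "M' t X = ev (U X) t" for t X
  define N where "N t X = ep (U X) t" for t X
  have lins: "linear (M t)" "linear (M' t)" "linear (N t)" if "t \<in> {a..b}" for t
  proof -
    have l: "linear (\<lambda>X. \<Gamma> t (U X))"
      using linear_compose[OF linU lin\<Gamma>[OF t01[OF that]]] by (simp add: o_def)
    show "linear (M t)" unfolding M_def using linear_compose[OF l linear_fst] by (simp add: o_def)
    show "linear (M' t)" unfolding M'_def using linear_compose[OF l linear_V] by (simp add: o_def)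
    show "linear (N t)" unfolding N_def using linear_compose[OF l linear_snd] by (simp add: o_def)
  qed
  have injM: "inj (M t)" if "t \<in> {a..b}" for t
    using inj[OF that] by (auto simp: linear_injective_0[OF lins(1)[OF that]] M_def U_def)
  have dM: "((\<lambda>t. M t X) has_vector_derivative M' t X) (at t within {a..b})" if "t \<in> {a..b}" for t X
    unfolding M_def M'_def by (rule eq_deriv[OF that ab(2)])
  define N' where "N' t X = \<beta>t t (M' t X) + \<delta> t (M t X)" for t X
  have dN: "((\<lambda>t. N t X) has_vector_derivative N' t X) (at t within {a..b})" if "t \<in> {a..b}" for t X
    unfolding N_def N'_def M_def M'_def by (rule ep_deriv[OF that ab(2)])
  have lin\<beta>t: "linear (\<beta>t t)" for t
    by (rule linearI; rule vector_eq_rdot[THEN iffD1]) (simp_all add: adj inner_add_left)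
  have linN': "linear (N' t)" if "t \<in> {a..b}" for t
    unfolding N'_def
    using linear_compose[OF lins(2)[OF that] lin\<beta>t[of t]] linear_compose[OF lins(1)[OF that] lin(3)[of t]]
    by (simp add: o_def linear_compose_add)
  \<comment> \<open>The symplectic pairing of two frame curves is constant in time and vanishes at
    a, where all their momenta are 0.\<close>
  have lag: "N t X \<bullet> M t X' = M t X \<bullet> N t X'" if "t \<in> {a..b}" for t X X'
  proof -
    have "N t X \<bullet> M t X' - N t X' \<bullet> M t X = N a X \<bullet> M a X' - N a X' \<bullet> M a X"
      unfolding M_def N_def using symplectic[OF t01[OF that], of "U X" "U X'"] symplectic[OF a, of "U X" "U X'"] by simp
    also have "\<dots> = 0" unfolding M_def N_def U_def by (simp add: \<Gamma>_inv[OF a])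
    finally show ?thesis by (simp add: inner_commute)
  qed
  have NM: "N t X = \<alpha> t (M' t X) + \<beta> t (M t X)" for t X
    unfolding N_def M_def M'_def by (simp add: V)
  define c where "c t = inv (M t) (\<eta> t)" for t
  have surjM: "surj (M t)" if "t \<in> {a..b}" for t
    using linear_injective_imp_surjective[OF lins(1)[OF that] injM[OF that]] by simp
  have Mc: "M t (c t) = \<eta> t" if "t \<in> {a..b}" for t
    unfolding c_def using surjM[OF that] by (simp add: surj_f_inv_f)
  define c' where "c' t = inv (M t) (\<eta>' t - M' t (c t))" for t
  have Mc': "M t (c' t) = \<eta>' t - M' t (c t)" if "t \<in> {a..b}" for t
    unfolding c'_def using surjM[OF that] by (simp add: surj_f_inv_f)
  \<comment> \<open>The coordinates c are defined only by \<open>M t (c t) = \<eta> t\<close>. The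
    frame matrix applied to their difference quotients converges to
    \<open>\<eta>' t - M' t (c t)\<close>, and injectivity of \<open>M t\<close> recovers the limit
    of the quotients.\<close>
  have dc: "(c has_vector_derivative c' t) (at t within {a..b})" if t: "t \<in> {a..b}" for t
    unfolding has_vector_derivative_iff_quotient
  proof (rule tendsto_linear_inverse[OF lins(1)[OF t] injM[OF t]])
    show "\<forall>\<^sub>F s in at t within {a..b}. linear (M s)"
      unfolding eventually_at_filter using lins(1) by (auto intro: always_eventually)
    show "((\<lambda>s. M s u) \<longlongrightarrow> M t u) (at t within {a..b})" for u
      using has_vector_derivative_continuous[OF dM[OF t]] by (simp add: continuous_within)
    have q1: "((\<lambda>s. (\<eta> s - \<eta> t) /\<^sub>R (s - t) - (M s (c t) - M t (c t)) /\<^sub>R (s - t)) \<longlongrightarrow> \<eta>' t - M' t (c t))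
        (at t within {a..b})"
      by (intro tendsto_diff \<eta>[OF t, unfolded has_vector_derivative_iff_quotient]
          dM[OF t, unfolded has_vector_derivative_iff_quotient])
    have q2: "M s ((c s - c t) /\<^sub>R (s - t)) = (\<eta> s - \<eta> t) /\<^sub>R (s - t) - (M s (c t) - M t (c t)) /\<^sub>R (s - t)"
      if "s \<in> {a..b}" for s
      using Mc[OF t] Mc[OF that]
      by (simp add: linear_cmul[OF lins(1)[OF that]] linear_diff[OF lins(1)[OF that]] scaleR_diff_right[symmetric])
    show "((\<lambda>s. M s ((c s - c t) /\<^sub>R (s - t))) \<longlongrightarrow> M t (c' t)) (at t within {a..b})"
      unfolding Mc'[OF t]
      by (rule Lim_transform_eventually[OF q1]) (auto intro!: always_eventually simp: eventually_at_filter q2)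
  qed
  \<comment> \<open>The exact derivative to be subtracted. Its integral vanishes because the frame
    momenta \<open>N\<close> are 0 at a and \<eta> is 0 at b.\<close>
  define D where "D t = N t (c t) \<bullet> \<eta>' t + (N' t (c t) + N t (c' t)) \<bullet> \<eta> t" for t
  have dD: "((\<lambda>t. N t (c t) \<bullet> \<eta> t) has_vector_derivative D t) (at t within {a..b})" if t: "t \<in> {a..b}" for t
    unfolding D_def
    by (intro bounded_bilinear.has_vector_derivative[OF bounded_bilinear_inner] \<eta>[OF t]
        has_vector_derivative_linear_family lins linN' dN dc t)
  have "(D has_integral N b (c b) \<bullet> \<eta> b - N a (c a) \<bullet> \<eta> a) {a..b}"
    by (rule fundamental_theorem_of_calculus[OF ab(1) dD])
  moreover have "N a X = 0" for X unfolding N_def U_def by (simp add: \<Gamma>_inv[OF a])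
  ultimately have "(D has_integral 0) {a..b}" using \<eta>b by simp
  from has_integral_diff[OF int this]
  have "((\<lambda>t. ell t (\<eta> t) (\<eta>' t) (\<eta> t) (\<eta>' t) - D t) has_integral I) {a..b}" by simp
  moreover have "0 \<le> ell t (\<eta> t) (\<eta>' t) (\<eta> t) (\<eta>' t) - D t" if t: "t \<in> {a..b}" for t
  proof -
    \<comment> \<open>The velocity of \<eta> splits into the part m carried by the frame and the
      part z coming from the change of the coordinates. After \<open>lag\<close> everything except
      the square of z cancels.\<close>
    define m where "m = M' t (c t)"
    define z where "z = M t (c' t)"
    have \<eta>': "\<eta>' t = m + z" using Mc'[OF t] by (simp add: m_def z_def)
    have N: "N t (c t) = \<alpha> t m + \<beta> t (\<eta> t)" unfolding NM m_def Mc[OF t] ..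
    have N': "N' t (c t) = \<beta>t t m + \<delta> t (\<eta> t)" unfolding N'_def m_def Mc[OF t] ..
    have "N t (c' t) \<bullet> \<eta> t = z \<bullet> N t (c t)" unfolding z_def lag[OF t, symmetric] Mc[OF t] ..
    then have "D t = (\<alpha> t m + \<beta> t (\<eta> t)) \<bullet> (m + z) + (\<beta>t t m + \<delta> t (\<eta> t)) \<bullet> \<eta> t + z \<bullet> (\<alpha> t m + \<beta> t (\<eta> t))"
      unfolding D_def N N' \<eta>' by (simp add: inner_add_left)
    then have "ell t (\<eta> t) (\<eta>' t) (\<eta> t) (\<eta>' t) - D t = \<alpha> t z \<bullet> z"
      unfolding ell_def \<eta>'
      by (simp add: linear_add[OF lin(1)] inner_add_left inner_add_right adj selfadj(1)[of t z m] inner_commute[of _ "\<alpha> t _"] inner_commute[of _ "\<beta> t _"])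
    also have "0 \<le> \<dots>" using pos[of z t] by (cases "z = 0") auto
    finally show ?thesis .
  qed
  ultimately show ?thesis by (rule has_integral_nonneg)
qed

end

section \<open>Broken extremals and the discrete action\<close>

lemma sum_fun_apply: "(\<Sum>i\<in>I. f i) x = (\<Sum>i\<in>I. f i x)"
  for f :: "'i \<Rightarrow> 'a \<Rightarrow> 'b::comm_monoid_add"
  by (induction I rule: infinite_finite_induct) (simp_all add: zero_fun_def plus_fun_def)

lemma has_integral_partition:
  fixes f :: "real \<Rightarrow> 'a::banach"
  assumes k: "0 < k" and f: "\<And>j. j < k \<Longrightarrow> (f has_integral I j) {real j / real k..real (Suc j) / real k}"
  shows "(f has_integral (\<Sum>j<k. I j)) {0..1}"
proof -
  have "(f has_integral (\<Sum>j<m. I j)) {0..real m / real k}" if "m \<le> k" for m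
    using that
  proof (induction m)
    case 0 then show ?case by (simp add: has_integral_refl)
  next
    case (Suc m)
    then show ?case
      using has_integral_combine[of 0 "real m / real k" "real (Suc m) / real k" f "\<Sum>j<m. I j" "I m"] f[of m]
      by (simp add: divide_right_mono)
  qed
  from this[of k] k show ?thesis by simp
qed

context linear_lagrangian
begin

lemma ell_square_add:
  "ell t (x + c *\<^sub>R y) (v + c *\<^sub>R w) (x + c *\<^sub>R y) (v + c *\<^sub>R w) =
    ell t x v x v + 2 * c * ell t x v y w + c\<^sup>2 * ell t y w y w"
  using ell_sym[of t y w x v]
  by (simp add: ell_add_left ell_add_right ell_scale_left ell_scale_right power2_eq_square algebra_simps)

text \<open>Putting Y = 0 and X' = 0 into the first equation of the generating function leaves X =
  0.\<close>

lemma described_frame_inj: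
  assumes "described_by (\<Gamma> t \<circ> inv (\<Gamma> a)) D" "fst (\<Gamma> t (inv (\<Gamma> a) (X, 0))) = 0"
  shows "X = 0"
proof -
  obtain A B C where D: "D = (A, B, C)" by (cases D)
  have "(\<Gamma> t \<circ> inv (\<Gamma> a)) (X, 0) = (0, snd (\<Gamma> t (inv (\<Gamma> a) (X, 0))))"
    using assms(2) by (simp add: prod_eq_iff)
  then have "0 - X = - (B *v 0) - C *v 0"
    using assms(1) unfolding D described_by_def by blast
  then show ?thesis by simp
qed

context
  fixes a b :: real and A B C :: "real^'d^'d"
  assumes ab: "a < b" "{a..b} \<subseteq> {0..1}"
    and fine: "\<And>t. t \<in> {a..b} \<Longrightarrow> \<exists>D. described_by (\<Gamma> t \<circ> inv (\<Gamma> a)) D"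
    and desc: "described_by (\<Gamma> b \<circ> inv (\<Gamma> a)) (A, B, C)"
begin

lemma a01: "a \<in> {0..1}" using ab by auto

text \<open>The frame has to stay nondegenerate throughout the step, so \<open>fine\<close> provides
  a generating function at every time in \<open>{a..b}\<close> and not only at b.\<close>

lemma step_nonneg:
  assumes \<eta>: "\<And>t. t \<in> {a..b} \<Longrightarrow> (\<eta> has_vector_derivative \<eta>' t) (at t within {a..b})"
    and \<eta>b: "\<eta> b = 0"
    and int: "((\<lambda>t. ell t (\<eta> t) (\<eta>' t) (\<eta> t) (\<eta>' t)) has_integral I) {a..b}"
  shows "0 \<le> I"
proof (rule jacobi_nonneg[OF less_imp_le[OF ab(1)] ab(2) _ \<eta> \<eta>b int])
  show "X = 0" if "t \<in> {a..b}" "fst (\<Gamma> t (inv (\<Gamma> a) (X, 0))) = 0" for t X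
    using fine[OF that(1)] described_frame_inj that(2) by blast
qed

lemma step_image:
  assumes "X' - X = - (B *v X') - C *v Y"
  shows "\<Gamma> b (inv (\<Gamma> a) (X, Y)) = (X', Y + A *v X' + transpose B *v Y)"
proof -
  have "(Y + A *v X' + transpose B *v Y) - Y = A *v X' + transpose B *v Y" by simp
  with assms have "(\<Gamma> b \<circ> inv (\<Gamma> a)) (X, Y) = (X', Y + A *v X' + transpose B *v Y)"
    using desc unfolding described_by_def by blast
  then show ?thesis by simp
qed

text \<open>The extremal from (CY, Y) at time a reaches position 0 at time b, and its second
  variation is the boundary term - <CY, Y>. Adding s times a linear curve from Y to 0 changes it by
  - 2s|Y|^2 + s^2 c. Nonnegativity for a small s > 0 forces <CY, Y> to be strictly negative.\<close>

lemma step_C_negative: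
  assumes Y: "Y \<noteq> 0"
  shows "(C *v Y) \<bullet> Y < 0"
proof (rule ccontr)
  assume nn: "\<not> (C *v Y) \<bullet> Y < 0"
  define z where "z = inv (\<Gamma> a) (C *v Y, Y)"
  have za: "\<Gamma> a z = (C *v Y, Y)" unfolding z_def by (rule \<Gamma>_inv[OF a01])
  have zb: "\<Gamma> b z = (0, Y + A *v 0 + transpose B *v Y)" unfolding z_def by (rule step_image) simp
  define \<zeta> where "\<zeta> t = (1 / (b - a)) *\<^sub>R ((b - t) *\<^sub>R Y)" for t
  define \<zeta>' where "\<zeta>' t = (1 / (b - a)) *\<^sub>R (- Y)" for t :: real
  have d\<zeta>: "(\<zeta> has_vector_derivative \<zeta>' t) (at t within {a..b})" for t
    unfolding \<zeta>_def \<zeta>'_def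
    by (intro bounded_linear.has_vector_derivative[OF bounded_linear_scaleR_right])
       (auto intro!: derivative_eq_intros)
  have \<zeta>: "\<zeta> a = Y" "\<zeta> b = 0" using ab(1) by (simp_all add: \<zeta>_def)
  note le = less_imp_le[OF ab(1)]
  note dz = eq_deriv[OF _ ab(2)]
  have i1: "((\<lambda>t. ell t (eq z t) (ev z t) (eq z t) (ev z t)) has_integral - ((C *v Y) \<bullet> Y)) {a..b}"
    using first_variation[OF le ab(2) dz, of z z] by (simp add: za zb inner_commute)
  have i2: "((\<lambda>t. ell t (eq z t) (ev z t) (\<zeta> t) (\<zeta>' t)) has_integral - (Y \<bullet> Y)) {a..b}"
    using first_variation[OF le ab(2) d\<zeta>, of z] by (simp add: za zb \<zeta>)
  have "continuous_on {a..b} \<zeta>" "continuous_on {a..b} \<zeta>'"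
    unfolding \<zeta>_def \<zeta>'_def using ab(1) by (auto intro!: continuous_intros)
  then obtain c where i3: "((\<lambda>t. ell t (\<zeta> t) (\<zeta>' t) (\<zeta> t) (\<zeta>' t)) has_integral c) {a..b}"
    using integrable_continuous_real[OF continuous_ell[OF ab(2)]] unfolding integrable_on_def by blast
  have quad: "0 \<le> - ((C *v Y) \<bullet> Y) + 2 * s * (- (Y \<bullet> Y)) + s\<^sup>2 * c" for s
  proof (rule step_nonneg)
    show "((\<lambda>t. eq z t + s *\<^sub>R \<zeta> t) has_vector_derivative ev z t + s *\<^sub>R \<zeta>' t) (at t within {a..b})"
      if "t \<in> {a..b}" for t
      by (intro has_vector_derivative_add dz that
          bounded_linear.has_vector_derivative[OF bounded_linear_scaleR_right] d\<zeta>)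
    show "eq z b + s *\<^sub>R \<zeta> b = 0" by (simp add: zb \<zeta>)
    show "((\<lambda>t. ell t (eq z t + s *\<^sub>R \<zeta> t) (ev z t + s *\<^sub>R \<zeta>' t) (eq z t + s *\<^sub>R \<zeta> t) (ev z t + s *\<^sub>R \<zeta>' t))
        has_integral - ((C *v Y) \<bullet> Y) + 2 * s * (- (Y \<bullet> Y)) + s\<^sup>2 * c) {a..b}"
      unfolding ell_square_add by (intro has_integral_add has_integral_mult_right i1 i2 i3)
  qed
  define y where "y = Y \<bullet> Y"
  have y: "0 < y" using Y by (simp add: y_def)
  \<comment> \<open>With this s the term s^2 c is at most s|Y|^2, half of the linear term, so the
    sum would be negative if <CY, Y> were nonnegative.\<close>
  define s where "s = y / (\<bar>c\<bar> + 1)"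
  have s: "0 < s" using y by (simp add: s_def add_nonneg_pos)
  have "s * c \<le> s * (\<bar>c\<bar> + 1)" using s by (intro mult_left_mono) auto
  also have "\<dots> = y" by (simp add: s_def add_nonneg_eq_0_iff)
  finally have "s * (s * c) \<le> s * y" using s by (intro mult_left_mono) auto
  moreover have "0 < s * y" using s y by simp
  ultimately show False using quad[of s] nn by (simp add: y_def[symmetric] power2_eq_square)
qed

text \<open>The difference of the curve and the extremal vanishes at both ends: the mixed term is 0
  by the first variation, and the quadratic term is nonnegative by
  \<open>step_nonneg\<close>.\<close>

lemma step_minimal:
  assumes \<xi>: "\<And>t. t \<in> {a..b} \<Longrightarrow> (\<xi> has_vector_derivative \<xi>' t) (at t within {a..b})"
    and ends: "eq z a = \<xi> a" "eq z b = \<xi> b"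
    and int: "((\<lambda>t. ell t (\<xi> t) (\<xi>' t) (\<xi> t) (\<xi>' t)) has_integral I) {a..b}"
  shows "ep z b \<bullet> eq z b - ep z a \<bullet> eq z a \<le> I"
proof -
  note le = less_imp_le[OF ab(1)]
  note dz = eq_deriv[OF _ ab(2)]
  have d: "((\<lambda>t. \<xi> t - eq z t) has_vector_derivative \<xi>' t - ev z t) (at t within {a..b})"
    if "t \<in> {a..b}" for t
    by (intro has_vector_derivative_diff \<xi> dz that)
  have i1: "((\<lambda>t. ell t (eq z t) (ev z t) (eq z t) (ev z t)) has_integral
      ep z b \<bullet> eq z b - ep z a \<bullet> eq z a) {a..b}"
    by (rule first_variation[OF le ab(2) dz])
  have i2: "((\<lambda>t. ell t (eq z t) (ev z t) (\<xi> t - eq z t) (\<xi>' t - ev z t)) has_integral 0) {a..b}"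
    using first_variation[OF le ab(2) d, of z] ends by simp
  have "ell t (\<xi> t) (\<xi>' t) (\<xi> t) (\<xi>' t) = ell t (eq z t) (ev z t) (eq z t) (ev z t) +
      2 * ell t (eq z t) (ev z t) (\<xi> t - eq z t) (\<xi>' t - ev z t) +
      ell t (\<xi> t - eq z t) (\<xi>' t - ev z t) (\<xi> t - eq z t) (\<xi>' t - ev z t)" for t
    using ell_square_add[of t "eq z t" 1 "\<xi> t - eq z t" "ev z t" "\<xi>' t - ev z t"] by simp
  note h = this
  have e: "ell t (\<xi> t - eq z t) (\<xi>' t - ev z t) (\<xi> t - eq z t) (\<xi>' t - ev z t) =
     ell t (\<xi> t) (\<xi>' t) (\<xi> t) (\<xi>' t) - ell t (eq z t) (ev z t) (eq z t) (ev z t) -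
      2 * ell t (eq z t) (ev z t) (\<xi> t - eq z t) (\<xi>' t - ev z t)" for t
    using h[of t] by linarith
  have "0 \<le> I - (ep z b \<bullet> eq z b - ep z a \<bullet> eq z a) - 2 * 0"
  proof (rule step_nonneg[OF d])
    show "\<xi> b - eq z b = 0" using ends by simp
    show "((\<lambda>t. ell t (\<xi> t - eq z t) (\<xi>' t - ev z t) (\<xi> t - eq z t) (\<xi>' t - ev z t)) has_integral
        I - (ep z b \<bullet> eq z b - ep z a \<bullet> eq z a) - 2 * 0) {a..b}"
      unfolding e by (intro has_integral_diff has_integral_mult_right int i1 i2)
  qed
  then show ?thesis by simp
qed

end

definition hess :: "(real \<Rightarrow> real^'d) \<Rightarrow> (real \<Rightarrow> real^'d) \<Rightarrow> real"
  where "hess \<xi> \<eta> = integral {0..1} (\<lambda>t. ell t (\<xi> t) (velocity \<xi> t) (\<eta> t) (velocity \<eta> t))"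

lemma loop_deriv:
  assumes "\<xi> \<in> loops"
  shows "(\<xi> has_vector_derivative velocity \<xi> t) (at t within S)" "continuous_on S \<xi>"
    "continuous_on S (velocity \<xi>)"
  using smooth_velocity[of \<xi>] assms
  by (auto simp: loops_def intro: has_vector_derivative_at_within)

lemma ell_loops_integrable:
  assumes "\<xi> \<in> loops" "\<eta> \<in> loops" "{a..b} \<subseteq> {0..1}"
  shows "(\<lambda>t. ell t (\<xi> t) (velocity \<xi> t) (\<eta> t) (velocity \<eta> t)) integrable_on {a..b}"
  by (intro integrable_continuous_real continuous_ell loop_deriv assms)

end

locale fine_partition = linear_lagrangian \<alpha> \<beta> \<beta>t \<delta> V \<Gamma>
  for \<alpha> \<beta> \<beta>t \<delta> :: "real \<Rightarrow> real^'d::finite \<Rightarrow> real^'d" and V \<Gamma> +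
  fixes k :: nat
  assumes fine_k: "fine_enough \<Gamma> k"
begin

definition node :: "nat \<Rightarrow> real" where "node j = real j / real k"

definition "A j = fst (step_data \<Gamma> k j)"
definition "B j = fst (snd (step_data \<Gamma> k j))"
definition "C j = snd (snd (step_data \<Gamma> k j))"

lemma k: "0 < k" using fine_k by (simp add: fine_enough_def)

lemma node_0: "node 0 = 0" and node_k: "node k = 1"
  using k by (simp_all add: node_def)

lemma node_less: "node j < node (Suc j)"
  using k by (simp add: node_def divide_strict_right_mono)

lemma node_subset: "j < k \<Longrightarrow> {node j..node (Suc j)} \<subseteq> {0..1}"
  using k by (auto simp: node_def field_simps intro: order_trans)

lemma fine_step:
  assumes "j < k" "t \<in> {node j..node (Suc j)}"
  shows "\<exists>D. described_by (\<Gamma> t \<circ> inv (\<Gamma> (node j))) D"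
proof -
  have "node (Suc j) - node j = 1 / real k" unfolding node_def by (simp add: add_divide_distrib)
  then have "\<bar>node j - t\<bar> \<le> 1 / real k" using assms(2) by auto
  moreover have "t \<in> {0..1}" "node j \<in> {0..1}"
    using node_subset[OF assms(1)] assms(2) node_less[of j] by auto
  ultimately show ?thesis using fine_k unfolding fine_enough_def by blast
qed

lemma desc: "j < k \<Longrightarrow> described_by (\<Gamma> (node (Suc j)) \<circ> inv (\<Gamma> (node j))) (A j, B j, C j)"
proof -
  assume j: "j < k"
  obtain D where D: "described_by (\<Gamma> (node (Suc j)) \<circ> inv (\<Gamma> (node j))) D"
    using fine_step[OF j] node_less[of j] by force
  then have "generating_data (\<Gamma> (node (Suc j)) \<circ> inv (\<Gamma> (node j))) = D"
    unfolding generating_data_def using described_by_unique by blast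
  then show ?thesis using D by (simp add: A_def B_def C_def step_data_def node_def)
qed

lemma transpose_C: "j < k \<Longrightarrow> transpose (C j) = C j"
  using desc by (auto simp: described_by_def)

context
  fixes j assumes j: "j < k"
begin

lemmas C_negative = step_C_negative[OF node_less node_subset[OF j] fine_step[OF j] desc[OF j]]
lemmas node_image = step_image[OF node_less node_subset[OF j] fine_step[OF j] desc[OF j]]
lemmas node_minimal = step_minimal[OF node_less node_subset[OF j] fine_step[OF j] desc[OF j]]

end

text \<open>Only positions are read modulo k: the discrete action refers cyclically to the next
  position, but to momenta only for j < k.\<close>

definition X :: "(nat \<Rightarrow> 'd phase) \<Rightarrow> nat \<Rightarrow> real^'d" where "X Z j = fst (Z (j mod k))"
definition Y :: "(nat \<Rightarrow> 'd phase) \<Rightarrow> nat \<Rightarrow> real^'d" where "Y Z j = snd (Z j)"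

text \<open>The equations say that the discrete action is stationary in the variables \<open>Y\<close>, and also that the
  solution starting at \<open>(X\<^sub>j, Y\<^sub>j)\<close> at the \<open>j\<close>-th node arrives at \<open>X\<^sub>j\<^sub>+\<^sub>1\<close> at the next one.\<close>

definition Y_critical :: "(nat \<Rightarrow> 'd phase) \<Rightarrow> bool"
  where "Y_critical Z \<longleftrightarrow>
    (\<forall>j<k. X Z (Suc j) - X Z j = - (B j *v X Z (Suc j)) - C j *v Y Z j)"

text \<open>For \<open>Y\<close>-critical chains this is the Hessian of the action evaluated on the broken extremals
  through \<open>Z\<close> and \<open>W\<close>; the summands are the boundary terms of the first variation.\<close>

definition gram :: "(nat \<Rightarrow> 'd phase) \<Rightarrow> (nat \<Rightarrow> 'd phase) \<Rightarrow> real"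
  where "gram Z W = (\<Sum>j<k. (Y Z j + A j *v X Z (Suc j) + transpose (B j) *v Y Z j) \<bullet> X W (Suc j)
    - Y Z j \<bullet> X W j)"

text \<open>The state at time 0 of the extremal that passes through \<open>Z j\<close> at the j-th
  node.\<close>

definition w :: "(nat \<Rightarrow> 'd phase) \<Rightarrow> nat \<Rightarrow> 'd phase" where "w Z j = inv (\<Gamma> (node j)) (Z j)"

lemma XY: "j < k \<Longrightarrow> Z j = (X Z j, Y Z j)" by (simp add: X_def Y_def)

lemma w_start: "j < k \<Longrightarrow> \<Gamma> (node j) (w Z j) = (X Z j, Y Z j)"
proof -
  assume j: "j < k"
  then have "node j \<in> {0..1}" using node_subset[OF j] node_less[of j] by auto
  then show ?thesis unfolding w_def using XY[OF j, of Z] by (simp add: \<Gamma>_inv)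
qed

lemma w_end: "Y_critical Z \<Longrightarrow> j < k \<Longrightarrow>
  \<Gamma> (node (Suc j)) (w Z j) = (X Z (Suc j), Y Z j + A j *v X Z (Suc j) + transpose (B j) *v Y Z j)"
  unfolding w_def using XY[of j Z] node_image[of j "X Z (Suc j)" "X Z j" "Y Z j"]
  by (simp add: Y_critical_def)

definition summand :: "(nat \<Rightarrow> 'd phase) \<Rightarrow> nat \<Rightarrow> real"
  where "summand Z j = Y Z j \<bullet> (X Z (Suc j) - X Z j) +
     (1/2 * ((A j *v X Z (Suc j)) \<bullet> X Z (Suc j)) + (B j *v X Z (Suc j)) \<bullet> Y Z j + 1/2 * ((C j *v Y Z j) \<bullet> Y Z j))"

lemma discrete_action_eq: "discrete_action \<Gamma> k Z = (\<Sum>j<k. summand Z j)"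
  unfolding discrete_action_def summand_def
  by (intro sum.cong) (simp_all add: Let_def quad_form_def A_def B_def C_def X_def Y_def case_prod_beta)

lemma discrete_form_self: "discrete_form \<Gamma> k Z Z = 2 * discrete_action \<Gamma> k Z"
proof -
  have "discrete_action \<Gamma> k (Z + Z) = 4 * discrete_action \<Gamma> k Z"
    unfolding discrete_action_eq sum_distrib_left
  proof (intro sum.cong refl)
    fix j
    have d: "X (Z + Z) i = 2 *\<^sub>R X Z i" "Y (Z + Z) i = 2 *\<^sub>R Y Z i" for i
      by (simp_all add: X_def Y_def scaleR_2)
    show "summand (Z + Z) j = 4 * summand Z j"
      unfolding summand_def d matrix_vector_mult_scaleR inner_scaleR_left inner_scaleR_right scaleR_diff_right[symmetric]
      by (simp add: algebra_simps)
  qed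
  then show ?thesis by (simp add: discrete_form_def)
qed

text \<open>Replacing the position at the j-th node by means of the critical equation turns each
  pair of boundary terms into twice the corresponding summand of the discrete action.\<close>

lemma gram_self:
  assumes "Y_critical Z"
  shows "gram Z Z = 2 * discrete_action \<Gamma> k Z"
  unfolding gram_def discrete_action_eq sum_distrib_left
proof (intro sum.cong refl)
  fix j assume "j \<in> {..<k}"
  then have c: "X Z j = X Z (Suc j) + B j *v X Z (Suc j) + C j *v Y Z j"
    using assms unfolding Y_critical_def by (auto simp: algebra_simps)
  show "(Y Z j + A j *v X Z (Suc j) + transpose (B j) *v Y Z j) \<bullet> X Z (Suc j) - Y Z j \<bullet> X Z j =
     2 * summand Z j"
    unfolding summand_def c by (simp add: inner_add_left inner_add_right inner_diff_right dot_lmul_matrix inner_commute[of "Y Z j"])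
qed

text \<open>On every step the extremal through Z has the same end positions as \<xi>, so
  \<open>node_minimal\<close> applies and the inequalities are added. On the last step the agreement
  uses that \<xi> is a loop.\<close>

lemma gram_le_hess:
  assumes \<xi>: "\<xi> \<in> loops" and Z: "Y_critical Z" and XZ: "\<And>j. j < k \<Longrightarrow> X Z j = \<xi> (node j)"
  shows "gram Z Z \<le> hess \<xi> \<xi>"
proof -
  have XZ': "X Z (Suc j) = \<xi> (node (Suc j))" if "j < k" for j
  proof (cases "Suc j < k")
    case True then show ?thesis using XZ by simp
  next
    case False
    then have "Suc j = k" using that by simp
    moreover have "\<xi> 1 = \<xi> 0" using \<xi> by (auto simp: loops_def dest: spec[of _ 0])
    ultimately show ?thesis using XZ[OF k] by (simp add: X_def node_k node_0)
  qed
  let ?f = "\<lambda>t. ell t (\<xi> t) (velocity \<xi> t) (\<xi> t) (velocity \<xi> t)"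
  have int: "(?f has_integral integral {node j..node (Suc j)} ?f) {node j..node (Suc j)}" if "j < k" for j
    by (intro integrable_integral ell_loops_integrable \<xi> node_subset that)
  have "(?f has_integral (\<Sum>j<k. integral {node j..node (Suc j)} ?f)) {0..1}"
    unfolding node_def by (rule has_integral_partition[OF k]) (rule int[unfolded node_def])
  then have h: "hess \<xi> \<xi> = (\<Sum>j<k. integral {node j..node (Suc j)} ?f)"
    unfolding hess_def by (rule integral_unique)
  show ?thesis
    unfolding h gram_def
  proof (rule sum_mono)
    fix j assume "j \<in> {..<k}"
    then have j: "j < k" by simp
    have "ep (w Z j) (node (Suc j)) \<bullet> eq (w Z j) (node (Suc j)) - ep (w Z j) (node j) \<bullet> eq (w Z j) (node j)
        \<le> integral {node j..node (Suc j)} ?f"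
      by (rule node_minimal[OF j _ loop_deriv(1)[OF \<xi>] _ _ int[OF j]])
         (auto simp: w_start[OF j] w_end[OF Z j] XZ[OF j] XZ'[OF j] j)
    then show "(Y Z j + A j *v X Z (Suc j) + transpose (B j) *v Y Z j) \<bullet> X Z (Suc j) - Y Z j \<bullet> X Z j
      \<le> integral {node j..node (Suc j)} ?f"
      by (simp add: w_start[OF j] w_end[OF Z j])
  qed
qed

end

context fine_partition
begin

definition Cinv :: "nat \<Rightarrow> real^'d \<Rightarrow> real^'d" where "Cinv j = inv ((*v) (C j))"

lemma inj_C: "j < k \<Longrightarrow> inj ((*v) (C j))"
proof (subst linear_injective_0[OF matrix_vector_mul_linear], intro allI impI, rule ccontr)
  fix y assume "j < k" "C j *v y = 0" "y \<noteq> 0"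
  then show False using C_negative[of j y] by simp
qed

lemma C_Cinv: "j < k \<Longrightarrow> C j *v Cinv j y = y"
  unfolding Cinv_def
  using linear_injective_imp_surjective[OF matrix_vector_mul_linear inj_C[of j]]
  by (simp add: surj_f_inv_f)

lemma linear_Cinv: "j < k \<Longrightarrow> linear (Cinv j)"
proof (rule linearI)
  fix x y :: "real^'d" and c :: real assume j: "j < k"
  note i = injD[OF inj_C[OF j]]
  show "Cinv j (x + y) = Cinv j x + Cinv j y"
    by (rule i) (simp add: C_Cinv[OF j] matrix_vector_right_distrib)
  show "Cinv j (c *\<^sub>R x) = c *\<^sub>R Cinv j x"
    by (rule i) (simp add: C_Cinv[OF j] matrix_vector_mult_scaleR)
qed

text \<open>Samples \<xi> at the nodes. The momentum is the solution of the equation in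
  \<open>Y_critical\<close>, which exists because \<open>C j\<close> is negative definite and hence
  invertible.\<close>

definition lift :: "(real \<Rightarrow> real^'d) \<Rightarrow> nat \<Rightarrow> 'd phase"
  where "lift \<xi> j = (if j < k
    then (\<xi> (node j), Cinv j (\<xi> (node j) - \<xi> (node (Suc j)) - B j *v \<xi> (node (Suc j)))) else 0)"

lemma linear_lift: "linear lift"
proof (rule linearI)
  show "lift (\<xi> + \<eta>) = lift \<xi> + lift \<eta>" for \<xi> \<eta>
  proof
    fix j
    show "lift (\<xi> + \<eta>) j = (lift \<xi> + lift \<eta>) j"
      using linear_add[OF linear_Cinv[of j], symmetric]
      by (cases "j < k") (simp_all add: lift_def matrix_vector_right_distrib algebra_simps)
  qed
  show "lift (c *\<^sub>R \<xi>) = c *\<^sub>R lift \<xi>" for c \<xi>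
  proof
    fix j
    show "lift (c *\<^sub>R \<xi>) j = (c *\<^sub>R lift \<xi>) j"
      using linear_cmul[OF linear_Cinv[of j], symmetric]
      by (cases "j < k") (simp_all add: lift_def scaleR_fun_def matrix_vector_mult_scaleR scaleR_diff_right)
  qed
qed

lemma loop_wrap: "\<xi> \<in> loops \<Longrightarrow> j \<le> k \<Longrightarrow> \<xi> (node (j mod k)) = \<xi> (node j)"
proof (cases "j = k")
  case True
  assume "\<xi> \<in> loops"
  then have "\<xi> 1 = \<xi> 0" by (auto simp: loops_def dest: spec[of _ 0])
  then show ?thesis using True by (simp add: node_k node_0)
qed simp

lemma X_lift: "\<xi> \<in> loops \<Longrightarrow> j \<le> k \<Longrightarrow> X (lift \<xi>) j = \<xi> (node j)"
  using loop_wrap[of \<xi> j] k by (simp add: X_def lift_def)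

lemma Y_critical_lift: "\<xi> \<in> loops \<Longrightarrow> Y_critical (lift \<xi>)"
  unfolding Y_critical_def by (simp add: X_lift) (simp add: Y_def lift_def C_Cinv)

text \<open>Criticality in Y removes the term linear in \<open>Y W\<close>, and what remains is the
  quadratic part of the action in Y. This splits off the Y directions orthogonally.\<close>

lemma discrete_action_add_Y:
  assumes Z: "Y_critical Z" and W: "\<And>j. X W j = 0"
  shows "discrete_action \<Gamma> k (Z + W) =
    discrete_action \<Gamma> k Z + (\<Sum>j<k. 1/2 * ((C j *v Y W j) \<bullet> Y W j))"
  unfolding discrete_action_eq sum.distrib[symmetric]
proof (intro sum.cong refl)
  fix j assume "j \<in> {..<k}"
  then have j: "j < k" by simp
  have XX: "X (Z + W) i = X Z i" for i using W[of i] by (simp add: X_def)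
  have YY: "Y (Z + W) i = Y Z i + Y W i" for i by (simp add: Y_def)
  have c: "X Z (Suc j) - X Z j = - (B j *v X Z (Suc j)) - C j *v Y Z j"
    using Z j by (simp add: Y_critical_def)
  have s: "(C j *v Y Z j) \<bullet> Y W j = (C j *v Y W j) \<bullet> Y Z j"
    using transpose_C[OF j] by (metis dot_lmul_matrix inner_commute transpose_matrix_vector)
  show "summand (Z + W) j = summand Z j + 1/2 * ((C j *v Y W j) \<bullet> Y W j)"
    unfolding summand_def XX YY c using s
    by (simp add: matrix_vector_right_distrib inner_add_left inner_add_right inner_diff_right
        inner_diff_left inner_commute[of "Y W j"] inner_commute[of "Y Z j"])
       (simp add: field_simps)
qed

lemma hess_zero: "hess 0 0 = 0"
  unfolding hess_def by (simp add: ell_def zero_fun_def linear_0[OF lin(1)] linear_0[OF lin(2)] linear_0[OF lin(3)])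

text \<open>The lifts are joined with the dk coordinate vectors of the Y variables. On a lift plus a
  Y vector the form is the Gram form, which is at most the Hessian of the loop, plus the negative
  definite contribution of the \<open>C j\<close>. If the loop coefficients all vanish, the latter
  alone is negative.\<close>

lemma chains_family_of_loops_family:
  assumes neg: "negative_family loops hess I e"
  shows "\<exists>(I' :: ('i + nat \<times> 'd) set) e'. negative_family (chains k) (discrete_form \<Gamma> k) I' e' \<and>
    card I' = card (I :: 'i set) + CARD('d) * k"
proof -
  define J where "J = {..<k} \<times> (UNIV :: 'd set)"
  have fin: "finite I" "finite J" using neg by (auto simp: negative_family_def J_def)
  define unit :: "nat \<times> 'd \<Rightarrow> nat \<Rightarrow> 'd phase"
    where "unit p m = (if m = fst p then (0, axis (snd p) 1) else 0)" for p m
  define e' where "e' = case_sum (\<lambda>i. lift (e i)) unit"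
  have "negative_family (chains k) (discrete_form \<Gamma> k) (I <+> J) e'"
    unfolding negative_family_def
  proof (intro conjI allI impI)
    show "finite (I <+> J)" using fin by simp
    fix a :: "'i + nat \<times> 'd \<Rightarrow> real"
    define \<xi> where "\<xi> = (\<Sum>i\<in>I. a (Inl i) *\<^sub>R e i)"
    define W :: "nat \<Rightarrow> 'd phase" where "W m = (if m < k then (0, \<chi> i. a (Inr (m, i))) else 0)" for m
    have "(\<Sum>p\<in>J. a (Inr p) *\<^sub>R unit p) m = W m" for m
    proof -
      have "(\<Sum>p\<in>J. a (Inr p) *\<^sub>R unit p) m = (\<Sum>l<k. \<Sum>i\<in>UNIV. a (Inr (l, i)) *\<^sub>R unit (l, i) m)"
        unfolding J_def sum.cartesian_product by (simp add: sum_fun_apply scaleR_fun_def case_prod_beta)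
      also have "\<dots> = (\<Sum>l<k. if l = m then (\<Sum>i\<in>UNIV. a (Inr (m, i)) *\<^sub>R (0, axis i 1)) else 0)"
        by (intro sum.cong refl) (auto simp: unit_def)
      also have "\<dots> = (if m < k then (\<Sum>i\<in>UNIV. a (Inr (m, i)) *\<^sub>R (0, axis i 1)) else 0)" by simp
      also have "(\<Sum>i\<in>UNIV. a (Inr (m, i)) *\<^sub>R (0 :: real^'d, axis i 1 :: real^'d)) = (0, \<chi> i. a (Inr (m, i)))"
        by (simp add: prod_eq_iff fst_sum snd_sum vec_eq_iff axis_def if_distrib cong: if_cong)
      finally show ?thesis by (simp add: W_def)
    qed
    then have unitW: "(\<Sum>p\<in>J. a (Inr p) *\<^sub>R unit p) = W" by blast
    have sum: "(\<Sum>i\<in>I <+> J. a i *\<^sub>R e' i) = lift \<xi> + W"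
      using fin unitW
      by (simp add: sum.Plus o_def e'_def \<xi>_def linear_sum[OF linear_lift] linear_cmul[OF linear_lift])
    have XW: "X W j = 0" for j by (simp add: X_def W_def)
    have "\<xi> \<in> loops" using neg by (simp add: \<xi>_def negative_family_def)
    show "(\<Sum>i\<in>I <+> J. a i *\<^sub>R e' i) \<in> chains k"
      unfolding sum by (simp add: chains_def lift_def W_def)
    assume ex: "\<exists>i\<in>I <+> J. a i \<noteq> 0"
    have "discrete_form \<Gamma> k (lift \<xi> + W) (lift \<xi> + W) =
        gram (lift \<xi>) (lift \<xi>) + (\<Sum>j<k. (C j *v Y W j) \<bullet> Y W j)"
      unfolding discrete_form_self discrete_action_add_Y[OF Y_critical_lift[OF \<open>\<xi> \<in> loops\<close>] XW]
        gram_self[OF Y_critical_lift[OF \<open>\<xi> \<in> loops\<close>]]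
      by (simp add: sum_divide_distrib[symmetric])
    also have "\<dots> \<le> hess \<xi> \<xi> + (\<Sum>j<k. (C j *v Y W j) \<bullet> Y W j)"
      using gram_le_hess[OF \<open>\<xi> \<in> loops\<close> Y_critical_lift[OF \<open>\<xi> \<in> loops\<close>]] X_lift[OF \<open>\<xi> \<in> loops\<close>] by simp
    also have "\<dots> < 0"
    proof -
      have C0: "(C j *v Y W j) \<bullet> Y W j \<le> 0" if "j < k" for j
        using C_negative[of j "Y W j"] that by (cases "Y W j = 0") auto
      show ?thesis
      proof (cases "\<exists>i\<in>I. a (Inl i) \<noteq> 0")
        case True
        then have "hess \<xi> \<xi> < 0"
          using neg[unfolded negative_family_def, THEN conjunct2, THEN spec, of "\<lambda>i. a (Inl i)"]
          by (simp add: \<xi>_def)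
        moreover have "(\<Sum>j<k. (C j *v Y W j) \<bullet> Y W j) \<le> 0" using C0 by (intro sum_nonpos) auto
        ultimately show ?thesis by simp
      next
        case False
        then have "\<xi> = 0" by (simp add: \<xi>_def)
        from False ex obtain j i where ji: "j < k" "a (Inr (j, i)) \<noteq> 0" by (auto simp: J_def)
        then have "Y W j \<noteq> 0" by (auto simp: Y_def W_def vec_eq_iff)
        then have "(C j *v Y W j) \<bullet> Y W j < 0" using C_negative ji(1) by simp
        then have "(\<Sum>j<k. (C j *v Y W j) \<bullet> Y W j) < (\<Sum>j<k. 0)"
          using C0 ji(1) by (intro sum_strict_mono_ex1) auto
        then show ?thesis using \<open>\<xi> = 0\<close> hess_zero by simp
      qed
    qed
    finally show "discrete_form \<Gamma> k (\<Sum>i\<in>I <+> J. a i *\<^sub>R e' i) (\<Sum>i\<in>I <+> J. a i *\<^sub>R e' i) < 0"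
      unfolding sum .
  qed
  moreover have "card (I <+> J) = card I + CARD('d) * k"
    using fin by (simp add: card_Plus J_def card_cartesian_product)
  ultimately show ?thesis by blast
qed

end

section \<open>Smooth loops approximating curves with corners\<close>

lemma partition_cover:
  fixes k :: nat and t :: real
  assumes "0 < k" "t \<in> {0..1}"
  shows "\<exists>j<k. t \<in> {real j / real k..real (Suc j) / real k}"
proof (cases "t = 1")
  case True
  then show ?thesis using assms by (intro exI[of _ "k - 1"]) (auto simp: field_simps)
next
  case False
  define j where "j = nat \<lfloor>real k * t\<rfloor>"
  have "0 \<le> real k * t" "real k * t < real k" using assms False by auto
  then have "real j \<le> real k * t" "real k * t < real j + 1" "j < k"
    unfolding j_def by linarith+
  then show ?thesis using assms by (intro exI[of _ j]) (auto simp: field_simps)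
qed

text \<open>Bounded pointwise convergence of positions and velocities, the hypothesis of dominated
  convergence; uniform convergence of velocities is impossible across corners.\<close>

definition loops_approximate ::
  "(nat \<Rightarrow> real \<Rightarrow> real^'d) \<Rightarrow> real \<Rightarrow> (real \<Rightarrow> real^'d) \<Rightarrow> (real \<Rightarrow> real^'d) \<Rightarrow> bool"
  where "loops_approximate \<xi> K q v \<longleftrightarrow> (\<forall>n. \<xi> n \<in> loops) \<and>
    (\<forall>n. \<forall>t\<in>{0..1}. norm (\<xi> n t) \<le> K \<and> norm (velocity (\<xi> n) t) \<le> K) \<and>
    (\<forall>t\<in>{0..1}. (\<lambda>n. velocity (\<xi> n) t) \<longlonglongrightarrow> v t \<and> (\<lambda>n. \<xi> n t) \<longlonglongrightarrow> q t)"

text \<open>A bounded derivative with jumps at the nodes is cut off near the nodes by \<open>|sin (\<pi> k t)|\<close>,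
  which makes it continuous, and is then approximated by trigonometric polynomials of mean zero.\<close>

lemma piecewise_approximation:
  fixes v :: "real \<Rightarrow> real^'d" and vj :: "nat \<Rightarrow> real \<Rightarrow> real^'d"
  assumes k: "0 < k"
    and vj: "\<And>j. j < k \<Longrightarrow> continuous_on {real j / real k..real (Suc j) / real k} (vj j)"
    and v: "\<And>j t. j < k \<Longrightarrow> t \<in> {real j / real k<..<real (Suc j) / real k} \<Longrightarrow> v t = vj j t"
    and v0: "\<And>j. v (real j / real k) = 0"
    and int: "(v has_integral 0) {0..1}"
  shows "\<exists>\<xi> K. loops_approximate \<xi> K (\<lambda>t. q0 + integral {0..t} v) v"
proof -
  define \<theta> where "\<theta> n t = min 1 (real n * \<bar>sin (pi * (real k * t))\<bar>)" for n :: nat and t :: real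
  have \<theta>01: "0 \<le> \<theta> n t" "\<theta> n t \<le> 1" for n t by (auto simp: \<theta>_def)
  have \<theta>node: "\<theta> n (real j / real k) = 0" for n j
    using k by (simp add: \<theta>_def)
  define u where "u n t = \<theta> n t *\<^sub>R v t" for n t
  have pieces: "{0..1} = (\<Union>j\<in>{..<k}. {real j / real k..real (Suc j) / real k})"
  proof
    show "{0..1} \<subseteq> (\<Union>j\<in>{..<k}. {real j / real k..real (Suc j) / real k})"
      using partition_cover[OF k] by fastforce
    show "(\<Union>j\<in>{..<k}. {real j / real k..real (Suc j) / real k}) \<subseteq> {0..1}"
    proof
      fix t assume "t \<in> (\<Union>j\<in>{..<k}. {real j / real k..real (Suc j) / real k})"
      then obtain j where j: "j < k" "real j / real k \<le> t" "t \<le> real (Suc j) / real k" by auto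
      moreover have "0 \<le> real j / real k" "real (Suc j) / real k \<le> 1" using j(1) by (auto simp: field_simps)
      ultimately show "t \<in> {0..1}" unfolding atLeastAtMost_iff by (meson order_trans)
    qed
  qed
  have contu: "continuous_on {0..1} (u n)" for n
    unfolding pieces
  proof (rule continuous_on_closed_Union)
    fix j assume j: "j \<in> {..<k}"
    have "continuous_on {real j / real k..real (Suc j) / real k} (\<lambda>t. \<theta> n t *\<^sub>R vj j t)"
      unfolding \<theta>_def using vj j by (intro continuous_intros) auto
    moreover have "\<theta> n t *\<^sub>R vj j t = u n t" if "t \<in> {real j / real k..real (Suc j) / real k}" for t
    proof (cases "t \<in> {real j / real k<..<real (Suc j) / real k}")
      case True then show ?thesis using v j by (simp add: u_def)
    next
      case False
      then have "t = real j / real k \<or> t = real (Suc j) / real k" using that by auto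
      then show ?thesis using \<theta>node[of n j] \<theta>node[of n "Suc j"] by (auto simp: u_def simp del: of_nat_Suc)
    qed
    ultimately show "continuous_on {real j / real k..real (Suc j) / real k} (u n)"
      by (rule continuous_on_eq)
  qed auto
  obtain Kj where Kj: "\<And>j t. j < k \<Longrightarrow> t \<in> {real j / real k..real (Suc j) / real k} \<Longrightarrow> norm (vj j t) \<le> Kj j"
  proof -
    have "\<exists>K. \<forall>t. j < k \<longrightarrow> t \<in> {real j / real k..real (Suc j) / real k} \<longrightarrow> norm (vj j t) \<le> K" for j
    proof (cases "j < k")
      case True
      obtain K where "\<And>t. t \<in> {real j / real k..real (Suc j) / real k} \<Longrightarrow> norm (vj j t) \<le> K"
        using continuous_on_compact_norm_bound[OF vj[OF True] compact_Icc] by blast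
      then show ?thesis by blast
    qed simp
    then show ?thesis using that by metis
  qed
  define K where "K = (\<Sum>j<k. \<bar>Kj j\<bar>)"
  have K0: "0 \<le> K" unfolding K_def by (intro sum_nonneg) auto
  have vK: "norm (v t) \<le> K" if t: "t \<in> {0..1}" for t
  proof -
    obtain j where j: "j < k" "t \<in> {real j / real k..real (Suc j) / real k}" using partition_cover[OF k t] by blast
    have "\<bar>Kj j\<bar> \<le> K" unfolding K_def using j(1) by (intro member_le_sum) auto
    moreover have "v t = vj j t \<or> v t = 0"
      using v[OF j(1), of t] v0[of j] v0[of "Suc j"] j(2) by fastforce
    ultimately show ?thesis using Kj[OF j] K0 by auto
  qed
  \<comment> \<open>Away from the nodes the cutoff is eventually 1. At a node it is always 0, and so
    is v by \<open>v0\<close>, so the convergence holds at every point.\<close>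
  have lim_u: "(\<lambda>n. u n t) \<longlonglongrightarrow> v t" if t: "t \<in> {0..1}" for t
  proof (cases "sin (pi * (real k * t)) = 0")
    case True
    then obtain i :: int where "pi * (real k * t) = of_int i * pi" unfolding sin_zero_iff_int2 by blast
    then have i: "real k * t = of_int i" by simp
    have "0 \<le> real k * t" using t by simp
    then have "0 \<le> i" unfolding i by simp
    then have "t = real (nat i) / real k" using i k by (simp add: field_simps)
    then have "v t = 0" using v0 by blast
    then show ?thesis by (simp add: u_def)
  next
    case False
    define r where "r = \<bar>sin (pi * (real k * t))\<bar>"
    have r: "0 < r" using False by (simp add: r_def)
    obtain N :: nat where N: "1 < real N * r" using reals_Archimedean3[OF r] by blast
    have "u n t = v t" if "N \<le> n" for n
    proof -
      have "real N * r \<le> real n * r" using that r by (intro mult_right_mono) auto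
      then have "\<theta> n t = 1" using N by (simp add: \<theta>_def r_def)
      then show ?thesis by (simp add: u_def)
    qed
    then show ?thesis by (intro tendsto_eventually) (auto simp: eventually_sequentially)
  qed
  have "u n 0 = u n 1" for n using v0[of 0] v0[of k] k by (simp add: u_def)
  then have "\<forall>n. \<exists>w\<in>loops. \<forall>t\<in>{0..1}. norm (w t - u n t) < inverse (real (Suc n))"
    using trigonometric_approximation[OF contu] by simp
  then obtain w where w: "\<And>n. w n \<in> loops"
    and wu: "\<And>n t. t \<in> {0..1} \<Longrightarrow> norm (w n t - u n t) < inverse (real (Suc n))"
    by metis
  have contw: "continuous_on S (w n)" for S n using w[of n] smooth_velocity(3) by (auto simp: loops_def)
  have lim_w: "(\<lambda>n. w n t) \<longlonglongrightarrow> v t" if t: "t \<in> {0..1}" for t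
  proof -
    have "(\<lambda>n. w n t - u n t) \<longlonglongrightarrow> 0"
      by (rule Lim_null_comparison[OF always_eventually LIMSEQ_inverse_real_of_nat])
         (use less_imp_le[OF wu[OF t]] in blast)
    from tendsto_add[OF this lim_u[OF t]] show ?thesis by simp
  qed
  have wK: "norm (w n t) \<le> K + 1" if t: "t \<in> {0..1}" for n t
  proof -
    have "inverse (real (Suc n)) \<le> 1" by (simp add: field_simps)
    moreover have "norm (u n t) \<le> K"
      using vK[OF t] \<theta>01[of n t] mult_left_le_one_le[of "norm (v t)" "\<theta> n t"] by (simp add: u_def)
    ultimately show ?thesis using wu[OF t, of n] norm_triangle_sub[of "w n t" "u n t"] by linarith
  qed
  \<comment> \<open>Removing the mean makes the antiderivative periodic. The means converge to the
    integral of v, which is 0, so the correction disappears in the limit.\<close>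
  define m where "m n = integral {0..1} (w n)" for n
  have intw: "w n integrable_on {a..b}" for n a b by (intro integrable_continuous_real contw)
  have lim_m: "m \<longlonglongrightarrow> 0"
  proof -
    have "m \<longlonglongrightarrow> integral {0..1} v"
      unfolding m_def[abs_def]
      by (rule dominated_convergence(2)[of _ _ "\<lambda>_. K + 1"]) (use intw wK lim_w in auto)
    then show ?thesis using integral_unique[OF int] by simp
  qed
  have mK: "norm (m n) \<le> K + 1" for n
  proof -
    have "norm (integral {0..1} (w n)) \<le> integral {0..1::real} (\<lambda>_. K + 1)"
      using Henstock_Kurzweil_Integration.integral_norm_bound_integral[OF intw[of n 0 1] integrable_const_ivl wK]
      by simp
    then show ?thesis by (simp add: m_def)
  qed
  define wb where "wb n t = w n t - m n" for n t
  have contwb: "continuous_on S (wb n)" for S n unfolding wb_def by (intro continuous_intros contw)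
  have intwb: "wb n integrable_on {a..b}" for n a b by (intro integrable_continuous_real contwb)
  have wbK: "norm (wb n t) \<le> 2 * (K + 1)" if "t \<in> {0..1}" for n t
  proof -
    have "norm (wb n t) \<le> (K + 1) + (K + 1)"
      unfolding wb_def by (rule order_trans[OF norm_triangle_ineq4 add_mono[OF wK[OF that] mK]])
    then show ?thesis by simp
  qed
  have lim_wb: "(\<lambda>n. wb n t) \<longlonglongrightarrow> v t" if "t \<in> {0..1}" for t
    using tendsto_diff[OF lim_w[OF that] lim_m] by (simp add: wb_def)
  have "\<exists>J. J 0 = 0 \<and> (\<forall>t. (J has_vector_derivative wb n t) (at t))" for n
    using antiderivative_real[OF contwb] by blast
  then obtain J where "\<And>n. J n 0 = 0 \<and> (\<forall>t. (J n has_vector_derivative wb n t) (at t))"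
    using choice[of "\<lambda>n J. J 0 = 0 \<and> (\<forall>t. (J has_vector_derivative wb n t) (at t))"] by blast
  then have J0: "\<And>n. J n 0 = 0" and J: "\<And>n t. (J n has_vector_derivative wb n t) (at t)" by auto
  have Jint: "J n t = integral {0..t} (wb n)" if "0 \<le> t" for n t
    using integral_unique[OF fundamental_theorem_of_calculus[OF that has_vector_derivative_at_within[OF J[of n]]]]
    by (simp add: J0)
  define \<xi> where "\<xi> n t = q0 + J n t" for n t
  have d\<xi>: "(\<xi> n has_vector_derivative wb n t) (at t)" for n t
    using has_vector_derivative_add[OF has_vector_derivative_const[of q0] J[of n t]] by (simp add: \<xi>_def[abs_def])
  have smooth_wb: "smooth (wb n)" for n
    using smooth_add[of "w n" "\<lambda>t. - m n"] w[of n]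
    by (simp add: wb_def[abs_def] loops_def smooth_def Ck_const)
  have "\<xi> n \<in> loops" for n
  proof -
    have per: "w n (t + 1) = w n t" for t using w[of n] by (simp add: loops_def)
    have "((\<lambda>t. J n (t + 1)) has_vector_derivative wb n (t + 1)) (at t)" for t
    proof -
      have "((\<lambda>t. t + 1) has_vector_derivative 1) (at t)" by (auto intro!: derivative_eq_intros)
      from vector_diff_chain_at[OF this J[of n "t + 1"]] show ?thesis by (simp add: o_def)
    qed
    \<comment> \<open>The increment of the antiderivative over one period is constant, and its value
      at 0 is the mean of \<open>wb n\<close>, hence 0.\<close>
    then have "((\<lambda>t. J n (t + 1) - J n t) has_vector_derivative 0) (at t within UNIV)" for t
      using has_vector_derivative_diff[OF _ J[of n t]] per by (fastforce simp: wb_def)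
    then obtain c where c: "\<And>t. J n (t + 1) - J n t = c"
      using has_vector_derivative_zero_constant[of UNIV "\<lambda>t. J n (t + 1) - J n t"] by auto
    have "J n 1 = 0"
      unfolding Jint[OF zero_le_one] wb_def
      by (subst Henstock_Kurzweil_Integration.integral_diff[OF intw integrable_const_ivl])
         (simp add: m_def)
    then have "c = 0" using c[of 0] J0[of n] by simp
    then have "J n (t + 1) = J n t" for t using c[of t] by simp
    moreover have "smooth (\<xi> n)" by (rule smooth_antiderivative[OF d\<xi> smooth_wb])
    ultimately show ?thesis by (simp add: loops_def \<xi>_def)
  qed
  moreover have vel: "velocity (\<xi> n) t = wb n t" for n t by (rule vector_derivative_at[OF d\<xi>])
  moreover have "norm (\<xi> n t) \<le> norm q0 + 2 * (K + 1) \<and> norm (velocity (\<xi> n) t) \<le> norm q0 + 2 * (K + 1)"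
    if t: "t \<in> {0..1}" for n t
  proof -
    have "norm (integral {0..t} (wb n)) \<le> integral {0..t} (\<lambda>_. 2 * (K + 1))"
      using Henstock_Kurzweil_Integration.integral_norm_bound_integral[OF intwb[of n 0 t] integrable_const_ivl wbK] t
      by simp
    also have "\<dots> = t * (2 * (K + 1))" using t by simp
    also have "\<dots> \<le> 2 * (K + 1)" using t K0 by (intro mult_left_le_one_le) auto
    finally have "norm (J n t) \<le> 2 * (K + 1)" using t by (simp add: Jint)
    then have "norm (\<xi> n t) \<le> norm q0 + 2 * (K + 1)"
      unfolding \<xi>_def by (intro norm_triangle_le) simp
    moreover have "norm (wb n t) \<le> norm q0 + 2 * (K + 1)" using wbK[OF t, of n] norm_ge_zero[of q0] by linarith
    ultimately show ?thesis by (simp add: vel)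
  qed
  moreover have "(\<lambda>n. \<xi> n t) \<longlonglongrightarrow> q0 + integral {0..t} v" if t: "t \<in> {0..1}" for t
  proof -
    have "(\<lambda>n. integral {0..t} (wb n)) \<longlonglongrightarrow> integral {0..t} v"
      by (rule dominated_convergence(2)[of _ _ "\<lambda>_. 2 * (K + 1)"]) (use intwb wbK lim_wb t in auto)
    then have "(\<lambda>n. J n t) \<longlonglongrightarrow> integral {0..t} v" using t by (simp add: Jint)
    then show ?thesis unfolding \<xi>_def by (intro tendsto_add tendsto_const)
  qed
  ultimately show ?thesis using lim_wb unfolding loops_approximate_def
    by (intro exI[of _ \<xi>] exI[of _ "norm q0 + 2 * (K + 1)"]) auto
qed

lemma linear_family_bound:
  fixes A :: "'t::topological_space \<Rightarrow> 'a::euclidean_space \<Rightarrow> 'b::real_normed_vector"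
  assumes S: "compact S" and lin: "\<And>t. linear (A t)" and cont: "\<And>u. continuous_on S (\<lambda>t. A t u)"
  obtains K where "0 \<le> K" "\<And>t u. t \<in> S \<Longrightarrow> norm (A t u) \<le> K * norm u"
proof -
  have "\<exists>K. \<forall>t\<in>S. norm (A t b) \<le> K" for b
    using continuous_on_compact_norm_bound[OF cont S] by metis
  then obtain K where K: "\<And>b t. t \<in> S \<Longrightarrow> norm (A t b) \<le> K b" by metis
  show ?thesis
  proof (rule that[of "\<Sum>b\<in>Basis. \<bar>K b\<bar>"])
    show "0 \<le> (\<Sum>b\<in>Basis. \<bar>K b\<bar>)" by (intro sum_nonneg) auto
    fix t u assume t: "t \<in> S"
    have "(\<Sum>b\<in>Basis. norm (A t b)) \<le> (\<Sum>b\<in>Basis. \<bar>K b\<bar>)"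
      using K[OF t] by (intro sum_mono) (meson abs_ge_self order_trans)
    from order_trans[OF linear_family_norm_le[OF lin] mult_right_mono[OF this norm_ge_zero]]
    show "norm (A t u) \<le> (\<Sum>b\<in>Basis. \<bar>K b\<bar>) * norm u" .
  qed
qed

context linear_lagrangian
begin

lemma ell_bound:
  obtains K where "0 \<le> K"
    "\<And>t x v y w. t \<in> {0..1} \<Longrightarrow> \<bar>ell t x v y w\<bar> \<le> K * ((norm x + norm v) * (norm y + norm w))"
proof -
  obtain a where a: "0 \<le> a" "\<And>t u. t \<in> {0..1} \<Longrightarrow> norm (\<alpha> t u) \<le> a * norm u"
    using linear_family_bound[OF compact_Icc lin(1) cont(1)] by blast
  obtain b where b: "0 \<le> b" "\<And>t u. t \<in> {0..1} \<Longrightarrow> norm (\<beta> t u) \<le> b * norm u"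
    using linear_family_bound[OF compact_Icc lin(2) cont(2)] by blast
  obtain d where d: "0 \<le> d" "\<And>t u. t \<in> {0..1} \<Longrightarrow> norm (\<delta> t u) \<le> d * norm u"
    using linear_family_bound[OF compact_Icc lin(3) cont(3)] by blast
  show ?thesis
  proof (rule that[of "a + b + b + d"])
    show "0 \<le> a + b + b + d" using a b d by simp
    fix t :: real and x v y w :: "real^'d" assume t: "t \<in> {0..1}"
    have cs: "\<bar>p \<bullet> q\<bar> \<le> K * (norm r * norm q)" if "norm p \<le> K * norm r" for p q r :: "real^'d" and K
      using order_trans[OF Cauchy_Schwarz_ineq2 mult_right_mono[OF that norm_ge_zero[of q]]] by (simp add: mult.assoc)
    have m: "K * (norm r * norm q) \<le> K * ((norm x + norm v) * (norm y + norm w))"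
      if "0 \<le> K" "r = x \<or> r = v" "q = y \<or> q = w" for K and r q :: "real^'d"
      using that by (intro mult_left_mono mult_mono) auto
    have "\<bar>\<alpha> t v \<bullet> w\<bar> \<le> a * ((norm x + norm v) * (norm y + norm w))"
      by (rule order_trans[OF cs[OF a(2)[OF t]] m[OF a(1)]]) auto
    moreover have "\<bar>\<beta> t x \<bullet> w\<bar> \<le> b * ((norm x + norm v) * (norm y + norm w))"
      by (rule order_trans[OF cs[OF b(2)[OF t]] m[OF b(1)]]) auto
    moreover have "\<bar>v \<bullet> \<beta> t y\<bar> \<le> b * ((norm x + norm v) * (norm y + norm w))"
    proof -
      have "\<bar>v \<bullet> \<beta> t y\<bar> \<le> b * (norm y * norm v)" using cs[OF b(2)[OF t], of y v] by (simp add: inner_commute)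
      then have "\<bar>v \<bullet> \<beta> t y\<bar> \<le> b * (norm v * norm y)" by (simp add: mult.commute)
      from order_trans[OF this m[OF b(1)]] show ?thesis by auto
    qed
    moreover have "\<bar>\<delta> t x \<bullet> y\<bar> \<le> d * ((norm x + norm v) * (norm y + norm w))"
      by (rule order_trans[OF cs[OF d(2)[OF t]] m[OF d(1)]]) auto
    ultimately show "\<bar>ell t x v y w\<bar> \<le> (a + b + b + d) * ((norm x + norm v) * (norm y + norm w))"
      unfolding ell_def by (simp only: distrib_right)
  qed
qed

lemma tendsto_ell:
  assumes "(x \<longlongrightarrow> x0) F" "(v \<longlongrightarrow> v0) F" "(y \<longlongrightarrow> y0) F" "(w \<longlongrightarrow> w0) F"
  shows "((\<lambda>n. ell t (x n) (v n) (y n) (w n)) \<longlongrightarrow> ell t x0 v0 y0 w0) F"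
  unfolding ell_def
  by (intro tendsto_add tendsto_inner assms
      bounded_linear.tendsto[OF lin(1)[THEN linear_conv_bounded_linear[THEN iffD1]]]
      bounded_linear.tendsto[OF lin(2)[THEN linear_conv_bounded_linear[THEN iffD1]]]
      bounded_linear.tendsto[OF lin(3)[THEN linear_conv_bounded_linear[THEN iffD1]]])

lemma loops_combination:
  assumes "\<And>i. i \<in> I \<Longrightarrow> e i \<in> loops"
  shows "(\<Sum>i\<in>I. a i *\<^sub>R e i) \<in> loops"
proof -
  have eq: "(\<Sum>i\<in>I. a i *\<^sub>R e i) = (\<lambda>t. \<Sum>i\<in>I. a i *\<^sub>R e i t)"
    by (rule ext) (simp add: sum_fun_apply scaleR_fun_def)
  have "Ck n (\<lambda>t. \<Sum>i\<in>I. a i *\<^sub>R e i t)" for n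
    using assms by (intro Ck_sum Ck_linear_comp[OF bounded_linear_scaleR_right]) (auto simp: loops_def smooth_def)
  then show ?thesis unfolding eq using assms by (simp add: loops_def smooth_def)
qed

lemma hess_combination:
  assumes e: "\<And>i. i \<in> I \<Longrightarrow> e i \<in> loops"
  shows "hess (\<Sum>i\<in>I. a i *\<^sub>R e i) (\<Sum>i\<in>I. a i *\<^sub>R e i) = (\<Sum>i\<in>I. \<Sum>l\<in>I. a i * a l * hess (e i) (e l))"
proof -
  have eq: "(\<Sum>i\<in>I. a i *\<^sub>R e i) = (\<lambda>t. \<Sum>i\<in>I. a i *\<^sub>R e i t)"
    by (rule ext) (simp add: sum_fun_apply scaleR_fun_def)
  have vel: "velocity (\<lambda>t. \<Sum>i\<in>I. a i *\<^sub>R e i t) t = (\<Sum>i\<in>I. a i *\<^sub>R velocity (e i) t)" for t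
    using loop_deriv(1)[OF e, of _ _ UNIV]
    by (intro vector_derivative_at has_vector_derivative_sum
        bounded_linear.has_vector_derivative[OF bounded_linear_scaleR_right]) auto
  have "((\<lambda>t. \<Sum>i\<in>I. \<Sum>l\<in>I. (a i * a l) * ell t (e i t) (velocity (e i) t) (e l t) (velocity (e l) t)) has_integral
     (\<Sum>i\<in>I. \<Sum>l\<in>I. (a i * a l) * hess (e i) (e l))) {0..1}"
  proof (cases "finite I")
    case True
    show ?thesis
      unfolding hess_def
      by (intro has_integral_sum True has_integral_mult_right integrable_integral ell_loops_integrable e) auto
  qed simp
  moreover have "(\<Sum>i\<in>I. \<Sum>l\<in>I. (a i * a l) * ell t (e i t) (velocity (e i) t) (e l t) (velocity (e l) t)) =
    ell t (\<Sum>i\<in>I. a i *\<^sub>R e i t) (\<Sum>i\<in>I. a i *\<^sub>R velocity (e i) t) (\<Sum>i\<in>I. a i *\<^sub>R e i t) (\<Sum>i\<in>I. a i *\<^sub>R velocity (e i) t)" for t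
    unfolding ell_sum_left by (intro sum.cong refl) (simp add: ell_sum_right ell_scale_left ell_scale_right sum_distrib_left mult.assoc mult.left_commute)
  ultimately show ?thesis unfolding hess_def eq vel by (simp add: integral_unique)
qed

section \<open>Existence of generating functions for short steps\<close>

text \<open>Uniform continuity makes \<open>\<Gamma> t2 \<circ> inv (\<Gamma> t1)\<close> so close
  to the identity that its position block is injective. The old position and the new momentum are
  then linear functions of the new position and the old momentum, and symplecticity gives their
  blocks the symmetries of a generating function.\<close>

lemma ex_fine_enough: "\<exists>k. fine_enough \<Gamma> k"
proof -
  obtain K where K: "0 \<le> K" "\<And>t z. t \<in> {0..1} \<Longrightarrow> norm (\<Gamma> t z) \<le> K * norm z"
  proof -
    define G where "G t = (if t \<in> {0..1} then \<Gamma> t else (\<lambda>_. 0))" for t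
    have l: "linear (G t)" for t by (cases "t \<in> {0..1}") (auto simp: G_def lin\<Gamma> linear_zero)
    have c: "continuous_on {0..1} (\<lambda>t. G t z)" for z
      by (rule continuous_on_eq[OF continuous_\<Gamma>[OF order_refl]]) (simp add: G_def)
    obtain K where "0 \<le> K" "\<And>t z. t \<in> {0..1} \<Longrightarrow> norm (G t z) \<le> K * norm z"
      using linear_family_bound[OF compact_Icc l c] by blast
    then show ?thesis using that[of K] by (auto simp: G_def)
  qed
  \<comment> \<open>The squared norm of z is its symplectic pairing with the rotated vector z'. As
    \<open>\<Gamma> t\<close> preserves the pairing, the bound K for \<open>\<Gamma> t\<close>
    bounds its inverse as well.\<close>
  have inv_bound: "norm z \<le> K * norm (\<Gamma> t z)" if t: "t \<in> {0..1}" for t z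
  proof (cases "z = 0")
    case False
    define z' where "z' = (snd z, - fst z)"
    have nz': "norm z' = norm z" by (cases z) (simp add: z'_def norm_Pair add.commute)
    have "norm z * norm z = snd z \<bullet> fst z' - snd z' \<bullet> fst z"
      by (cases z) (simp add: z'_def power2_eq_square[symmetric] norm_Pair power2_norm_eq_inner)
    also have "\<dots> = (ep z t, - eq z t) \<bullet> (eq z' t, ep z' t)"
      using symplectic[OF t, of z z'] by (simp add: inner_prod_def inner_commute)
    also have "\<dots> \<le> norm (ep z t, - eq z t) * norm (eq z' t, ep z' t)" by (rule norm_cauchy_schwarz)
    also have "norm (ep z t, - eq z t) = norm (\<Gamma> t z)" by (cases "\<Gamma> t z") (simp add: norm_Pair add.commute)
    also have "norm (eq z' t, ep z' t) = norm (\<Gamma> t z')" by simp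
    also have "norm (\<Gamma> t z) * norm (\<Gamma> t z') \<le> norm (\<Gamma> t z) * (K * norm z)"
      using K(2)[OF t, of z'] nz' by (intro mult_left_mono) auto
    finally have "norm z * norm z \<le> (K * norm (\<Gamma> t z)) * norm z" by (simp add: ac_simps)
    then show ?thesis using False by simp
  qed (use K(1) in simp)
  \<comment> \<open>Summed over the basis this gives 1/(2(K+1)); the inverse bound contributes a
    factor K, and K/(2(K+1)) < 1.\<close>
  define e where "e = 1 / (2 * (K + 1) * DIM('d phase))"
  have e: "0 < e" using K(1) by (simp add: e_def)
  have "\<exists>d>0. \<forall>t\<in>{0..1}. \<forall>t'\<in>{0..1}. dist t' t < d \<longrightarrow> dist (\<Gamma> t' b) (\<Gamma> t b) < e" for b
    using compact_uniformly_continuous[OF continuous_\<Gamma>[of "{0..1}" b] compact_Icc] e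
    unfolding uniformly_continuous_on_def by auto
  then obtain d where d: "\<And>b. 0 < d b" and du: "\<And>b t t'. t \<in> {0..1} \<Longrightarrow> t' \<in> {0..1} \<Longrightarrow> dist t' t < d b \<Longrightarrow>
      dist (\<Gamma> t' b) (\<Gamma> t b) < e" by metis
  define m where "m = Min (d ` (Basis :: 'd phase set))"
  have "0 < m" unfolding m_def using d by simp
  then obtain k :: nat where k: "k \<noteq> 0" "1 / real k < m"
    by (metis real_arch_invD inverse_eq_divide)
  have inj: "X = 0" if t: "t1 \<in> {0..1}" "t2 \<in> {0..1}" "\<bar>t1 - t2\<bar> \<le> 1 / real k"
    and X: "fst (\<Gamma> t2 (inv (\<Gamma> t1) (X, 0))) = 0" for t1 t2 X
  proof (rule ccontr)
    assume "X \<noteq> 0"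
    define z where "z = inv (\<Gamma> t1) (X, 0)"
    have z1: "\<Gamma> t1 z = (X, 0)" unfolding z_def by (rule \<Gamma>_inv[OF t(1)])
    have "linear (\<lambda>z. \<Gamma> t2 z - \<Gamma> t1 z)" by (intro linear_compose_sub lin\<Gamma> t)
    from linear_family_norm_le[OF this, of z]
    have "norm (\<Gamma> t2 z - \<Gamma> t1 z) \<le> (\<Sum>b\<in>Basis. norm (\<Gamma> t2 b - \<Gamma> t1 b)) * norm z" .
    also have "\<dots> \<le> (\<Sum>b\<in>(Basis :: 'd phase set). e) * norm z"
    proof (intro mult_right_mono sum_mono norm_ge_zero)
      fix b :: "'d phase" assume "b \<in> Basis"
      then have "m \<le> d b" unfolding m_def by simp
      then have "dist t2 t1 < d b" using t(3) k(2) by (simp add: dist_real_def abs_minus_commute)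
      from du[OF t(1,2) this] show "norm (\<Gamma> t2 b - \<Gamma> t1 b) \<le> e" by (simp add: dist_norm)
    qed
    also have "\<dots> = 1 / (2 * (K + 1)) * norm z" by (simp add: e_def)
    also have "\<dots> \<le> 1 / (2 * (K + 1)) * (K * norm X)"
      using inv_bound[OF t(1), of z] K(1) by (intro mult_left_mono) (auto simp: z1 norm_Pair)
    also have "\<dots> < norm X"
    proof -
      have "0 < norm X" using \<open>X \<noteq> 0\<close> by simp
      moreover have "K / (2 * (K + 1)) < 1" using K(1) by (simp add: field_simps)
      ultimately have "K / (2 * (K + 1)) * norm X < 1 * norm X" by (intro mult_strict_right_mono)
      then show ?thesis by simp
    qed
    finally have lt: "norm (\<Gamma> t2 z - \<Gamma> t1 z) < norm X" .
    have "norm (fst (\<Gamma> t2 z - \<Gamma> t1 z)) \<le> norm (\<Gamma> t2 z - \<Gamma> t1 z)"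
      by (metis norm_fst_le prod.collapse)
    then have "norm (fst (\<Gamma> t2 z - \<Gamma> t1 z)) < norm X" using lt by (rule order.strict_trans1)
    then show False using X by (simp add: z_def[symmetric] z1)
  qed
  have "\<exists>D. described_by (\<Gamma> t2 \<circ> inv (\<Gamma> t1)) D"
    if t: "t1 \<in> {0..1}" "t2 \<in> {0..1}" "\<bar>t1 - t2\<bar> \<le> 1 / real k" for t1 t2
  proof -
    define P where "P = \<Gamma> t2 \<circ> inv (\<Gamma> t1)"
    have linP: "linear P" unfolding P_def by (rule linear_compose[OF linear_inv_\<Gamma>[OF t(1)] lin\<Gamma>[OF t(2)]])
    have sympl: "snd (P z) \<bullet> fst (P z') - snd (P z') \<bullet> fst (P z) = snd z \<bullet> fst z' - snd z' \<bullet> fst z" for z z'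
      using symplectic[OF t(1), of "inv (\<Gamma> t1) z" "inv (\<Gamma> t1) z'"] symplectic[OF t(2), of "inv (\<Gamma> t1) z" "inv (\<Gamma> t1) z'"]
      by (simp add: P_def \<Gamma>_inv[OF t(1)])
    define M where "M x = fst (P (x, 0))" for x
    have linM: "linear M"
      unfolding M_def
      by (rule linear_compose[OF linear_compose[OF _ linP] linear_fst, unfolded o_def]) (auto intro!: linearI)
    have "inj M" using inj[OF t] by (auto simp: linear_injective_0[OF linM] M_def P_def)
    then have bijM: "bij M" using linear_injective_imp_surjective[OF linM] by (simp add: bij_def)
    define Mi where "Mi = inv M"
    have MMi: "M (Mi x) = x" for x unfolding Mi_def using bijM by (simp add: bij_is_surj surj_f_inv_f)
    have MiM: "Mi (M x) = x" for x unfolding Mi_def using bijM by (simp add: bij_is_inj)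
    have linMi: "linear Mi"
      by (rule linearI; rule injD[OF \<open>inj M\<close>]) (simp_all add: MMi linear_add[OF linM] linear_cmul[OF linM])
    have split: "fst (P (x, y)) = M x + fst (P (0, y))" for x y
      using linear_add[OF linP, of "(x, 0)" "(0, y)"] by (simp add: M_def)
    \<comment> \<open>The old position as a function of the new position x and the old momentum y;
      \<open>T\<close> below is the new momentum in the same variables.\<close>
    define S where "S x y = Mi (x - fst (P (0, y)))" for x y
    have S: "fst (P (S x y, y)) = x" for x y
      using split[of "S x y" y] by (simp add: S_def MMi)
    have Suniq: "S x' y = x" if "fst (P (x, y)) = x'" for x x' y
    proof -
      have "x' - fst (P (0, y)) = M x" using split[of x y] that by (simp add: algebra_simps)
      then show ?thesis by (simp add: S_def MiM)
    qed
    have Sadd: "S (x + x') (y + y') = S x y + S x' y'" for x x' y y'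
      by (rule Suniq) (simp add: S linear_add[OF linP, of "(S x y, y)" "(S x' y', y')", simplified])
    have Sscale: "S (c *\<^sub>R x) (c *\<^sub>R y) = c *\<^sub>R S x y" for c x y
      by (rule Suniq) (simp add: S linear_cmul[OF linP, of c "(S x y, y)", simplified])
    define T where "T x y = snd (P (S x y, y))" for x y
    have Tadd: "T (x + x') (y + y') = T x y + T x' y'" for x x' y y'
      unfolding T_def Sadd by (simp add: linear_add[OF linP, of "(S x y, y)" "(S x' y', y')", simplified])
    have Tscale: "T (c *\<^sub>R x) (c *\<^sub>R y) = c *\<^sub>R T x y" for c x y
      unfolding T_def Sscale by (simp add: linear_cmul[OF linP, of c "(S x y, y)", simplified])
    have lin1: "linear (\<lambda>x. S x 0)" "linear (\<lambda>y. S 0 y)" "linear (\<lambda>x. T x 0)" "linear (\<lambda>y. T 0 y)"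
      using Sadd[of _ _ 0 0] Sadd[of 0 0] Tadd[of _ _ 0 0] Tadd[of 0 0] Sscale[of _ _ 0] Sscale[of _ 0] Tscale[of _ _ 0] Tscale[of _ 0]
      by (auto intro!: linearI)
    define A where "A = matrix (\<lambda>x. T x 0)"
    define B where "B = matrix (\<lambda>x. S x 0 - x)"
    define C where "C = matrix (\<lambda>y. S 0 y)"
    define E where "E = matrix (\<lambda>y. T 0 y - y)"
    have l2: "linear (\<lambda>x. S x 0 - x)" "linear (\<lambda>y. T 0 y - y)" 
      by (rule linear_compose_sub[OF lin1(1) linear_ident], rule linear_compose_sub[OF lin1(4) linear_ident])
    have A: "A *v x = T x 0" for x unfolding A_def by (simp add: matrix_works lin1)
    have B: "B *v x = S x 0 - x" for x unfolding B_def by (simp add: matrix_works l2)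
    have C: "C *v y = S 0 y" for y unfolding C_def by (simp add: matrix_works lin1)
    have E: "E *v y = T 0 y - y" for y unfolding E_def by (simp add: matrix_works l2)
    have PS: "P (S x y, y) = (x, T x y)" for x y by (simp add: prod_eq_iff S T_def)
    have Sx: "S x y = x + B *v x + C *v y" for x y using Sadd[of x 0 0 y] by (simp add: B C)
    have Ty: "T x y = y + A *v x + E *v y" for x y using Tadd[of x 0 0 y] by (simp add: A E)
    \<comment> \<open>Preservation of the symplectic form in the mixed variables. Setting two of the
      four arguments to 0 yields in turn the symmetry of A, that of C, and that E is the transpose
      of B.\<close>
    have sy: "T x y \<bullet> x' - T x' y' \<bullet> x = y \<bullet> S x' y' - y' \<bullet> S x y" for x x' y y'
      using sympl[of "(S x y, y)" "(S x' y', y')"] by (simp add: PS)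
    have Asym: "(A *v x) \<bullet> x' = x \<bullet> (A *v x')" for x x'
      using sy[of x 0 x' 0] by (simp add: Ty inner_commute)
    have Csym: "(C *v y) \<bullet> y' = y \<bullet> (C *v y')" for y y'
      using sy[of 0 y 0 y'] by (simp add: Sx inner_commute)
    have EB: "(E *v y) \<bullet> x = y \<bullet> (B *v x)" for x y
      using sy[of 0 y x 0] by (simp add: Sx Ty inner_add_left inner_add_right)
    have tr: "transpose N *v x = N' *v x" if "\<And>u v. (N' *v u) \<bullet> v = u \<bullet> (N *v v)" for N N' :: "real^'d^'d" and x
      by (rule vector_eq_rdot[THEN iffD1]) (simp add: that dot_lmul_matrix)
    have "transpose A = A" "transpose C = C" "transpose B = E"
      using tr[of A A] tr[of C C] tr[of E B] Asym Csym EB by (auto simp: matrix_eq)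
    moreover have "P (x, y) = (x', y') \<longleftrightarrow> x' - x = - (B *v x') - C *v y \<and> y' - y = A *v x' + E *v y" for x y x' y'
    proof
      assume P: "P (x, y) = (x', y')"
      then have "S x' y = x" by (intro Suniq) simp
      moreover then have "T x' y = y'" using P by (simp add: T_def)
      ultimately show "x' - x = - (B *v x') - C *v y \<and> y' - y = A *v x' + E *v y"
        using Sx[of x' y] Ty[of x' y] by (auto simp: algebra_simps)
    next
      assume *: "x' - x = - (B *v x') - C *v y \<and> y' - y = A *v x' + E *v y"
      then have "x = S x' y" "y' = T x' y" unfolding Sx Ty by (auto simp: algebra_simps)
      then show "P (x, y) = (x', y')" using PS by simp
    qed
    ultimately have "described_by P (A, B, C)"
      by (simp add: described_by_def del: transpose_matrix_vector)
    then show ?thesis unfolding P_def by blast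
  qed
  then have "fine_enough \<Gamma> k" unfolding fine_enough_def using k(1) by auto
  then show ?thesis by blast
qed

end

section \<open>Broken extremals and the comparison of the indices\<close>

context fine_partition
begin

text \<open>The step containing t. At t = 1 the floor is k, and the minimum assigns this point to
  the last step.\<close>

definition idx :: "real \<Rightarrow> nat" where "idx t = min (k - 1) (nat \<lfloor>real k * t\<rfloor>)"

lemma idx_interior: "j < k \<Longrightarrow> t \<in> {node j..<node (Suc j)} \<Longrightarrow> idx t = j"
proof -
  assume j: "j < k" and t: "t \<in> {node j..<node (Suc j)}"
  then have "real j \<le> real k * t" "real k * t < real j + 1"
    using k by (auto simp: node_def field_simps)
  then have "\<lfloor>real k * t\<rfloor> = int j" by linarith
  then show ?thesis using j by (simp add: idx_def)
qed

lemma idx_1: "idx 1 = k - 1" by (simp add: idx_def)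

lemma node_interior: "t \<in> {node j<..<node (Suc j)} \<Longrightarrow> t \<noteq> node i"
proof
  assume t: "t \<in> {node j<..<node (Suc j)}" "t = node i"
  then have "real j < real i" "real i < real (Suc j)"
    using k by (auto simp: node_def divide_less_cancel simp del: of_nat_Suc)
  then show False by simp
qed

lemma node_cover: "t \<in> {0..1} \<Longrightarrow> \<exists>j<k. t \<in> {node j..node (Suc j)}"
  using partition_cover[OF k] by (simp add: node_def)

definition bq :: "(nat \<Rightarrow> 'd phase) \<Rightarrow> real \<Rightarrow> real^'d" where "bq Z t = eq (w Z (idx t)) t"

text \<open>At the nodes, where the broken extremal has corners, its velocity is set to \<open>0\<close>.\<close>

definition bv :: "(nat \<Rightarrow> 'd phase) \<Rightarrow> real \<Rightarrow> real^'d"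
  where "bv Z t = (if \<exists>j. t = node j then 0 else ev (w Z (idx t)) t)"

text \<open>At an interior right end \<open>idx\<close> already selects the next extremal. For a
  \<open>Y_critical\<close> chain its initial position is the final position of the previous one,
  which makes the broken extremal continuous.\<close>

lemma bq_piece:
  assumes Z: "Y_critical Z" and j: "j < k" and t: "t \<in> {node j..node (Suc j)}"
  shows "bq Z t = eq (w Z j) t"
proof (cases "t = node (Suc j)")
  case False
  then show ?thesis using idx_interior[OF j, of t] t by (simp add: bq_def)
next
  case True
  show ?thesis
  proof (cases "Suc j < k")
    case True
    have "idx t = Suc j" using idx_interior[OF True, of t] node_less[of "Suc j"] \<open>t = node (Suc j)\<close> by simp
    then show ?thesis
      using \<open>t = node (Suc j)\<close> w_end[OF Z j] w_start[OF True, of Z] by (simp add: bq_def)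
  next
    case False
    then have "Suc j = k" using j by simp
    then have "t = 1" "j = k - 1" using \<open>t = node (Suc j)\<close> node_k by auto
    then show ?thesis by (simp add: bq_def idx_1)
  qed
qed

lemma bv_piece: "j < k \<Longrightarrow> t \<in> {node j<..<node (Suc j)} \<Longrightarrow> bv Z t = ev (w Z j) t"
  using node_interior[of t j] idx_interior[of j t] by (auto simp: bv_def)

lemma broken_has_integral:
  assumes Z: "Y_critical Z" and W: "Y_critical W"
  shows "((\<lambda>t. ell t (bq Z t) (bv Z t) (bq W t) (bv W t)) has_integral gram Z W) {0..1}"
  unfolding gram_def
proof (rule has_integral_partition[OF k, folded node_def])
  fix j assume j: "j < k"
  have "((\<lambda>t. ell t (eq (w Z j) t) (ev (w Z j) t) (eq (w W j) t) (ev (w W j) t)) has_integral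
      ep (w Z j) (node (Suc j)) \<bullet> eq (w W j) (node (Suc j)) - ep (w Z j) (node j) \<bullet> eq (w W j) (node j))
      {node j..node (Suc j)}"
    by (rule first_variation[OF less_imp_le[OF node_less] node_subset[OF j] eq_deriv[OF _ node_subset[OF j]]])
  then have "((\<lambda>t. ell t (eq (w Z j) t) (ev (w Z j) t) (eq (w W j) t) (ev (w W j) t)) has_integral
      (Y Z j + A j *v X Z (Suc j) + transpose (B j) *v Y Z j) \<bullet> X W (Suc j) - Y Z j \<bullet> X W j)
      {node j..node (Suc j)}"
    by (simp add: w_start[OF j] w_end[OF Z j] w_end[OF W j])
  then show "((\<lambda>t. ell t (bq Z t) (bv Z t) (bq W t) (bv W t)) has_integral
      (Y Z j + A j *v X Z (Suc j) + transpose (B j) *v Y Z j) \<bullet> X W (Suc j) - Y Z j \<bullet> X W j)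
      {node j..node (Suc j)}"
  proof (rule has_integral_spike_finite[rotated 2])
    show "finite {node j, node (Suc j)}" by simp
    fix t assume t: "t \<in> {node j..node (Suc j)} - {node j, node (Suc j)}"
    then show "ell t (bq Z t) (bv Z t) (bq W t) (bv W t) =
        ell t (eq (w Z j) t) (ev (w Z j) t) (eq (w W j) t) (ev (w W j) t)"
      by (simp add: bq_piece[OF Z j] bq_piece[OF W j] bv_piece[OF j])
  qed
qed

text \<open>The fundamental theorem of calculus with finitely many exceptional points: the broken
  extremal is continuous, and it is differentiable with derivative \<open>bv\<close> off the
  nodes.\<close>

lemma broken_deriv:
  assumes Z: "Y_critical Z" and t: "t \<in> {0..1}"
  shows "(bv Z has_integral (bq Z t - bq Z 0)) {0..t}"
proof (rule fundamental_theorem_of_calculus_interior_strong)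
  show "finite (node ` {..k})" by simp
  show "0 \<le> t" using t by simp
  have pieces: "{0..1} = (\<Union>j\<in>{..<k}. {node j..node (Suc j)})"
    using node_cover node_subset by fastforce
  have "continuous_on {0..1} (bq Z)"
    unfolding pieces
  proof (rule continuous_on_closed_Union)
    fix j assume "j \<in> {..<k}"
    then have j: "j < k" by simp
    show "continuous_on {node j..node (Suc j)} (bq Z)"
      by (rule continuous_on_eq[OF continuous_eq_ep(1)[OF node_subset[OF j], of "w Z j"]])
         (simp add: bq_piece[OF Z j])
  qed auto
  then show "continuous_on {0..t} (bq Z)" by (rule continuous_on_subset) (use t in auto)
  fix s assume s: "s \<in> {0<..<t} - node ` {..k}"
  then obtain j where j: "j < k" "s \<in> {node j..node (Suc j)}" using node_cover[of s] t by auto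
  moreover have "s \<noteq> node j" "s \<noteq> node (Suc j)" using s j(1) by auto
  ultimately have si: "s \<in> {node j<..<node (Suc j)}" by auto
  have "(eq (w Z j) has_vector_derivative ev (w Z j) s) (at s within {node j..node (Suc j)})"
    by (rule eq_deriv[OF j(2) node_subset[OF j(1)]])
  moreover have "s \<in> interior {node j..node (Suc j)}"
    using si unfolding interior_atLeastAtMost_real .
  ultimately have "(eq (w Z j) has_vector_derivative ev (w Z j) s) (at s)"
    by (simp only: at_within_interior)
  then show "(bq Z has_vector_derivative bv Z s) (at s)"
    unfolding bv_piece[OF j(1) si]
    by (rule has_vector_derivative_transform_within_open[OF _ open_greaterThanLessThan si])
       (simp add: bq_piece[OF Z j(1)])
qed

lemma broken_approximation:
  assumes Z: "Y_critical Z"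
  shows "\<exists>\<xi> K. loops_approximate \<xi> K (bq Z) (bv Z)"
proof -
  \<comment> \<open>The curve closes up because positions are read modulo k.\<close>
  have "bq Z 1 = bq Z 0"
  proof -
    have "k - 1 < k" "Suc (k - 1) = k" using k by auto
    then have "bq Z 1 = X Z 0"
      using bq_piece[OF Z, of "k - 1" 1] w_end[OF Z, of "k - 1"] node_k node_less[of "k - 1"]
      by (simp add: X_def)
    also have "\<dots> = bq Z 0"
      using bq_piece[OF Z k, of 0] w_start[OF k, of Z] node_0 node_less[of 0] by simp
    finally show ?thesis .
  qed
  then have int: "(bv Z has_integral 0) {0..1}" using broken_deriv[OF Z, of 1] by simp
  have bq: "bq Z 0 + integral {0..t} (bv Z) = bq Z t" if "t \<in> {0..1}" for t
    using integral_unique[OF broken_deriv[OF Z that]] by simp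
  have "\<exists>\<xi> K. loops_approximate \<xi> K (\<lambda>t. bq Z 0 + integral {0..t} (bv Z)) (bv Z)"
    by (rule piecewise_approximation[OF k, folded node_def, of "\<lambda>j. ev (w Z j)"])
       (auto intro!: continuous_ev node_subset bv_piece int simp: bv_def[of Z "node _"])
  then show ?thesis using bq by (simp add: loops_approximate_def)
qed

lemma X_Y_linear:
  "X (Z + Z') j = X Z j + X Z' j" "Y (Z + Z') j = Y Z j + Y Z' j"
  "X (c *\<^sub>R Z) j = c *\<^sub>R X Z j" "Y (c *\<^sub>R Z) j = c *\<^sub>R Y Z j"
  by (simp_all add: X_def Y_def scaleR_fun_def)

lemma gram_combination:
  "gram (\<Sum>i\<in>I. a i *\<^sub>R e i) (\<Sum>i\<in>I. a i *\<^sub>R e i) = (\<Sum>i\<in>I. \<Sum>l\<in>I. a i * a l * gram (e i) (e l))"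
proof -
  have l1: "linear (\<lambda>Z. gram Z W)" for W
    by (rule linearI)
       (simp_all add: gram_def X_Y_linear matrix_vector_right_distrib matrix_vector_mult_scaleR inner_add_left
         sum.distrib[symmetric] sum_distrib_left algebra_simps del: transpose_matrix_vector)
  have l2: "linear (\<lambda>W. gram Z W)" for Z
    by (rule linearI)
       (simp_all add: gram_def X_Y_linear inner_add_right
         sum.distrib[symmetric] sum_distrib_left algebra_simps del: transpose_matrix_vector)
  show ?thesis
  proof -
    have 1: "gram (\<Sum>i\<in>I. a i *\<^sub>R e i) W = (\<Sum>i\<in>I. a i * gram (e i) W)" for W
      by (simp add: linear_sum[OF l1] linear_cmul[OF l1])
    have 2: "gram Z (\<Sum>i\<in>I. a i *\<^sub>R e i) = (\<Sum>i\<in>I. a i * gram Z (e i))" for Z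
      by (simp add: linear_sum[OF l2] linear_cmul[OF l2])
    show ?thesis by (subst 1) (simp only: 2 sum_distrib_left mult.assoc)
  qed
qed

text \<open>Being \<open>Y_critical\<close> amounts to dk linear equations, so at most dk members
  are lost in passing to critical chains, where the form is the Gram form of broken extremals. Each
  remaining member is smoothed separately, and a single n then serves the whole family because
  negativity of the limiting Gram matrix is an open condition.\<close>

lemma loops_family_of_chains_family:
  assumes neg: "negative_family (chains k) (discrete_form \<Gamma> k) I (e :: 'i \<Rightarrow> nat \<Rightarrow> 'd phase)"
  shows "\<exists>(I' :: 'i set) e'. negative_family loops hess I' e' \<and> card I \<le> card I' + CARD('d) * k"
proof -
  define J where "J = {..<k} \<times> (UNIV :: 'd set)"
  \<comment> \<open>The coordinates of the defect in the equation defining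
    \<open>Y_critical\<close>.\<close>
  define \<phi> where "\<phi> p Z = (X Z (Suc (fst p)) - X Z (fst p) + B (fst p) *v X Z (Suc (fst p)) + C (fst p) *v Y Z (fst p)) $ snd p"
    for p :: "nat \<times> 'd" and Z
  have lin\<phi>: "linear (\<phi> p)" for p
    by (rule linearI) (simp_all add: \<phi>_def X_Y_linear matrix_vector_right_distrib matrix_vector_mult_scaleR algebra_simps)
  have fin: "finite J" "finite I" using neg by (auto simp: J_def negative_family_def)
  obtain I' :: "'i set" and e' :: "'i \<Rightarrow> nat \<Rightarrow> 'd phase" where I': "finite I'" "card I \<le> card I' + card J"
    and kill: "\<And>p i. p \<in> J \<Longrightarrow> i \<in> I' \<Longrightarrow> \<phi> p (e' i) = 0"
    and comb: "\<And>a. \<exists>i\<in>I'. a i \<noteq> 0 \<Longrightarrow>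
      \<exists>a'. (\<exists>i\<in>I. a' i \<noteq> 0) \<and> (\<Sum>i\<in>I'. a i *\<^sub>R e' i) = (\<Sum>i\<in>I. a' i *\<^sub>R e i)"
    using eliminate_functionals[OF fin, of \<phi> e] lin\<phi> by blast
  have crit: "Y_critical Z" if "\<And>p. p \<in> J \<Longrightarrow> \<phi> p Z = 0" for Z
    unfolding Y_critical_def
  proof (intro allI impI)
    fix j assume "j < k"
    then have "X Z (Suc j) - X Z j + B j *v X Z (Suc j) + C j *v Y Z j = 0"
      using that[of "(j, _)"] by (simp add: J_def \<phi>_def vec_eq_iff)
    then show "X Z (Suc j) - X Z j = - (B j *v X Z (Suc j)) - C j *v Y Z j"
      by (simp add: algebra_simps add_eq_0_iff)
  qed
  have crit_e: "Y_critical (e' i)" if "i \<in> I'" for i using crit kill that by blast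
  have crit_sum: "Y_critical (\<Sum>i\<in>I'. a i *\<^sub>R e' i)" for a
    by (rule crit) (simp add: linear_sum[OF lin\<phi>] linear_cmul[OF lin\<phi>] kill)
  have gram_neg: "(\<Sum>i\<in>I'. \<Sum>l\<in>I'. a i * a l * gram (e' i) (e' l)) < 0" if a: "\<exists>i\<in>I'. a i \<noteq> 0" for a
  proof -
    obtain a' where a': "\<exists>i\<in>I. a' i \<noteq> 0" "(\<Sum>i\<in>I'. a i *\<^sub>R e' i) = (\<Sum>i\<in>I. a' i *\<^sub>R e i)"
      using comb[OF a] by blast
    have "discrete_form \<Gamma> k (\<Sum>i\<in>I'. a i *\<^sub>R e' i) (\<Sum>i\<in>I'. a i *\<^sub>R e' i) < 0"
      unfolding a'(2) using neg[unfolded negative_family_def, THEN conjunct2, THEN spec, of a'] a'(1) by simp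
    then show ?thesis
      unfolding discrete_form_self gram_self[OF crit_sum, symmetric] gram_combination .
  qed
  have "\<forall>i. \<exists>\<xi> K. i \<in> I' \<longrightarrow> loops_approximate \<xi> K (bq (e' i)) (bv (e' i))"
    using broken_approximation[OF crit_e] by blast
  then obtain \<xi> K where "\<forall>i. i \<in> I' \<longrightarrow> loops_approximate (\<xi> i) (K i) (bq (e' i)) (bv (e' i))"
    by metis
  then have loops: "\<And>i n. i \<in> I' \<Longrightarrow> \<xi> i n \<in> loops"
    and bd: "\<And>i n t. i \<in> I' \<Longrightarrow> t \<in> {0..1} \<Longrightarrow> norm (\<xi> i n t) \<le> K i \<and> norm (velocity (\<xi> i n) t) \<le> K i"
    and lim: "\<And>i t. i \<in> I' \<Longrightarrow> t \<in> {0..1} \<Longrightarrow> (\<lambda>n. velocity (\<xi> i n) t) \<longlonglongrightarrow> bv (e' i) t"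
      "\<And>i t. i \<in> I' \<Longrightarrow> t \<in> {0..1} \<Longrightarrow> (\<lambda>n. \<xi> i n t) \<longlonglongrightarrow> bq (e' i) t"
    unfolding loops_approximate_def by blast+
  obtain M where M: "0 \<le> M"
    "\<And>t x v y w. t \<in> {0..1} \<Longrightarrow> \<bar>ell t x v y w\<bar> \<le> M * ((norm x + norm v) * (norm y + norm w))"
    using ell_bound by blast
  \<comment> \<open>Dominated convergence with a constant majorant, from the uniform bounds on the
    loops and the bound M on the coefficients.\<close>
  have "(\<lambda>n. hess (\<xi> i n) (\<xi> l n)) \<longlonglongrightarrow> gram (e' i) (e' l)" if il: "i \<in> I'" "l \<in> I'" for i l
  proof -
    have "(\<lambda>n. integral {0..1} (\<lambda>t. ell t (\<xi> i n t) (velocity (\<xi> i n) t) (\<xi> l n t) (velocity (\<xi> l n) t)))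
      \<longlonglongrightarrow> integral {0..1} (\<lambda>t. ell t (bq (e' i) t) (bv (e' i) t) (bq (e' l) t) (bv (e' l) t))"
    proof (rule dominated_convergence(2)[of _ _ "\<lambda>_. M * ((K i + K i) * (K l + K l))"])
      show "(\<lambda>t. ell t (\<xi> i n t) (velocity (\<xi> i n) t) (\<xi> l n t) (velocity (\<xi> l n) t)) integrable_on {0..1}" for n
        by (intro ell_loops_integrable loops il) auto
      show "norm (ell t (\<xi> i n t) (velocity (\<xi> i n) t) (\<xi> l n t) (velocity (\<xi> l n) t))
          \<le> M * ((K i + K i) * (K l + K l))" if t: "t \<in> {0..1}" for n t
      proof -
        have "0 \<le> K i" using bd[OF il(1) t, of n] norm_ge_zero order_trans by blast
        then have "M * ((norm (\<xi> i n t) + norm (velocity (\<xi> i n) t)) * (norm (\<xi> l n t) + norm (velocity (\<xi> l n) t)))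
          \<le> M * ((K i + K i) * (K l + K l))"
          using bd[OF il(1) t, of n] bd[OF il(2) t, of n]
          by (intro mult_left_mono[OF mult_mono M(1)] add_mono) auto
        from order_trans[OF M(2)[OF t] this] show ?thesis by simp
      qed
      show "(\<lambda>n. ell t (\<xi> i n t) (velocity (\<xi> i n) t) (\<xi> l n t) (velocity (\<xi> l n) t))
          \<longlonglongrightarrow> ell t (bq (e' i) t) (bv (e' i) t) (bq (e' l) t) (bv (e' l) t)" if t: "t \<in> {0..1}" for t
        by (intro tendsto_ell lim il t)
    qed (rule integrable_const_ivl)
    then show ?thesis
      unfolding hess_def integral_unique[OF broken_has_integral[OF crit_e[OF il(1)] crit_e[OF il(2)]]] .
  qed
  from gram_negative_open[OF I'(1) gram_neg this]
  obtain n where n: "\<And>a. \<exists>i\<in>I'. a i \<noteq> 0 \<Longrightarrow> (\<Sum>i\<in>I'. \<Sum>l\<in>I'. a i * a l * hess (\<xi> i n) (\<xi> l n)) < 0"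
    by blast
  have "negative_family loops hess I' (\<lambda>i. \<xi> i n)"
    unfolding negative_family_def using I'(1) loops n
    by (simp add: loops_combination hess_combination)
  moreover have "card J = CARD('d) * k" by (simp add: J_def card_cartesian_product)
  ultimately show ?thesis using I'(2) by auto
qed

text \<open>The 2dk coordinates of a chain are functionals whose common kernel among chains is 0.
  Eliminating them from a negative family must leave nothing, as the form is not negative at
  0.\<close>

lemma chains_family_bound:
  assumes neg: "negative_family (chains k) (discrete_form \<Gamma> k) I (e :: 'i \<Rightarrow> nat \<Rightarrow> 'd phase)"
  shows "card I \<le> k * card (Basis :: 'd phase set)"
proof -
  define J where "J = {..<k} \<times> (Basis :: 'd phase set)"
  define \<phi> where "\<phi> p Z = Z (fst p) \<bullet> snd p" for p and Z :: "nat \<Rightarrow> 'd phase"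
  have lin\<phi>: "linear (\<phi> p)" for p
    by (rule linearI) (simp_all add: \<phi>_def scaleR_fun_def inner_add_left)
  have fin: "finite J" "finite I" using neg by (auto simp: J_def negative_family_def)
  obtain I' :: "'i set" and e' :: "'i \<Rightarrow> nat \<Rightarrow> 'd phase" where I': "finite I'" "card I \<le> card I' + card J"
    and kill: "\<And>p i. p \<in> J \<Longrightarrow> i \<in> I' \<Longrightarrow> \<phi> p (e' i) = 0"
    and comb: "\<And>a. \<exists>i\<in>I'. a i \<noteq> 0 \<Longrightarrow>
      \<exists>a'. (\<exists>i\<in>I. a' i \<noteq> 0) \<and> (\<Sum>i\<in>I'. a i *\<^sub>R e' i) = (\<Sum>i\<in>I. a' i *\<^sub>R e i)"
    using eliminate_functionals[OF fin, of \<phi> e] lin\<phi> by blast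
  have "I' = {}"
  proof (rule ccontr)
    assume "I' \<noteq> {}"
    then obtain a' where a': "\<exists>i\<in>I. a' i \<noteq> 0" "(\<Sum>i\<in>I'. 1 *\<^sub>R e' i) = (\<Sum>i\<in>I. a' i *\<^sub>R e i)"
      using comb[of "\<lambda>_. 1"] by auto
    define Z where "Z = (\<Sum>i\<in>I. a' i *\<^sub>R e i)"
    have Z: "Z \<in> chains k" "discrete_form \<Gamma> k Z Z < 0"
      unfolding Z_def using neg[unfolded negative_family_def, THEN conjunct2, THEN spec, of a'] a'(1) by auto
    have \<phi>Z: "\<phi> p Z = 0" if "p \<in> J" for p
      unfolding Z_def a'(2)[symmetric] using kill[OF that] by (simp add: linear_sum[OF lin\<phi>])
    have "Z j \<bullet> b = 0" if "j < k" "b \<in> Basis" for j b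
      using \<phi>Z[of "(j, b)"] that by (simp add: \<phi>_def J_def)
    then have "Z j = 0" if "j < k" for j using that euclidean_all_zero_iff by blast
    then have "Z = 0" using Z(1) by (auto simp: chains_def fun_eq_iff not_less[symmetric])
    then show False using Z(2) by (simp add: discrete_form_self discrete_action_eq summand_def X_def Y_def)
  qed
  then show ?thesis using I'(2) by (simp add: J_def card_cartesian_product)
qed

text \<open>The maximal number N of negative loops gives N + dk negative chains, while a negative
  family of chains loses at most dk members on the way back to loops.\<close>

theorem index_eq:
  "\<exists>n. form_index loops hess = enat n \<and>
    form_index (chains k) (discrete_form \<Gamma> k) = enat (n + CARD('d) * k)"
proof -
  define P where "P n \<longleftrightarrow> (\<exists>B. negative_family loops hess B (id :: _ \<Rightarrow> real \<Rightarrow> real^'d) \<and> card B = n)" for n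
  have bound: "n \<le> k * card (Basis :: 'd phase set)" if Pn: "P n" for n
  proof -
    obtain B where B: "negative_family loops hess B (id :: _ \<Rightarrow> real \<Rightarrow> real^'d)" "card B = n"
      using Pn unfolding P_def by blast
    obtain I' :: "((real \<Rightarrow> real^'d) + nat \<times> 'd) set" and e'
      where "negative_family (chains k) (discrete_form \<Gamma> k) I' e'" "card I' = card B + CARD('d) * k"
      using chains_family_of_loops_family[OF B(1)] by blast
    then show ?thesis using chains_family_bound[of I' e'] B(2) by simp
  qed
  have "P 0"
    unfolding P_def negative_family_def by (intro exI[of _ "{}"]) (simp add: loops_def smooth_def Ck_const zero_fun_def del: Ck.simps)
  \<comment> \<open>The maximum exists: the empty family is negative, and \<open>bound\<close>
    limits all sizes through the chains.\<close>
  define N where "N = Greatest P"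
  have N: "P N" "\<And>n. P n \<Longrightarrow> n \<le> N"
    unfolding N_def using GreatestI_nat[of P 0, OF \<open>P 0\<close> bound] Greatest_le_nat[of P, OF _ bound] by blast+
  obtain BN where BN: "negative_family loops hess BN (id :: _ \<Rightarrow> real \<Rightarrow> real^'d)" "card BN = N"
    using N(1) unfolding P_def by blast
  have loops_index: "form_index loops hess = enat N"
  proof (rule form_index_eqI[where b = hess, OF BN hess_zero])
    show "card B \<le> N" if "negative_family loops hess B (id :: _ \<Rightarrow> real \<Rightarrow> real^'d)" for B
      by (rule N(2)) (use that in \<open>auto simp: P_def\<close>)
  qed
  obtain I' :: "((real \<Rightarrow> real^'d) + nat \<times> 'd) set" and e'
    where I': "negative_family (chains k) (discrete_form \<Gamma> k) I' e'" "card I' = N + CARD('d) * k"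
    using chains_family_of_loops_family[OF BN(1)] BN(2) by blast
  have "form_index (chains k) (discrete_form \<Gamma> k) = enat (N + CARD('d) * k)"
  proof (rule form_index_eqI[OF I'])
    show "discrete_form \<Gamma> k 0 0 = 0" by (simp add: discrete_form_self discrete_action_eq summand_def X_def Y_def)
    show "card B \<le> N + CARD('d) * k" if B: "negative_family (chains k) (discrete_form \<Gamma> k) B (id :: _ \<Rightarrow> nat \<Rightarrow> 'd phase)" for B
    proof -
      obtain I'' :: "(nat \<Rightarrow> 'd phase) set" and e'' where *: "negative_family loops hess I'' e''" "card B \<le> card I'' + CARD('d) * k"
        using loops_family_of_chains_family[OF B] by blast
      then show ?thesis using negative_family_eq_form_index[where b = hess, OF *(1) loops_index hess_zero] *(2) by simp
    qed
  qed
  with loops_index show ?thesis by blast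
qed

end

text \<open>Of the chosen k only its fineness is known, and \<open>index_eq\<close> holds for each
  fine k with the same left-hand index.\<close>

theorem (in linear_lagrangian) index_eq_maslov:
  "\<exists>n. form_index loops hess = enat n \<and> maslov_index \<Gamma> = int n"
proof -
  define k where "k = (SOME k. fine_enough \<Gamma> k)"
  have "fine_enough \<Gamma> k" unfolding k_def using someI_ex[OF ex_fine_enough] .
  then interpret fine_partition \<alpha> \<beta> \<beta>t \<delta> V \<Gamma> k by unfold_locales
  obtain n where "form_index loops hess = enat n"
    "form_index (chains k) (discrete_form \<Gamma> k) = enat (n + CARD('d) * k)"
    using index_eq by blast
  then show ?thesis by (simp add: maslov_index_def Let_def k_def[symmetric])
qed

section \<open>Legendre duality\<close>

lemma vec_linear_inner:
  fixes g :: "real^'n \<Rightarrow> real"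
  assumes "linear g"
  shows "(\<chi> i. g (axis i 1)) \<bullet> w = g w"
proof -
  have "(\<chi> i. g (axis i 1)) \<bullet> w = g (\<Sum>i\<in>UNIV. (w $ i) *\<^sub>R axis i 1)"
    by (simp add: inner_vec_def mult.commute linear_sum[OF assms] linear_cmul[OF assms])
  then show ?thesis by (simp only: axis_expansion)
qed

lemma grad_inner:
  assumes "(g has_derivative g') (at x)"
  shows "grad g x \<bullet> w = g' w"
proof -
  have "frechet_derivative g (at x) = g'" using frechet_derivative_at[OF assms] by simp
  then show ?thesis
    unfolding grad_def using vec_linear_inner[OF has_derivative_linear[OF assms]] by simp
qed

lemma has_derivative_vecI:
  fixes f :: "'a::real_normed_vector \<Rightarrow> real^'n"
  assumes "\<And>w. ((\<lambda>x. f x \<bullet> w) has_derivative (\<lambda>h. f' h \<bullet> w)) F"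
  shows "(f has_derivative f') F"
proof -
  have 1: "((\<lambda>x. f x $ i) has_derivative (\<lambda>h. f' h $ i)) F" for i
    using assms[of "axis i 1"] by (simp add: inner_axis)
  have "((\<lambda>x. \<Sum>i\<in>UNIV. (f x $ i) *\<^sub>R (axis i 1 :: real^'n)) has_derivative
      (\<lambda>h. \<Sum>i\<in>UNIV. (f' h $ i) *\<^sub>R (axis i 1 :: real^'n))) F"
    by (intro has_derivative_sum bounded_linear.has_derivative[OF bounded_linear_scaleR_left 1])
  then show ?thesis by (simp add: axis_expansion)
qed

lemma continuous_on_vecI:
  fixes f :: "'a::topological_space \<Rightarrow> real^'n"
  assumes "\<And>w. continuous_on S (\<lambda>x. f x \<bullet> w)"
  shows "continuous_on S f"
proof -
  have "continuous_on S (\<lambda>x. \<chi> i. f x $ i)"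
    using assms[of "axis _ 1"] by (intro continuous_on_vec_lambda) (simp add: inner_axis)
  then show ?thesis by simp
qed

locale tonelli_lagrangian =
  fixes L :: "'d::finite lagrangian"
  assumes tonelli: "tonelli L"
begin

definition f :: "real \<times> 'd phase \<Rightarrow> real" where "f = (\<lambda>(t, q, v). L t q v)"
definition "f1 x u = frechet_derivative f (at x) u"
definition "f2 x u w = frechet_derivative (\<lambda>x. f1 x u) (at x) w"

lemma f_apply: "f (t, q, v) = L t q v" by (simp add: f_def)

lemma C2:
  "f differentiable (at x)"
  "(\<lambda>x. frechet_derivative f (at x) u) differentiable (at x)"
  "continuous_on UNIV (\<lambda>x. frechet_derivative (\<lambda>x. frechet_derivative f (at x) u) (at x) w)"
proof -
  have "Ck (Suc (Suc 0)) f"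
    using tonelli unfolding tonelli_def smooth_def f_def by blast
  then show "f differentiable (at x)"
    "(\<lambda>x. frechet_derivative f (at x) u) differentiable (at x)"
    "continuous_on UNIV (\<lambda>x. frechet_derivative (\<lambda>x. frechet_derivative f (at x) u) (at x) w)"
    unfolding Ck.simps by blast+
qed

lemma f_deriv: "(f has_derivative f1 x) (at x)"
  using C2(1) unfolding f1_def[abs_def] by (simp add: frechet_derivative_works)

lemma f1_deriv: "((\<lambda>x. f1 x u) has_derivative f2 x u) (at x)"
  using C2(2) unfolding f2_def[abs_def] f1_def by (simp add: frechet_derivative_works)

lemma f2_cont: "continuous_on UNIV (\<lambda>x. f2 x u w)"
  using C2(3) unfolding f2_def f1_def .

lemma f1_cont: "continuous_on UNIV (\<lambda>x. f1 x u)"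
  using has_derivative_continuous[OF f1_deriv] by (simp add: continuous_on_eq_continuous_at)

lemma f2_sym: "f2 x u w = f2 x w u"
  by (rule second_derivative_symmetric[OF f_deriv f1_deriv f2_cont])

lemma f1_linear: "linear (f1 x)" and f2_linear_right: "linear (f2 x u)"
  using has_derivative_linear[OF f_deriv] has_derivative_linear[OF f1_deriv] by blast+

lemma f2_linear_left: "linear (\<lambda>u. f2 x u w)"
  using f2_linear_right[of x w] by (subst f2_sym)

text \<open>Together with \<open>ddq\<close>, the derivative of \<open>dv\<close> and
  \<open>dq\<close> at x = (t, q, v) in an arbitrary direction h. The operators \<open>dvv\<close>,
  \<open>dqv\<close> and \<open>dqq\<close> are their restrictions to single components of
  h.\<close>

definition ddv :: "real \<times> 'd phase \<Rightarrow> real \<times> 'd phase \<Rightarrow> real^'d"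
  where "ddv x h = (\<chi> i. f2 x (0, 0, axis i 1) h)"
definition ddq :: "real \<times> 'd phase \<Rightarrow> real \<times> 'd phase \<Rightarrow> real^'d"
  where "ddq x h = (\<chi> i. f2 x (0, axis i 1, 0) h)"

lemma ddv_inner: "ddv x h \<bullet> w = f2 x (0, 0, w) h"
  unfolding ddv_def
  by (rule vec_linear_inner, rule linear_compose[OF _ f2_linear_left, unfolded o_def]) (auto intro!: linearI)

lemma ddq_inner: "ddq x h \<bullet> w = f2 x (0, w, 0) h"
  unfolding ddq_def
  by (rule vec_linear_inner, rule linear_compose[OF _ f2_linear_left, unfolded o_def]) (auto intro!: linearI)

lemma linear_ddv: "linear (ddv x)" and linear_ddq: "linear (ddq x)"
  by (rule linearI; rule vector_eq_rdot[THEN iffD1];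
      simp add: ddv_inner ddq_inner linear_add[OF f2_linear_right] linear_cmul[OF f2_linear_right] inner_add_left)+

lemma cont_ddv: "continuous_on UNIV (\<lambda>x. ddv x h)" and cont_ddq: "continuous_on UNIV (\<lambda>x. ddq x h)"
  by (rule continuous_on_vecI, simp add: ddv_inner ddq_inner f2_cont)+

lemma dv_inner: "dv L t q v \<bullet> w = f1 (t, q, v) (0, 0, w)"
proof -
  have "((\<lambda>v'. (t, q, v')) has_derivative (\<lambda>h. (0, 0, h))) (at v)" by (auto intro!: derivative_eq_intros)
  from has_derivative_compose[OF this f_deriv]
  have "((\<lambda>v'. L t q v') has_derivative (\<lambda>h. f1 (t, q, v) (0, 0, h))) (at v)" by (simp add: f_apply)
  then show ?thesis unfolding dv_def by (rule grad_inner)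
qed

lemma dq_inner: "dq L t q v \<bullet> w = f1 (t, q, v) (0, w, 0)"
proof -
  have "((\<lambda>q'. (t, q', v)) has_derivative (\<lambda>h. (0, h, 0))) (at q)" by (auto intro!: derivative_eq_intros)
  from has_derivative_compose[OF this f_deriv]
  have "((\<lambda>q'. L t q' v) has_derivative (\<lambda>h. f1 (t, q, v) (0, h, 0))) (at q)" by (simp add: f_apply)
  then show ?thesis unfolding dq_def by (rule grad_inner)
qed

lemma dv_deriv: "((\<lambda>x. dv L (fst x) (fst (snd x)) (snd (snd x))) has_derivative ddv x) (at x)"
  by (rule has_derivative_vecI) (simp add: dv_inner ddv_inner f1_deriv)

lemma dq_deriv: "((\<lambda>x. dq L (fst x) (fst (snd x)) (snd (snd x))) has_derivative ddq x) (at x)"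
  by (rule has_derivative_vecI) (simp add: dq_inner ddq_inner f1_deriv)

lemma dvv_eq: "dvv L t q v h = ddv (t, q, v) (0, 0, h)"
proof -
  have "((\<lambda>v'. (t, q, v')) has_derivative (\<lambda>h. (0, 0, h))) (at v)" by (auto intro!: derivative_eq_intros)
  from has_derivative_compose[OF this dv_deriv]
  have "((\<lambda>v'. dv L t q v') has_derivative (\<lambda>h. ddv (t, q, v) (0, 0, h))) (at v)" by simp
  from frechet_derivative_at[OF this] show ?thesis unfolding dvv_def by (simp add: fun_eq_iff)
qed

lemma dqv_eq: "dqv L t q v h = ddv (t, q, v) (0, h, 0)"
proof -
  have "((\<lambda>q'. (t, q', v)) has_derivative (\<lambda>h. (0, h, 0))) (at q)" by (auto intro!: derivative_eq_intros)
  from has_derivative_compose[OF this dv_deriv]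
  have "((\<lambda>q'. dv L t q' v) has_derivative (\<lambda>h. ddv (t, q, v) (0, h, 0))) (at q)" by simp
  from frechet_derivative_at[OF this] show ?thesis unfolding dqv_def by (simp add: fun_eq_iff)
qed

lemma dqq_eq: "dqq L t q v h = ddq (t, q, v) (0, h, 0)"
proof -
  have "((\<lambda>q'. (t, q', v)) has_derivative (\<lambda>h. (0, h, 0))) (at q)" by (auto intro!: derivative_eq_intros)
  from has_derivative_compose[OF this dq_deriv]
  have "((\<lambda>q'. dq L t q' v) has_derivative (\<lambda>h. ddq (t, q, v) (0, h, 0))) (at q)" by simp
  from frechet_derivative_at[OF this] show ?thesis unfolding dqq_def by (simp add: fun_eq_iff)
qed

lemma dvv_pos: "w \<noteq> 0 \<Longrightarrow> 0 < ddv (t, q, v) (0, 0, w) \<bullet> w"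
  using tonelli by (simp add: tonelli_def dvv_eq)

lemma linear_dvv: "linear (\<lambda>h. ddv x (0, 0, h))"
  by (rule linear_compose[OF _ linear_ddv, unfolded o_def]) (auto intro!: linearI)

lemma inj_dvv: "inj (\<lambda>h. ddv x (0, 0, h))"
proof (subst linear_injective_0[OF linear_dvv], intro allI impI, rule ccontr)
  fix w assume "ddv x (0, 0, w) = 0" "w \<noteq> 0"
  then show False using dvv_pos[of w "fst x" "fst (snd x)" "snd (snd x)"] by simp
qed

definition "ai x = inv (\<lambda>h. ddv x (0, 0, h))"

lemma ddv_ai: "ddv x (0, 0, ai x p) = p"
  unfolding ai_def
  using surj_f_inv_f[OF linear_injective_imp_surjective[OF linear_dvv inj_dvv], of x p] by simp

text \<open>On the segment from v' to v, the momentum paired with v - v' has positive derivative by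
  convexity, so it takes different values at the two ends.\<close>

lemma dv_inj: "dv L t q v = dv L t q v' \<Longrightarrow> v = v'"
proof (rule ccontr)
  assume eq: "dv L t q v = dv L t q v'" and ne: "v \<noteq> v'"
  define g where "g s = dv L t q (v' + s *\<^sub>R (v - v')) \<bullet> (v - v')" for s
  have "(g has_real_derivative ddv (t, q, v' + s *\<^sub>R (v - v')) (0, 0, v - v') \<bullet> (v - v')) (at s)" for s
  proof -
    have "((\<lambda>s. (t, q, v' + s *\<^sub>R (v - v'))) has_derivative (\<lambda>h. (0, 0, h *\<^sub>R (v - v')))) (at s)"
      by (auto intro!: derivative_eq_intros)
    from has_derivative_inner_left[OF has_derivative_compose[OF this dv_deriv], of "v - v'"]
    have "(g has_derivative (\<lambda>h. ddv (t, q, v' + s *\<^sub>R (v - v')) (0, 0, h *\<^sub>R (v - v')) \<bullet> (v - v'))) (at s)"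
      by (simp add: g_def[abs_def])
    then show ?thesis
      by (simp add: has_field_derivative_def linear_cmul[OF linear_dvv] mult_commute_abs)
  qed
  then obtain z where "g 1 - g 0 = (1 - 0) * (ddv (t, q, v' + z *\<^sub>R (v - v')) (0, 0, v - v') \<bullet> (v - v'))"
    using MVT2[of 0 1 g "\<lambda>s. ddv (t, q, v' + s *\<^sub>R (v - v')) (0, 0, v - v') \<bullet> (v - v')"] by auto
  moreover have "0 < ddv (t, q, v' + z *\<^sub>R (v - v')) (0, 0, v - v') \<bullet> (v - v')"
    using ne by (intro dvv_pos) simp
  ultimately show False using eq by (simp add: g_def)
qed

text \<open>Superlinear growth confines the minimization of \<open>L t q v - p \<bullet> v\<close>
  to a ball; the gradient vanishes at the minimum.\<close>

lemma minimizer: "\<exists>v0. dv L t q v0 = p \<and> (\<forall>v. L t q v0 - p \<bullet> v0 \<le> L t q v - p \<bullet> v)"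
proof -
  define g where "g v = L t q v - p \<bullet> v" for v
  have dg: "(g has_derivative (\<lambda>h. (dv L t q v - p) \<bullet> h)) (at v)" for v
  proof -
    have "((\<lambda>v'. (t, q, v')) has_derivative (\<lambda>h. (0, 0, h))) (at v)" by (auto intro!: derivative_eq_intros)
    from has_derivative_compose[OF this f_deriv]
    have "((\<lambda>v'. L t q v') has_derivative (\<lambda>h. f1 (t, q, v) (0, 0, h))) (at v)" by (simp add: f_apply)
    then show ?thesis unfolding g_def
      by (auto intro!: derivative_eq_intros simp: dv_inner inner_diff_left)
  qed
  then have contg: "continuous_on S g" for S
    using has_derivative_continuous continuous_at_imp_continuous_on by blast
  have "filterlim (\<lambda>v. L t q v / norm v) at_top at_infinity" using tonelli by (simp add: tonelli_def)
  then have "\<forall>\<^sub>F v in at_infinity. norm p + 1 \<le> L t q v / norm v" by (simp add: filterlim_at_top)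
  then obtain b where b: "\<And>v. b \<le> norm v \<Longrightarrow> norm p + 1 \<le> L t q v / norm v"
    by (auto simp: eventually_at_infinity)
  \<comment> \<open>Beyond R the growth estimate gives \<open>g v \<ge> norm v\<close>, and
    \<open>norm v\<close> exceeds \<open>g 0\<close>. The bound 1 permits clearing the denominator,
    and b is where the estimate starts.\<close>
  define R where "R = max (max b 1) (\<bar>g 0\<bar> + 1)"
  have out: "g 0 < g v" if "R \<le> norm v" for v
  proof -
    have "1 \<le> norm v" "b \<le> norm v" "\<bar>g 0\<bar> + 1 \<le> norm v" using that by (auto simp: R_def)
    from \<open>1 \<le> norm v\<close> have "0 < norm v" by linarith
    then have "(norm p + 1) * norm v \<le> L t q v"
      using b[OF \<open>b \<le> norm v\<close>] by (simp add: pos_le_divide_eq)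
    moreover have "p \<bullet> v \<le> norm p * norm v" by (rule norm_cauchy_schwarz)
    ultimately have "norm v \<le> g v" by (simp add: g_def algebra_simps)
    then show ?thesis using \<open>\<bar>g 0\<bar> + 1 \<le> norm v\<close> by linarith
  qed
  have "0 < R" by (simp add: R_def)
  obtain v0 where v0: "v0 \<in> cball 0 R" "\<And>v. v \<in> cball 0 R \<Longrightarrow> g v0 \<le> g v"
    using continuous_attains_inf[OF compact_cball _ contg, of 0 R] \<open>0 < R\<close> by auto
  have min: "g v0 \<le> g v" for v
  proof (cases "v \<in> cball 0 R")
    case False
    then have "g 0 < g v" by (intro out) simp
    moreover have "g v0 \<le> g 0" using \<open>0 < R\<close> by (intro v0(2)) simp
    ultimately show ?thesis by simp
  qed (rule v0(2))
  have "(\<lambda>h. (dv L t q v0 - p) \<bullet> h) = (\<lambda>h. 0)"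
    by (rule differential_zero_maxmin[OF UNIV_I open_UNIV dg]) (use min in simp)
  then have "(dv L t q v0 - p) \<bullet> (dv L t q v0 - p) = 0" by meson
  then show ?thesis using min by (intro exI[of _ v0]) (simp add: g_def)
qed

definition Vf :: "real \<Rightarrow> real^'d \<Rightarrow> real^'d \<Rightarrow> real^'d" where "Vf t q p = (THE v. dv L t q v = p)"

lemma dv_Vf: "dv L t q (Vf t q p) = p"
  unfolding Vf_def by (rule theI') (use minimizer dv_inj in metis)

lemma Vf_dv: "Vf t q (dv L t q v) = v"
  by (rule dv_inj) (rule dv_Vf)

lemma hamiltonian_eq: "dual_hamiltonian L t q p = p \<bullet> Vf t q p - L t q (Vf t q p)"
proof -
  obtain v0 where v0: "dv L t q v0 = p" "\<And>v. L t q v0 - p \<bullet> v0 \<le> L t q v - p \<bullet> v"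
    using minimizer by blast
  then have "v0 = Vf t q p" using Vf_dv[of t q v0] by simp
  with v0(2) have "p \<bullet> v - L t q v \<le> p \<bullet> Vf t q p - L t q (Vf t q p)" for v
    by (simp add: algebra_simps)
  then show ?thesis unfolding dual_hamiltonian_def by (intro cSup_eq_maximum) auto
qed

abbreviation "lag y \<equiv> (fst y, fst (snd y), Vf (fst y) (fst (snd y)) (snd (snd y)))"

text \<open>Implicit differentiation of \<open>dv L t q (Vf t q p) = p\<close>: solve for the
  velocity increment with the inverse \<open>ai\<close> of the second derivative in v.\<close>

definition "dVf y h = ai (lag y) (snd (snd h) - ddv (lag y) (fst h, fst (snd h), 0))"

text \<open>\<open>lag\<close> inverts the map (t, q, v) \<mapsto> (t, q, p) with p =
  \<open>dv L t q v\<close>. The derivative of this map is block triangular with invertible block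
  \<open>dvv\<close>, so the derivative of the inverse is the inverse of the derivative.\<close>

lemma lag_deriv: "((\<lambda>y. lag y) has_derivative (\<lambda>h. (fst h, fst (snd h), dVf y h))) (at y)"
proof (rule has_derivative_inverse_strong_x[where S = UNIV])
  let ?G = "\<lambda>x. (fst x, fst (snd x), dv L (fst x) (fst (snd x)) (snd (snd x)))"
  have dG: "(?G has_derivative (\<lambda>h. (fst h, fst (snd h), ddv x h))) (at x)" for x
    by (intro has_derivative_Pair dv_deriv) (auto intro!: derivative_eq_intros)
  then show "(?G has_derivative (\<lambda>h. (fst h, fst (snd h), ddv (lag y) h))) (at (lag y))" .
  show "continuous_on UNIV ?G"
    using has_derivative_continuous[OF dG] by (simp add: continuous_on_eq_continuous_at)
  show "lag (?G x) = x" for x by (simp add: Vf_dv)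
  show "?G (lag y) = y" by (simp add: dv_Vf)
  have "ddv (lag y) (fst h, fst (snd h), dVf y h) =
      ddv (lag y) (fst h, fst (snd h), 0) + ddv (lag y) (0, 0, dVf y h)" for h
    using linear_add[OF linear_ddv, of "lag y" "(fst h, fst (snd h), 0)" "(0, 0, dVf y h)"] by simp
  then have "ddv (lag y) (fst h, fst (snd h), dVf y h) = snd (snd h)" for h
    by (simp add: dVf_def ddv_ai)
  then show "(\<lambda>h. (fst h, fst (snd h), ddv (lag y) h)) \<circ> (\<lambda>h. (fst h, fst (snd h), dVf y h)) = id"
    by (simp add: fun_eq_iff)
qed auto

lemma cont_lag: "continuous_on UNIV (\<lambda>y. lag y)"
  using has_derivative_continuous[OF lag_deriv] by (simp add: continuous_on_eq_continuous_at)

text \<open>The Hamiltonian field written through L and the inverse Legendre transform. In this form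
  its derivative can be computed, whereas the Hamiltonian itself is given as a supremum.\<close>

definition "X t z = (Vf t (fst z) (snd z), dq L t (fst z) (Vf t (fst z) (snd z)))"

definition "DX t z u = (let v = dVf (t, z) (0, u) in (v, ddq (lag (t, z)) (0, fst u, v)))"

lemma ham_field_eq: "ham_field (dual_hamiltonian L) t z = X t z"
proof -
  obtain q p where z: "z = (q, p)" by (cases z)
  define y where "y = (t, q, p)"
  have V: "((\<lambda>y. Vf (fst y) (fst (snd y)) (snd (snd y))) has_derivative dVf y) (at y)"
    using has_derivative_snd[OF has_derivative_snd[OF lag_deriv]] by simp
  have L: "((\<lambda>y. f (lag y)) has_derivative (\<lambda>h. f1 (lag y) (fst h, fst (snd h), dVf y h))) (at y)"
    by (rule has_derivative_compose[OF lag_deriv f_deriv])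
  have "((\<lambda>y. snd (snd y)) has_derivative (\<lambda>h. snd (snd h))) (at y)" by (auto intro!: derivative_eq_intros)
  from has_derivative_diff[OF has_derivative_inner[OF this V] L]
  have "((\<lambda>y. dual_hamiltonian L (fst y) (fst (snd y)) (snd (snd y))) has_derivative
    (\<lambda>h. (snd (snd y) \<bullet> dVf y h + snd (snd h) \<bullet> Vf (fst y) (fst (snd y)) (snd (snd y)))
        - f1 (lag y) (fst h, fst (snd h), dVf y h))) (at y)"
    by (simp add: hamiltonian_eq f_apply)
  \<comment> \<open>Envelope argument: the derivative of L in v at the maximizer is p, so the terms
    containing \<open>dVf\<close> cancel in the derivative of the Hamiltonian.\<close>
  moreover have "f1 (lag y) (fst h, fst (snd h), dVf y h) =
      f1 (lag y) (fst h, fst (snd h), 0) + p \<bullet> dVf y h" for h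
    using linear_add[OF f1_linear, of "lag y" "(fst h, fst (snd h), 0)" "(0, 0, dVf y h)"]
      dv_inner[of t q "Vf t q p" "dVf y h"]
    by (simp add: dv_Vf y_def)
  ultimately have H: "((\<lambda>y. dual_hamiltonian L (fst y) (fst (snd y)) (snd (snd y))) has_derivative
    (\<lambda>h. snd (snd h) \<bullet> Vf t q p - f1 (lag y) (fst h, fst (snd h), 0))) (at y)"
    by (simp add: y_def algebra_simps)
  have "((\<lambda>p'. (t, q, p')) has_derivative (\<lambda>h. (0, 0, h))) (at p)" by (auto intro!: derivative_eq_intros)
  from has_derivative_compose[OF this H[unfolded y_def]]
  have "((\<lambda>p'. dual_hamiltonian L t q p') has_derivative (\<lambda>h. h \<bullet> Vf t q p)) (at p)"
    using linear_0[OF f1_linear] by (simp add: zero_prod_def[symmetric])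
  from grad_inner[OF this] have gp: "grad (\<lambda>p'. dual_hamiltonian L t q p') p = Vf t q p"
    by (intro vector_eq_rdot[THEN iffD1]) (simp add: inner_commute)
  have "((\<lambda>q'. (t, q', p)) has_derivative (\<lambda>h. (0, h, 0))) (at q)" by (auto intro!: derivative_eq_intros)
  from has_derivative_compose[OF this H[unfolded y_def]]
  have "((\<lambda>q'. dual_hamiltonian L t q' p) has_derivative (\<lambda>h. - (dq L t q (Vf t q p) \<bullet> h))) (at q)"
    by (simp add: dq_inner)
  from grad_inner[OF this] have gq: "grad (\<lambda>q'. dual_hamiltonian L t q' p) q = - dq L t q (Vf t q p)"
    by (intro vector_eq_rdot[THEN iffD1]) simp
  show ?thesis by (simp add: z ham_field_def X_def gp gq)
qed

lemma continuous_dVf: "continuous_on UNIV (\<lambda>y. dVf y h)"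
  unfolding continuous_on_def
proof
  fix y :: "real \<times> 'd phase"
  have c1: "continuous_on UNIV (\<lambda>y. ddv (lag y) h)" for h
    by (rule continuous_on_compose2[OF cont_ddv cont_lag]) simp
  show "((\<lambda>y. dVf y h) \<longlongrightarrow> dVf y h) (at y within UNIV)"
  proof (rule tendsto_linear_inverse[OF linear_dvv[of "lag y"] inj_dvv])
    show "((\<lambda>y. ddv (lag y) (0, 0, u)) \<longlongrightarrow> ddv (lag y) (0, 0, u)) (at y within UNIV)" for u
      using c1[of "(0, 0, u)"] unfolding continuous_on_def by blast
    have "continuous_on UNIV (\<lambda>y. snd (snd h) - ddv (lag y) (fst h, fst (snd h), 0))"
      by (intro continuous_intros c1)
    then show "((\<lambda>y. ddv (lag y) (0, 0, dVf y h)) \<longlongrightarrow> ddv (lag y) (0, 0, dVf y h)) (at y within UNIV)"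
      unfolding dVf_def ddv_ai continuous_on_def by blast
  qed (simp add: linear_dvv)
qed

sublocale C1_field X DX
proof
  fix t :: real and z u :: "'d phase"
  have e: "((\<lambda>z. (t, z)) has_derivative (\<lambda>h. (0, h))) (at z)" for z :: "'d phase"
    by (auto intro!: derivative_eq_intros)
  have l: "((\<lambda>z. lag (t, z)) has_derivative (\<lambda>h. (0, fst h, dVf (t, z) (0, h)))) (at z)"
    using has_derivative_compose[OF e lag_deriv[of "(t, z)"]] by simp
  have "((\<lambda>z. Vf t (fst z) (snd z)) has_derivative (\<lambda>h. dVf (t, z) (0, h))) (at z)"
    using has_derivative_snd[OF has_derivative_snd[OF l]] by simp
  moreover have "((\<lambda>z. dq L t (fst z) (Vf t (fst z) (snd z))) has_derivative
      (\<lambda>h. ddq (lag (t, z)) (0, fst h, dVf (t, z) (0, h)))) (at z)"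
    using has_derivative_compose[OF l dq_deriv] by simp
  ultimately show "(X t has_derivative DX t z) (at z)"
    unfolding X_def[abs_def] DX_def[abs_def] Let_def by (rule has_derivative_Pair)
  have "continuous_on UNIV (\<lambda>y. Vf (fst y) (fst (snd y)) (snd (snd y)))"
    using continuous_on_snd[OF continuous_on_snd[OF cont_lag]] by simp
  moreover have "continuous_on UNIV (\<lambda>y. dq L (fst (lag y)) (fst (snd (lag y))) (snd (snd (lag y))))"
    by (rule continuous_on_compose2[OF _ cont_lag, of UNIV])
       (use has_derivative_continuous[OF dq_deriv] in \<open>auto simp: continuous_on_eq_continuous_at\<close>)
  ultimately show "continuous_on UNIV (\<lambda>(t, z). X t z)"
    unfolding X_def case_prod_beta by (intro continuous_on_Pair) simp_all
  have c: "continuous_on UNIV (\<lambda>y. ddq (lag y) (0, fst u, dVf y (0, u)))"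
    by (rule continuous_on_linear_family[OF linear_ddq])
       (intro continuous_intros continuous_dVf continuous_on_compose2[OF cont_ddq cont_lag] subset_UNIV)+
  show "continuous_on UNIV (\<lambda>(t, z). DX t z u)"
    unfolding DX_def case_prod_beta Let_def
    using continuous_on_Pair[OF continuous_dVf[of "(0, u)"] c] by simp
qed

end

section \<open>Critical points and the main theorem\<close>

lemma periodic_frac:
  fixes g :: "real \<Rightarrow> 'a"
  assumes "\<And>t. g (t + 1) = g t"
  shows "g t = g (frac t)"
proof -
  have shift: "g (s + real n) = g s" for s n
  proof (induction n)
    case (Suc n)
    have "s + real (Suc n) = (s + real n) + 1" by simp
    then show ?case using assms[of "s + real n"] Suc by (simp only:)
  qed simp
  show ?thesis
  proof (cases "0 \<le> \<lfloor>t\<rfloor>")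
    case True
    then have "t = frac t + real (nat \<lfloor>t\<rfloor>)" by (simp add: frac_def)
    then show ?thesis using shift by metis
  next
    case False
    then have "frac t = t + real (nat (- \<lfloor>t\<rfloor>))" by (simp add: frac_def)
    then show ?thesis using shift by metis
  qed
qed

text \<open>Loops approximating g itself serve as test functions: the integral of |g|^2 equals that
  of <g, g - \<xi>>, which is at most M e.\<close>

lemma orthogonal_to_loops_imp_zero:
  fixes g :: "real \<Rightarrow> real^'d"
  assumes cont: "continuous_on {0..1} g" and "g 0 = g 1"
    and orth: "\<And>\<xi>. \<xi> \<in> loops \<Longrightarrow> integral {0..1} (\<lambda>t. g t \<bullet> \<xi> t) = 0" and t: "t \<in> {0..1}"
  shows "g t = 0"
proof -
  have intgg: "(\<lambda>t. g t \<bullet> g t) integrable_on {0..1}"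
    by (intro integrable_continuous_real continuous_on_inner cont)
  obtain M where M: "\<And>t. t \<in> {0..1} \<Longrightarrow> norm (g t) \<le> M"
    using continuous_on_compact_norm_bound[OF cont compact_Icc] by blast
  have "0 \<le> M" using M[of 0] norm_ge_zero[of "g 0"] by (meson atLeastAtMost_iff order_trans zero_le_one order_refl)
  have small: "integral {0..1} (\<lambda>t. g t \<bullet> g t) \<le> M * e" if e: "0 < e" for e
  proof -
    obtain \<xi> where \<xi>: "\<xi> \<in> loops" "\<And>t. t \<in> {0..1} \<Longrightarrow> norm (\<xi> t - g t) < e"
      using trigonometric_approximation[OF cont assms(2) e] by blast
    have cont\<xi>: "continuous_on {0..1} \<xi>" using \<xi>(1) smooth_velocity(3) by (auto simp: loops_def)
    have int: "(\<lambda>t. g t \<bullet> \<xi> t) integrable_on {0..1}" "(\<lambda>t. g t \<bullet> (g t - \<xi> t)) integrable_on {0..1}"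
      by (intro integrable_continuous_real continuous_intros cont cont\<xi>)+
    have "integral {0..1} (\<lambda>t. g t \<bullet> g t) = integral {0..1} (\<lambda>t. g t \<bullet> \<xi> t + g t \<bullet> (g t - \<xi> t))"
      by (simp add: inner_diff_right)
    also have "\<dots> = integral {0..1} (\<lambda>t. g t \<bullet> (g t - \<xi> t))"
      using Henstock_Kurzweil_Integration.integral_add[OF int] orth[OF \<xi>(1)] by simp
    also have "\<dots> \<le> integral {0..1::real} (\<lambda>_. M * e)"
    proof (rule integral_le[OF int(2) integrable_const_ivl])
      fix t :: real assume t: "t \<in> {0..1}"
      have "g t \<bullet> (g t - \<xi> t) \<le> norm (g t) * norm (g t - \<xi> t)" by (rule norm_cauchy_schwarz)
      also have "\<dots> \<le> M * e"
        using M[OF t] \<xi>(2)[OF t] \<open>0 \<le> M\<close> by (intro mult_mono) (auto simp: norm_minus_commute)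
      finally show "g t \<bullet> (g t - \<xi> t) \<le> M * e" .
    qed
    finally show ?thesis by simp
  qed
  have "integral {0..1} (\<lambda>t. g t \<bullet> g t) \<le> 0"
  proof (rule field_le_epsilon)
    fix e :: real assume e: "0 < e"
    have "integral {0..1} (\<lambda>t. g t \<bullet> g t) \<le> M * (e / (M + 1))"
      using e \<open>0 \<le> M\<close> by (intro small) simp
    also have "\<dots> \<le> e" using e \<open>0 \<le> M\<close> by (simp add: field_simps)
    finally show "integral {0..1} (\<lambda>t. g t \<bullet> g t) \<le> 0 + e" by simp
  qed
  moreover have "0 \<le> integral {0..1} (\<lambda>t. g t \<bullet> g t)" by (rule integral_nonneg[OF intgg]) simp
  ultimately have "integral (cbox 0 1) (\<lambda>t. g t \<bullet> g t) = 0" by simp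
  then have "((\<lambda>t. g t \<bullet> g t) has_integral 0) (cbox 0 1)"
    using integrable_integral[OF intgg] by simp
  then have "g t \<bullet> g t = 0"
    by (rule has_integral_0_cbox_imp_0[rotated 2]) (use cont t in \<open>auto intro!: continuous_on_inner\<close>)
  then show ?thesis by simp
qed

context tonelli_lagrangian
begin

lemma EL_imp_hamilton:
  assumes "open I" "EL_solution_on L I \<gamma>" "t \<in> I"
  shows "((\<lambda>s. (\<gamma> s, dv L s (\<gamma> s) (velocity \<gamma> s))) has_vector_derivative
    X t (\<gamma> t, dv L t (\<gamma> t) (velocity \<gamma> t))) (at t)"
proof -
  have "(\<gamma> has_vector_derivative velocity \<gamma> t) (at t)"
    "((\<lambda>s. dv L s (\<gamma> s) (velocity \<gamma> s)) has_vector_derivative dq L t (\<gamma> t) (velocity \<gamma> t)) (at t)"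
    using assms by (auto simp: EL_solution_on_def vector_derivative_works)
  from has_vector_derivative_Pair[OF this] show ?thesis by (simp add: X_def Vf_dv)
qed

lemma hamilton_imp_EL:
  assumes I: "open I" and x: "\<And>t. t \<in> I \<Longrightarrow> (x has_vector_derivative X t (x t)) (at t)"
  shows "EL_solution_on L I (\<lambda>t. fst (x t))"
    and "t \<in> I \<Longrightarrow> dv L t (fst (x t)) (velocity (\<lambda>t. fst (x t)) t) = snd (x t)"
proof -
  have d1: "((\<lambda>t. fst (x t)) has_vector_derivative fst (X t (x t))) (at t)" if "t \<in> I" for t
    by (rule bounded_linear.has_vector_derivative[OF bounded_linear_fst x[OF that]])
  have d2: "((\<lambda>t. snd (x t)) has_vector_derivative snd (X t (x t))) (at t)" if "t \<in> I" for t
    by (rule bounded_linear.has_vector_derivative[OF bounded_linear_snd x[OF that]])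
  have vel: "velocity (\<lambda>t. fst (x t)) t = Vf t (fst (x t)) (snd (x t))" if "t \<in> I" for t
    using vector_derivative_at[OF d1[OF that]] by (simp add: X_def)
  then have p: "dv L t (fst (x t)) (velocity (\<lambda>t. fst (x t)) t) = snd (x t)" if "t \<in> I" for t
    using that by (simp add: dv_Vf)
  then show "t \<in> I \<Longrightarrow> dv L t (fst (x t)) (velocity (\<lambda>t. fst (x t)) t) = snd (x t)" .
  show "EL_solution_on L I (\<lambda>t. fst (x t))"
    unfolding EL_solution_on_def
  proof (intro ballI conjI)
    fix t assume t: "t \<in> I"
    show "(\<lambda>t. fst (x t)) differentiable (at t)" using d1[OF t] by (rule differentiableI_vector)
    show "((\<lambda>s. dv L s (fst (x s)) (velocity (\<lambda>t. fst (x t)) s)) has_vector_derivative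
         dq L t (fst (x t)) (velocity (\<lambda>t. fst (x t)) t)) (at t)"
      by (rule has_vector_derivative_transform_within_open[OF _ I t])
         (use d2[OF t] vel[OF t] p in \<open>simp_all add: X_def\<close>)
  qed
qed

text \<open>A local Hamiltonian solution projects to a local Euler-Lagrange solution, completeness
  extends the latter to the whole line, and the Legendre transform lifts it back. Uniqueness
  identifies the result with \<open>ham_flow\<close>.\<close>

lemma ham_flow_exists:
  assumes "EL_complete L"
  shows "\<exists>\<phi>. (\<forall>z. \<phi> z 0 = z) \<and> (\<forall>z t. (\<phi> z has_vector_derivative X t (\<phi> z t)) (at t)) \<and>
    (\<forall>z t. ham_flow (dual_hamiltonian L) t z = \<phi> z t)"
proof -
  have "\<exists>y. y 0 = z \<and> (\<forall>t. (y has_vector_derivative X t (y t)) (at t))" for z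
  proof -
    obtain e x where e: "0 < e" and x: "x 0 = z" "\<And>t. t \<in> {-e<..<e} \<Longrightarrow> (x has_vector_derivative X t (x t)) (at t)"
      using local_solution[of z] by blast
    let ?\<gamma> = "\<lambda>t. fst (x t)"
    have "EL_solution_on L {-e<..<e} ?\<gamma>" by (rule hamilton_imp_EL(1)[OF open_greaterThanLessThan x(2)])
    moreover have "is_interval {-e<..<e}" by (auto simp: is_interval_1)
    moreover have "{-e<..<e} \<noteq> {}" using e by auto
    ultimately obtain \<gamma>' where \<gamma>': "EL_solution_on L UNIV \<gamma>'" "\<And>t. t \<in> {-e<..<e} \<Longrightarrow> \<gamma>' t = ?\<gamma> t"
      using assms unfolding EL_complete_def by (metis open_greaterThanLessThan)
    \<comment> \<open>The extension agrees with the local solution near 0, hence has the same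
      velocity and momentum there, so its lift starts at z.\<close>
    have 0: "0 \<in> {-e<..<e}" using e by simp
    have "(\<gamma>' has_vector_derivative velocity \<gamma>' 0) (at 0)"
      using \<gamma>'(1) by (simp add: EL_solution_on_def vector_derivative_works)
    then have "(?\<gamma> has_vector_derivative velocity \<gamma>' 0) (at 0)"
      by (rule has_vector_derivative_transform_within_open[OF _ open_greaterThanLessThan 0]) (rule \<gamma>'(2))
    then have "velocity ?\<gamma> 0 = velocity \<gamma>' 0" by (rule vector_derivative_at)
    then have "dv L 0 (\<gamma>' 0) (velocity \<gamma>' 0) = snd z"
      using hamilton_imp_EL(2)[OF open_greaterThanLessThan x(2) 0] \<gamma>'(2)[OF 0] x(1) by simp
    then show ?thesis
      using EL_imp_hamilton[OF open_UNIV \<gamma>'(1)] \<gamma>'(2)[OF 0] x(1)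
      by (intro exI[of _ "\<lambda>s. (\<gamma>' s, dv L s (\<gamma>' s) (velocity \<gamma>' s))"]) simp
  qed
  then obtain \<phi> where \<phi>: "\<And>z. \<phi> z 0 = z" "\<And>z t. (\<phi> z has_vector_derivative X t (\<phi> z t)) (at t)" by metis
  have "ham_flow (dual_hamiltonian L) t z = \<phi> z t" for z t
  proof -
    have "(THE x. x 0 = z \<and> (\<forall>s. (x has_vector_derivative X s (x s)) (at s))) = \<phi> z"
      by (rule the_equality) (use \<phi> unique_solution in auto)
    then show ?thesis by (simp add: ham_flow_def ham_field_eq)
  qed
  then show ?thesis using \<phi> by blast
qed

text \<open>For a smooth loop the momentum b has a derivative b' by the chain rule. Differentiation
  under the integral and integration by parts then make a - b' orthogonal to all loops; periodicity
  removes the boundary terms and carries the conclusion from [0, 1] to the whole line.\<close>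

lemma critical_imp_EL:
  assumes crit: "critical_point L \<gamma>"
  shows "EL_solution_on L UNIV \<gamma>"
proof -
  have \<gamma>: "\<gamma> \<in> loops" and smooth: "smooth \<gamma>" and per: "\<gamma> (t + 1) = \<gamma> t" for t
    using crit by (auto simp: critical_point_def loops_def)
  define c where "c = velocity \<gamma>"
  define cc where "cc = velocity c"
  have d: "(\<gamma> has_vector_derivative c t) (at t)" "(c has_vector_derivative cc t) (at t)" for t
    unfolding c_def cc_def using smooth_velocity(1,2)[OF smooth] smooth_velocity(1) by blast+
  have cont: "continuous_on S \<gamma>" "continuous_on S c" "continuous_on S cc" for S
    unfolding c_def cc_def using smooth_velocity(2-4)[OF smooth] smooth_velocity(4) by blast+
  define x where "x t = (t, \<gamma> t, c t)" for t
  define a where "a t = dq L t (\<gamma> t) (c t)" for t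
  define b where "b t = dv L t (\<gamma> t) (c t)" for t
  define b' where "b' t = ddv (x t) (1, c t, cc t)" for t
  have contx: "continuous_on S x" for S unfolding x_def by (intro continuous_intros cont)
  have db: "(b has_vector_derivative b' t) (at t)" for t
  proof -
    have "(x has_derivative (\<lambda>h. h *\<^sub>R (1, c t, cc t))) (at t)"
      unfolding x_def has_vector_derivative_def[symmetric]
      by (intro has_vector_derivative_Pair d has_vector_derivative_id)
    from has_derivative_compose[OF this dv_deriv]
    show ?thesis
      by (simp add: has_vector_derivative_def linear_cmul[OF linear_ddv, of _ _ "(1, c t, cc t)", simplified] b'_def b_def[abs_def] x_def)
  qed
  have cont_a: "continuous_on S a" for S
  proof -
    have "continuous_on UNIV (\<lambda>y. dq L (fst y) (fst (snd y)) (snd (snd y)))"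
      using has_derivative_continuous[OF dq_deriv] by (simp add: continuous_on_eq_continuous_at)
    from continuous_on_compose2[OF this contx] show ?thesis by (simp add: x_def a_def[abs_def])
  qed
  have cont_b: "continuous_on S b" for S
    using db has_vector_derivative_continuous continuous_at_imp_continuous_on by blast
  have cont_b': "continuous_on S b'" for S
    unfolding b'_def
    by (rule continuous_on_linear_family[OF linear_ddv])
       (intro continuous_on_compose2[OF cont_ddv contx] subset_UNIV continuous_intros cont)+
  have c_per: "c (t + 1) = c t" for t
  proof -
    have "((\<lambda>s. s + 1) has_vector_derivative 1) (at t)" by (auto intro!: derivative_eq_intros)
    from vector_diff_chain_at[OF this d(1)[of "t + 1"]]
    have "(\<gamma> has_vector_derivative c (t + 1)) (at t)" by (simp add: o_def per)
    then show ?thesis using vector_derivative_at[OF d(1)] vector_derivative_at by metis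
  qed
  have L_per: "L (t + 1) = L t" for t
    using tonelli by (auto simp: tonelli_def fun_eq_iff)
  have a_per: "a (t + 1) = a t" and b_per: "b (t + 1) = b t" for t
    by (simp_all add: a_def b_def dq_def dv_def L_per per c_per)
  have b'_per: "b' (t + 1) = b' t" for t
  proof -
    have "((\<lambda>s. s + 1) has_vector_derivative 1) (at t)" by (auto intro!: derivative_eq_intros)
    from vector_diff_chain_at[OF this db[of "t + 1"]]
    have "(b has_vector_derivative b' (t + 1)) (at t)" by (simp add: o_def b_per)
    then show ?thesis using vector_derivative_at[OF db] vector_derivative_at by metis
  qed
  have orth: "integral {0..1} (\<lambda>t. (a t - b' t) \<bullet> \<xi> t) = 0" if \<xi>: "\<xi> \<in> loops" for \<xi>
  proof -
    define e where "e = velocity \<xi>"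
    have sm: "smooth \<xi>" and p\<xi>: "\<xi> 1 = \<xi> 0" using \<xi> by (auto simp: loops_def dest: spec[of _ 0])
    have de: "(\<xi> has_vector_derivative e t) (at t)" for t unfolding e_def by (rule smooth_velocity(1)[OF sm])
    have ce: "continuous_on S \<xi>" "continuous_on S e" for S unfolding e_def by (rule smooth_velocity(3,4)[OF sm])+
    have vel: "velocity (\<gamma> + s *\<^sub>R \<xi>) t = c t + s *\<^sub>R e t" for s t
    proof -
      have "((\<lambda>t. \<gamma> t + s *\<^sub>R \<xi> t) has_vector_derivative c t + s *\<^sub>R e t) (at t)"
        by (intro has_vector_derivative_add d bounded_linear.has_vector_derivative[OF bounded_linear_scaleR_right de])
      then show ?thesis unfolding plus_fun_def scaleR_fun_def by (rule vector_derivative_at)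
    qed
    define y where "y s t = (t, \<gamma> t + s *\<^sub>R \<xi> t, c t + s *\<^sub>R e t)" for s t
    have act: "action L (\<gamma> + s *\<^sub>R \<xi>) = integral (cbox 0 1) (\<lambda>t. f (y s t))" for s
      unfolding action_def vel by (simp add: y_def f_apply scaleR_fun_def)
    have c2: "continuous_on S (\<lambda>p. y (fst p) (snd p))" for S
      unfolding y_def
      by (intro continuous_intros continuous_on_compose2[OF cont(1)[of UNIV]] continuous_on_compose2[OF cont(2)[of UNIV]]
          continuous_on_compose2[OF ce(1)[of UNIV]] continuous_on_compose2[OF ce(2)[of UNIV]]) auto
    have cy: "continuous_on S (y s)" for S s
      unfolding y_def by (intro continuous_intros cont ce)
    have dy: "((\<lambda>s. f (y s t)) has_field_derivative f1 (y s t) (0, \<xi> t, e t)) (at s within UNIV)" for s t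
    proof -
      have "((\<lambda>s. y s t) has_derivative (\<lambda>h. h *\<^sub>R (0, \<xi> t, e t))) (at s)"
        unfolding y_def by (auto intro!: derivative_eq_intros)
      from has_derivative_compose[OF this f_deriv] show ?thesis
        by (simp add: has_field_derivative_def linear_cmul[OF f1_linear, of _ _ "(0, \<xi> t, e t)", simplified] mult_commute_abs)
    qed
    have contf: "continuous_on UNIV f"
      using has_derivative_continuous[OF f_deriv] by (simp add: continuous_on_eq_continuous_at)
    have "((\<lambda>s. integral (cbox 0 1) (\<lambda>t. f (y s t))) has_field_derivative
        integral (cbox 0 1) (\<lambda>t. f1 (y 0 t) (0, \<xi> t, e t))) (at 0 within UNIV)"
    proof (rule leibniz_rule_field_derivative[OF dy])
      show "(\<lambda>t. f (y s t)) integrable_on cbox 0 1" for s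
        by (intro integrable_continuous continuous_on_compose2[OF contf cy]) auto
      show "continuous_on (UNIV \<times> cbox 0 1) (\<lambda>(s, t). f1 (y s t) (0, \<xi> t, e t))"
        unfolding case_prod_beta
        by (rule continuous_on_linear_family[OF f1_linear])
           (intro continuous_on_compose2[OF f1_cont c2] subset_UNIV continuous_intros
             continuous_on_compose2[OF ce(1)[of UNIV]] continuous_on_compose2[OF ce(2)[of UNIV]])+
    qed auto
    moreover have "f1 (y 0 t) (0, \<xi> t, e t) = a t \<bullet> \<xi> t + b t \<bullet> e t" for t
      using linear_add[OF f1_linear, of "y 0 t" "(0, \<xi> t, 0)" "(0, 0, e t)"]
      by (simp add: a_def b_def dq_inner dv_inner y_def)
    ultimately have "((\<lambda>s. action L (\<gamma> + s *\<^sub>R \<xi>)) has_field_derivative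
        integral {0..1} (\<lambda>t. a t \<bullet> \<xi> t + b t \<bullet> e t)) (at 0)"
      by (simp add: act)
    moreover have "((\<lambda>s. action L (\<gamma> + s *\<^sub>R \<xi>)) has_field_derivative 0) (at 0)"
      using crit \<xi> by (simp add: critical_point_def)
    ultimately have 1: "integral {0..1} (\<lambda>t. a t \<bullet> \<xi> t + b t \<bullet> e t) = 0" by (rule DERIV_unique)
    have i1: "(\<lambda>t. a t \<bullet> \<xi> t + b t \<bullet> e t) integrable_on {0..1}"
      by (intro integrable_continuous_real continuous_intros cont_a cont_b ce)
    have "((\<lambda>t. b t \<bullet> e t + b' t \<bullet> \<xi> t) has_integral b 1 \<bullet> \<xi> 1 - b 0 \<bullet> \<xi> 0) {0..1}"
      by (rule fundamental_theorem_of_calculus[OF zero_le_one has_vector_derivative_at_within[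
            OF bounded_bilinear.has_vector_derivative[OF bounded_bilinear_inner db de]]])
    moreover have "b 1 = b 0" using b_per[of 0] by simp
    ultimately have "((\<lambda>t. b t \<bullet> e t + b' t \<bullet> \<xi> t) has_integral 0) {0..1}" by (simp add: p\<xi>)
    from has_integral_diff[OF integrable_integral[OF i1] this]
    have "((\<lambda>t. (a t - b' t) \<bullet> \<xi> t) has_integral 0) {0..1}" by (simp add: 1 inner_diff_left)
    then show ?thesis by (rule integral_unique)
  qed
  have "a t - b' t = 0" for t
  proof -
    have "a t - b' t = a (frac t) - b' (frac t)"
      by (rule periodic_frac[of "\<lambda>t. a t - b' t"]) (simp add: a_per b'_per)
    also have "\<dots> = 0"
    proof (rule orthogonal_to_loops_imp_zero[of "\<lambda>t. a t - b' t"])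
      show "a 0 - b' 0 = a 1 - b' 1" using a_per[of 0] b'_per[of 0] by simp
      show "frac t \<in> {0..1}" using frac_lt_1[of t] by (simp add: less_imp_le)
    qed (intro continuous_intros cont_a cont_b', rule orth)
    finally show ?thesis .
  qed
  then have "(b has_vector_derivative a t) (at t)" for t using db[of t] by simp
  then show ?thesis
    using d(1) unfolding EL_solution_on_def
    by (auto simp: b_def[abs_def] a_def c_def intro: differentiableI_vector)
qed

text \<open>The Hamiltonian orbit through the initial state is the lift of \<gamma>, so \<Gamma>
  solves the variational equation along \<gamma>. There \<open>DX\<close> is the linear Hamiltonian
  system with coefficients \<alpha>, \<beta>, \<delta>, which places the problem in
  \<open>linear_lagrangian\<close>.\<close>

lemma index_eq_maslov:
  assumes complete: "EL_complete L" and crit: "critical_point L \<gamma>"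
  shows "\<exists>n. morse_index L \<gamma> = enat n \<and> maslov_index (symplectic_path L \<gamma>) = int n"
proof -
  obtain \<phi> where \<phi>: "\<And>z. \<phi> z 0 = z" "\<And>z t. (\<phi> z has_vector_derivative X t (\<phi> z t)) (at t)"
    and flow: "\<And>z t. ham_flow (dual_hamiltonian L) t z = \<phi> z t"
    using ham_flow_exists[OF complete] by blast
  define c where "c = velocity \<gamma>"
  define z0 where "z0 = (\<gamma> 0, dv L 0 (\<gamma> 0) (c 0))"
  have EL: "EL_solution_on L UNIV \<gamma>" by (rule critical_imp_EL[OF crit])
  have "\<phi> z0 = (\<lambda>t. (\<gamma> t, dv L t (\<gamma> t) (c t)))"
    using EL_imp_hamilton[OF open_UNIV EL] unfolding c_def z0_def
    by (intro unique_solution \<phi>(2)) (simp_all add: \<phi>(1))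
  then have \<phi>z0: "\<phi> z0 t = (\<gamma> t, dv L t (\<gamma> t) (c t))" for t by simp
  obtain W where W0: "\<And>w. W 0 w = w"
    and W: "\<And>w t. t \<in> {0..1} \<Longrightarrow> ((\<lambda>t. W t w) has_vector_derivative DX t (\<phi> z0 t) (W t w)) (at t within {0..1})"
    and dW: "\<And>t. t \<in> {0..1} \<Longrightarrow> ((\<lambda>z. \<phi> z t) has_derivative W t) (at z0)"
    using flow_has_derivative[OF \<phi>, of z0] by blast
  define \<Gamma> where "\<Gamma> = symplectic_path L \<gamma>"
  have \<Gamma>W: "\<Gamma> t = W t" if "t \<in> {0..1}" for t
    using frechet_derivative_at[OF dW[OF that]]
    by (simp add: \<Gamma>_def symplectic_path_def flow[abs_def] z0_def c_def)
  define x where "x t = (t, \<gamma> t, c t)" for t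
  define \<alpha> where "\<alpha> t = dvv L t (\<gamma> t) (c t)" for t
  define \<beta> where "\<beta> t = dqv L t (\<gamma> t) (c t)" for t
  define \<delta> where "\<delta> t = dqq L t (\<gamma> t) (c t)" for t
  \<comment> \<open>The mixed second derivative taken in the other order; symmetry of second
    derivatives makes it the adjoint of \<beta>.\<close>
  define \<beta>t where "\<beta>t t v = ddq (x t) (0, 0, v)" for t v
  define V where "V t z = ai (x t) (snd z - \<beta> t (fst z))" for t and z :: "'d phase"
  have \<alpha>: "\<alpha> t h = ddv (x t) (0, 0, h)" and \<beta>: "\<beta> t h = ddv (x t) (0, h, 0)"
    and \<delta>: "\<delta> t h = ddq (x t) (0, h, 0)" for t h
    by (simp_all add: \<alpha>_def \<beta>_def \<delta>_def x_def dvv_eq dqv_eq dqq_eq)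
  have "smooth \<gamma>" using crit by (simp add: critical_point_def loops_def)
  then have contx: "continuous_on S x" for S
    unfolding x_def c_def by (intro continuous_intros smooth_velocity)
  have DX: "DX t (\<phi> z0 t) w = (V t w, \<beta>t t (V t w) + \<delta> t (fst w))" for t w
  proof -
    have "lag (t, \<phi> z0 t) = x t" by (simp add: \<phi>z0 Vf_dv x_def)
    moreover from this have "dVf (t, \<phi> z0 t) (0, w) = V t w" by (simp add: dVf_def V_def \<beta>)
    moreover have "ddq (x t) (0, fst w, V t w) = \<beta>t t (V t w) + \<delta> t (fst w)"
      using linear_add[OF linear_ddq, of "x t" "(0, 0, V t w)" "(0, fst w, 0)"] by (simp add: \<beta>t_def \<delta>)
    ultimately show ?thesis by (simp add: DX_def Let_def)
  qed
  interpret linear_lagrangian \<alpha> \<beta> \<beta>t \<delta> V \<Gamma>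
  proof (rule linear_lagrangian.intro)
    fix t :: real and u w v :: "real^'d" and z :: "'d phase"
    show "linear (\<alpha> t)" unfolding \<alpha>[abs_def] by (rule linear_ddv[THEN linear_compose[rotated], unfolded o_def]) (auto intro!: linearI)
    show "linear (\<beta> t)" unfolding \<beta>[abs_def] by (rule linear_ddv[THEN linear_compose[rotated], unfolded o_def]) (auto intro!: linearI)
    show "linear (\<delta> t)" unfolding \<delta>[abs_def] by (rule linear_ddq[THEN linear_compose[rotated], unfolded o_def]) (auto intro!: linearI)
    show "continuous_on {0..1} (\<lambda>t. \<alpha> t u)" unfolding \<alpha> by (rule continuous_on_compose2[OF cont_ddv contx]) simp
    show "continuous_on {0..1} (\<lambda>t. \<beta> t u)" unfolding \<beta> by (rule continuous_on_compose2[OF cont_ddv contx]) simp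
    show "continuous_on {0..1} (\<lambda>t. \<delta> t u)" unfolding \<delta> by (rule continuous_on_compose2[OF cont_ddq contx]) simp
    show "\<alpha> t u \<bullet> w = \<alpha> t w \<bullet> u" unfolding \<alpha> ddv_inner by (rule f2_sym)
    show "\<delta> t u \<bullet> w = \<delta> t w \<bullet> u" unfolding \<delta> ddq_inner by (rule f2_sym)
    show "\<beta>t t v \<bullet> u = v \<bullet> \<beta> t u"
      unfolding \<beta>t_def \<beta> inner_commute[of v] ddv_inner ddq_inner by (rule f2_sym)
    show "0 < \<alpha> t w \<bullet> w" if "w \<noteq> 0" unfolding \<alpha> x_def by (rule dvv_pos[OF that])
    show "\<alpha> t (V t z) + \<beta> t (fst z) = snd z" by (simp add: \<alpha> V_def ddv_ai)
    show "\<Gamma> 0 z = z" by (simp add: \<Gamma>W W0)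
    assume t: "t \<in> {0..1}"
    show "linear (\<Gamma> t)" unfolding \<Gamma>W[OF t] by (rule has_derivative_linear[OF dW[OF t]])
    have "((\<lambda>t. \<Gamma> t z) has_vector_derivative (V t (\<Gamma> t z), \<beta>t t (V t (\<Gamma> t z)) + \<delta> t (fst (\<Gamma> t z)))) (at t within {0..1})"
      by (rule has_vector_derivative_transform[OF t _ W[OF t, of z, unfolded DX, folded \<Gamma>W[OF t]]]) (simp add: \<Gamma>W)
    from bounded_linear.has_vector_derivative[OF bounded_linear_fst this]
      bounded_linear.has_vector_derivative[OF bounded_linear_snd this]
    show "((\<lambda>t. fst (\<Gamma> t z)) has_vector_derivative V t (\<Gamma> t z)) (at t within {0..1})"
      "((\<lambda>t. snd (\<Gamma> t z)) has_vector_derivative \<beta>t t (V t (\<Gamma> t z)) + \<delta> t (fst (\<Gamma> t z))) (at t within {0..1})"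
      by simp_all
  qed
  have "hess = hess_action L \<gamma>"
    by (intro ext) (simp add: hess_def ell_def hess_action_def Let_def \<alpha>_def \<beta>_def \<delta>_def c_def)
  then show ?thesis using index_eq_maslov by (simp add: morse_index_def \<Gamma>_def)
qed

end

theorem theorem4p1:
  fixes L :: "real \<Rightarrow> real^'d \<Rightarrow> real^'d \<Rightarrow> real"
    and \<gamma> :: "real \<Rightarrow> real^'d"
  assumes "tonelli L"
    and "EL_complete L"
    and "critical_point L \<gamma>"
  shows "\<exists>n. morse_index L \<gamma> = enat n \<and> maslov_index (symplectic_path L \<gamma>) = int n"
proof -
  interpret tonelli_lagrangian L by unfold_locales (rule assms(1))
  show ?thesis by (rule index_eq_maslov[OF assms(2,3)])
qed

end
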